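(* Let $A$ be an Artin algebra and let $Y$ be a double semi-Gorenstein-projective left $A$-module which is not torsionless. Let $\varphi:Y\to P$ be a left $\mathrm{add}(A)$-approximation of $Y$. Then $\binom{P}{Y}_\varphi$ is a double semi-Gorenstein-projective $T_2(A)$-module which is not monic. In particular, $\binom{P}{Y}_\varphi$ is not torsionless.
   Context: All modules are finitely generated. For an Artin algebra $R$ and a left or right $R$-module $N$, $N^*=\mathrm{Hom}_R(N,R)$, and $\phi_N:N\to N^{**}$, $\phi_N(n)(f)=f(n)$, is the canonical map. $N$ is torsionless if $\phi_N$ is a monomorphism (equivalently $N$ is a submodule of a projective module). $N$ is semi-Gorenstein-projective if $\mathrm{Ext}_R^i(N,R)=0$ for all $i\ge1$; $N$ is double semi-Gorenstein-projective if both $N$ and $N^*$ are semi-Gorenstein-projective. $\mathrm{add}(A)$ is the category of projective left $A$-modules. A left $\mathrm{add}(A)$-approximation of $Y$ is an $A$-map $\varphi:Y\to P$ with $P\in\mathrm{add}(A)$ such that every $A$-map from $Y$ to a module in $\mathrm{add}(A)$ factors through $\varphi$. $T_2(A)=\begin{pmatrix}A&A\\0&A\end{pmatrix}$. A left $T_2(A)$-module is identified with a triple $\binom{X}{Y}_\varphi$, where $X,Y$ are left $A$-modules and $\varphi:Y\to X$ is a left $A$-map; the action is $\begin{pmatrix}a_1&a_2\\0&a_3\end{pmatrix}\binom{x}{y}=\binom{a_1x+a_2\varphi(y)}{a_3y}$. It is monic if $\varphi$ is a monomorphism. *)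

theory Defs
  imports "HOL-Algebra.Module" "HOL-Algebra.Ideal" "HOL-Algebra.Elementary_Groups"
begin

section \<open>Modules over noncommutative rings\<close>

text \<open>
  The library's module locale asks for a commutative ring of scalars, so modules over an arbitrary
  ring are set up here on top of the library record.  The multiplicative fields of that record
  carry no information for a module and are left \<open>undefined\<close> where nothing natural is available.
\<close>

locale left_module = R?: ring R + M?: abelian_group M
  for R :: "'a ring" (structure) and M :: "('a, 'm) module" (structure) +
  assumes smult_closed:
      "\<lbrakk>a \<in> carrier R; x \<in> carrier M\<rbrakk> \<Longrightarrow> a \<odot>\<^bsub>M\<^esub> x \<in> carrier M"
    and smult_l_distr:
      "\<lbrakk>a \<in> carrier R; b \<in> carrier R; x \<in> carrier M\<rbrakk>
        \<Longrightarrow> (a \<oplus>\<^bsub>R\<^esub> b) \<odot>\<^bsub>M\<^esub> x = a \<odot>\<^bsub>M\<^esub> x \<oplus>\<^bsub>M\<^esub> b \<odot>\<^bsub>M\<^esub> x"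
    and smult_r_distr:
      "\<lbrakk>a \<in> carrier R; x \<in> carrier M; y \<in> carrier M\<rbrakk>
        \<Longrightarrow> a \<odot>\<^bsub>M\<^esub> (x \<oplus>\<^bsub>M\<^esub> y) = a \<odot>\<^bsub>M\<^esub> x \<oplus>\<^bsub>M\<^esub> a \<odot>\<^bsub>M\<^esub> y"
    and smult_assoc:
      "\<lbrakk>a \<in> carrier R; b \<in> carrier R; x \<in> carrier M\<rbrakk>
        \<Longrightarrow> (a \<otimes>\<^bsub>R\<^esub> b) \<odot>\<^bsub>M\<^esub> x = a \<odot>\<^bsub>M\<^esub> (b \<odot>\<^bsub>M\<^esub> x)"
    and smult_one:
      "x \<in> carrier M \<Longrightarrow> \<one>\<^bsub>R\<^esub> \<odot>\<^bsub>M\<^esub> x = x"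

text \<open>A right \<open>R\<close>-module is a left module over \<open>opposite_ring R\<close>, with \<open>r \<odot> x\<close> standing for \<open>x r\<close>.\<close>

definition opposite_ring :: "'a ring \<Rightarrow> 'a ring" where
  "opposite_ring R = R\<lparr>mult := \<lambda>a b. b \<otimes>\<^bsub>R\<^esub> a\<rparr>"

definition regular_module :: "'a ring \<Rightarrow> ('a, 'a) module" where
  "regular_module R =
     \<lparr>carrier = carrier R, mult = mult R, one = \<one>\<^bsub>R\<^esub>, zero = \<zero>\<^bsub>R\<^esub>, add = add R, smult = mult R\<rparr>"

definition fg_module :: "'a ring \<Rightarrow> ('a, 'm) module \<Rightarrow> bool" where
  "fg_module R M \<longleftrightarrow> left_module R M \<and>
     (\<exists>S \<subseteq> carrier M. finite S \<and>
        (\<forall>x \<in> carrier M. \<exists>c \<in> S \<rightarrow> carrier R. x = (\<Oplus>\<^bsub>M\<^esub>s\<in>S. c s \<odot>\<^bsub>M\<^esub> s)))"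

text \<open>Homomorphisms are taken extensional on the carrier, so that equality of maps is equality in HOL.\<close>

definition lin_maps :: "'a ring \<Rightarrow> ('a, 'm) module \<Rightarrow> ('a, 'n) module \<Rightarrow> ('m \<Rightarrow> 'n) set" where
  "lin_maps R M N =
     {f \<in> carrier M \<rightarrow>\<^sub>E carrier N.
        (\<forall>x \<in> carrier M. \<forall>y \<in> carrier M. f (x \<oplus>\<^bsub>M\<^esub> y) = f x \<oplus>\<^bsub>N\<^esub> f y) \<and>
        (\<forall>r \<in> carrier R. \<forall>x \<in> carrier M. f (r \<odot>\<^bsub>M\<^esub> x) = r \<odot>\<^bsub>N\<^esub> f x)}"

definition free_module :: "'a ring \<Rightarrow> nat \<Rightarrow> ('a, nat \<Rightarrow> 'a) module" where
  "free_module R n =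
     \<lparr>carrier = {..<n} \<rightarrow>\<^sub>E carrier R, mult = undefined, one = undefined,
      zero = (\<lambda>i\<in>{..<n}. \<zero>\<^bsub>R\<^esub>),
      add = (\<lambda>v w. \<lambda>i\<in>{..<n}. v i \<oplus>\<^bsub>R\<^esub> w i),
      smult = (\<lambda>r v. \<lambda>i\<in>{..<n}. r \<otimes>\<^bsub>R\<^esub> v i)\<rparr>"

text \<open>
  Membership in \<open>add(R)\<close>: \<open>P\<close> is (isomorphic to) a direct summand of some \<open>R\<^sup>n\<close>, the inclusion being
  \<open>s\<close> and the projection \<open>r\<close>.
\<close>

definition in_add :: "'a ring \<Rightarrow> ('a, 'm) module \<Rightarrow> bool" where
  "in_add R P \<longleftrightarrow> left_module R P \<and>
     (\<exists>n. \<exists>s \<in> lin_maps R P (free_module R n). \<exists>r \<in> lin_maps R (free_module R n) P.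
        \<forall>x \<in> carrier P. r (s x) = x)"

text \<open>
  The test modules \<open>Q\<close> range over the type \<open>nat \<Rightarrow> 'a\<close>; every member of \<open>add(R)\<close>, whatever its
  element type, has an isomorphic copy there, as a submodule of some \<^term>\<open>free_module R n\<close>.
\<close>

definition left_add_approximation ::
    "'a ring \<Rightarrow> ('a, 'y) module \<Rightarrow> ('a, 'p) module \<Rightarrow> ('y \<Rightarrow> 'p) \<Rightarrow> bool" where
  "left_add_approximation R Y P \<phi> \<longleftrightarrow>
     in_add R P \<and> \<phi> \<in> lin_maps R Y P \<and>
     (\<forall>Q :: ('a, nat \<Rightarrow> 'a) module. in_add R Q \<longrightarrow>
        (\<forall>f \<in> lin_maps R Y Q. \<exists>g \<in> lin_maps R P Q. \<forall>y \<in> carrier Y. f y = g (\<phi> y)))"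


section \<open>Duals and torsionless modules\<close>

text \<open>
  \<open>N\<^sup>*\<close> of a left \<open>R\<close>-module is the right \<open>R\<close>-module with \<open>(f r)(n) = f(n) r\<close>.  Duals of right modules
  are obtained by replacing \<open>R\<close> with its opposite; note that the opposite of the opposite of \<open>R\<close> is \<open>R\<close>.
\<close>

definition dual :: "'a ring \<Rightarrow> ('a, 'n) module \<Rightarrow> ('a, 'n \<Rightarrow> 'a) module" where
  "dual R N =
     \<lparr>carrier = lin_maps R N (regular_module R), mult = undefined, one = undefined,
      zero = (\<lambda>x\<in>carrier N. \<zero>\<^bsub>R\<^esub>),
      add = (\<lambda>f g. \<lambda>x\<in>carrier N. f x \<oplus>\<^bsub>R\<^esub> g x),
      smult = (\<lambda>r f. \<lambda>x\<in>carrier N. f x \<otimes>\<^bsub>R\<^esub> r)\<rparr>"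

text \<open>The canonical map from \<open>N\<close> to \<^term>\<open>dual (opposite_ring R) (dual R N)\<close>.\<close>

definition canonical_map :: "'a ring \<Rightarrow> ('a, 'n) module \<Rightarrow> 'n \<Rightarrow> ('n \<Rightarrow> 'a) \<Rightarrow> 'a" where
  "canonical_map R N = (\<lambda>x\<in>carrier N. \<lambda>f\<in>carrier (dual R N). f x)"

definition torsionless :: "'a ring \<Rightarrow> ('a, 'n) module \<Rightarrow> bool" where
  "torsionless R N \<longleftrightarrow> inj_on (canonical_map R N) (carrier N)"


section \<open>Ext and semi-Gorenstein-projective modules\<close>

definition Hom_group :: "'a ring \<Rightarrow> ('a, 'm) module \<Rightarrow> ('a, 'n) module \<Rightarrow> ('m \<Rightarrow> 'n) monoid" where
  "Hom_group R M N =
     \<lparr>carrier = lin_maps R M N,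
      mult = (\<lambda>f g. \<lambda>x\<in>carrier M. f x \<oplus>\<^bsub>N\<^esub> g x),
      one = (\<lambda>x\<in>carrier M. \<zero>\<^bsub>N\<^esub>)\<rparr>"

text \<open>
  \<open>\<cdots> \<rightarrow> P 2 \<rightarrow> P 1 \<rightarrow> P 0 \<rightarrow> N \<rightarrow> 0\<close>, with \<open>d i : P (i+1) \<rightarrow> P i\<close> and augmentation \<open>\<epsilon> : P 0 \<rightarrow> N\<close>; the
  \<open>P i\<close> are finitely generated projective.
\<close>

definition projective_resolution ::
    "'a ring \<Rightarrow> ('a, 'n) module \<Rightarrow> (nat \<Rightarrow> ('a, 'p) module) \<Rightarrow> (nat \<Rightarrow> 'p \<Rightarrow> 'p) \<Rightarrow> ('p \<Rightarrow> 'n) \<Rightarrow> bool" where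
  "projective_resolution R N P d \<epsilon> \<longleftrightarrow>
     (\<forall>i. in_add R (P i)) \<and>
     (\<forall>i. d i \<in> lin_maps R (P (Suc i)) (P i)) \<and>
     \<epsilon> \<in> lin_maps R (P 0) N \<and>
     \<epsilon> ` carrier (P 0) = carrier N \<and>
     d 0 ` carrier (P 1) = {x \<in> carrier (P 0). \<epsilon> x = \<zero>\<^bsub>N\<^esub>} \<and>
     (\<forall>i. d (Suc i) ` carrier (P (Suc (Suc i))) = {x \<in> carrier (P (Suc i)). d i x = \<zero>\<^bsub>P i\<^esub>})"

definition coboundary ::
    "(nat \<Rightarrow> ('a, 'p) module) \<Rightarrow> (nat \<Rightarrow> 'p \<Rightarrow> 'p) \<Rightarrow> nat \<Rightarrow> ('p \<Rightarrow> 'm) \<Rightarrow> ('p \<Rightarrow> 'm)" where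
  "coboundary P d i f = compose (carrier (P (Suc i))) f (d i)"

text \<open>The \<open>i\<close>-th cohomology group of \<open>0 \<rightarrow> Hom(P 0, M) \<rightarrow> Hom(P 1, M) \<rightarrow> \<cdots>\<close>\<close>

definition Ext_group ::
    "'a ring \<Rightarrow> (nat \<Rightarrow> ('a, 'p) module) \<Rightarrow> (nat \<Rightarrow> 'p \<Rightarrow> 'p) \<Rightarrow> ('a, 'm) module \<Rightarrow> nat
      \<Rightarrow> ('p \<Rightarrow> 'm) set monoid" where
  "Ext_group R P d M i =
     (Hom_group R (P i) M)
        \<lparr>carrier := kernel (Hom_group R (P i) M) (Hom_group R (P (Suc i)) M) (coboundary P d i)\<rparr>
     Mod
     (case i of
        0 \<Rightarrow> {\<one>\<^bsub>Hom_group R (P 0) M\<^esub>}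
      | Suc j \<Rightarrow> coboundary P d j ` lin_maps R (P j) M)"

text \<open>
  \<open>Ext\<^sup>i(N, M) = 0\<close>.  As \<open>Ext\<close> does not depend on the resolution, all of them are required to give the
  trivial group; the first conjunct rules out vacuous truth, and holds automatically for a finitely
  generated module over an Artin algebra.  Every finitely generated projective module has an
  isomorphic copy with elements of type \<open>nat \<Rightarrow> 'a\<close>, so fixing that type loses no resolutions.
\<close>

definition Ext_vanishes :: "'a ring \<Rightarrow> nat \<Rightarrow> ('a, 'n) module \<Rightarrow> ('a, 'm) module \<Rightarrow> bool" where
  "Ext_vanishes R i N M \<longleftrightarrow>
     (\<exists>(P :: nat \<Rightarrow> ('a, nat \<Rightarrow> 'a) module) d \<epsilon>. projective_resolution R N P d \<epsilon>) \<and>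
     (\<forall>(P :: nat \<Rightarrow> ('a, nat \<Rightarrow> 'a) module) d \<epsilon>. projective_resolution R N P d \<epsilon> \<longrightarrow>
        trivial_group (Ext_group R P d M i))"

definition semi_Gorenstein_projective :: "'a ring \<Rightarrow> ('a, 'n) module \<Rightarrow> bool" where
  "semi_Gorenstein_projective R N \<longleftrightarrow>
     fg_module R N \<and> (\<forall>i\<ge>1. Ext_vanishes R i N (regular_module R))"

definition double_semi_Gorenstein_projective :: "'a ring \<Rightarrow> ('a, 'n) module \<Rightarrow> bool" where
  "double_semi_Gorenstein_projective R N \<longleftrightarrow>
     semi_Gorenstein_projective R N \<and> semi_Gorenstein_projective (opposite_ring R) (dual R N)"


section \<open>Artin algebras and upper triangular matrices\<close>

definition artinian_cring :: "'k ring \<Rightarrow> bool" where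
  "artinian_cring k \<longleftrightarrow> cring k \<and>
     (\<forall>I :: nat \<Rightarrow> 'k set. (\<forall>n. ideal (I n) k) \<and> (\<forall>n. I (Suc n) \<subseteq> I n) \<longrightarrow>
        (\<exists>m. \<forall>n\<ge>m. I n = I m))"

text \<open>\<open>A\<close> is an algebra over the commutative artinian ring \<open>k\<close> via \<open>\<eta>\<close>, finitely generated as a \<open>k\<close>-module.\<close>

definition artin_algebra :: "'k ring \<Rightarrow> ('k \<Rightarrow> 'a) \<Rightarrow> 'a ring \<Rightarrow> bool" where
  "artin_algebra k \<eta> A \<longleftrightarrow>
     artinian_cring k \<and> ring A \<and> \<eta> \<in> ring_hom k A \<and>
     (\<forall>c \<in> carrier k. \<forall>a \<in> carrier A. \<eta> c \<otimes>\<^bsub>A\<^esub> a = a \<otimes>\<^bsub>A\<^esub> \<eta> c) \<and>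
     fg_module k
       \<lparr>carrier = carrier A, mult = mult A, one = \<one>\<^bsub>A\<^esub>, zero = \<zero>\<^bsub>A\<^esub>, add = add A,
        smult = (\<lambda>c a. \<eta> c \<otimes>\<^bsub>A\<^esub> a)\<rparr>"

text \<open>The triple \<open>(a\<^sub>1, a\<^sub>2, a\<^sub>3)\<close> is the matrix with first row \<open>a\<^sub>1 a\<^sub>2\<close> and second row \<open>0 a\<^sub>3\<close>.\<close>

definition T2 :: "'a ring \<Rightarrow> ('a \<times> 'a \<times> 'a) ring" where
  "T2 A =
     \<lparr>carrier = carrier A \<times> carrier A \<times> carrier A,
      mult = (\<lambda>(a1, a2, a3) (b1, b2, b3).
        (a1 \<otimes>\<^bsub>A\<^esub> b1, a1 \<otimes>\<^bsub>A\<^esub> b2 \<oplus>\<^bsub>A\<^esub> a2 \<otimes>\<^bsub>A\<^esub> b3, a3 \<otimes>\<^bsub>A\<^esub> b3)),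
      one = (\<one>\<^bsub>A\<^esub>, \<zero>\<^bsub>A\<^esub>, \<one>\<^bsub>A\<^esub>),
      zero = (\<zero>\<^bsub>A\<^esub>, \<zero>\<^bsub>A\<^esub>, \<zero>\<^bsub>A\<^esub>),
      add = (\<lambda>(a1, a2, a3) (b1, b2, b3). (a1 \<oplus>\<^bsub>A\<^esub> b1, a2 \<oplus>\<^bsub>A\<^esub> b2, a3 \<oplus>\<^bsub>A\<^esub> b3))\<rparr>"

text \<open>The \<open>T2 A\<close>-module given by the column with entries \<open>X\<close> (top) and \<open>Y\<close> (bottom) and \<open>\<phi> : Y \<rightarrow> X\<close>.\<close>

definition T2_module ::
    "('a, 'x) module \<Rightarrow> ('a, 'y) module \<Rightarrow> ('y \<Rightarrow> 'x) \<Rightarrow> ('a \<times> 'a \<times> 'a, 'x \<times> 'y) module" where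
  "T2_module X Y \<phi> =
     \<lparr>carrier = carrier X \<times> carrier Y, mult = undefined, one = undefined,
      zero = (\<zero>\<^bsub>X\<^esub>, \<zero>\<^bsub>Y\<^esub>),
      add = (\<lambda>(x, y) (x', y'). (x \<oplus>\<^bsub>X\<^esub> x', y \<oplus>\<^bsub>Y\<^esub> y')),
      smult = (\<lambda>(a1, a2, a3) (x, y). (a1 \<odot>\<^bsub>X\<^esub> x \<oplus>\<^bsub>X\<^esub> a2 \<odot>\<^bsub>X\<^esub> \<phi> y, a3 \<odot>\<^bsub>Y\<^esub> y))\<rparr>"

text \<open>Being monic is a property of the triple, not of the bare record \<^term>\<open>T2_module X Y \<phi>\<close>.\<close>

definition monic_triple :: "('a, 'x) module \<Rightarrow> ('a, 'y) module \<Rightarrow> ('y \<Rightarrow> 'x) \<Rightarrow> bool" where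
  "monic_triple X Y \<phi> \<longleftrightarrow> inj_on \<phi> (carrier Y)"

end

(*
  A projective module over T2 A is a triple whose structure map is a split monomorphism, and a
  projective resolution of the triple (X, Y) restricts to projective resolutions of X and Y over A.
  Maps to the second column (A, A) of T2 A are maps from the top, and maps to the first column (A, 0)
  are maps from the top killed by the bottom.  So if X is projective, Y is semi-Gorenstein-projective
  and Hom(X, A) -> Hom(Y, A) is onto, the triple is semi-Gorenstein-projective; this covers (P, Y).

  The opposite ring of T2 A is T2 of the opposite ring of A, and under this identification the dual of
  (P, Y) is (P*, K) with K the kernel of P* -> Y*, which is onto because P is an approximation.  Since
  Y* is semi-Gorenstein-projective and P* is projective, dimension shifting along K -> P* -> Y* shows
  that K is semi-Gorenstein-projective and that maps from K to A extend to P*, so the same criterion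
  applies.
*)

theory Submission
  imports Defs
begin

section \<open>Linear maps and constructions of modules\<close>

text \<open>Ext vanishing is demanded of every resolution, and the existence of one is part of the
  demand, with elements of type \<open>nat \<Rightarrow> 'a\<close>. So a resolution of each new
  module has to be built (by splicing covers of triples, and by a Schanuel argument for the kernel
  of the dual approximation), while vanishing is tested on an unknown resolution over
  \<open>T2 A\<close>. The latter restricts to resolutions over \<open>A\<close> whose elements have
  the wrong type, so vanishing over \<open>A\<close> must first be freed from the element type. The
  main obstacle is the first column: a bounding map on the top need not kill the bottom. The defect
  is a cocycle on the bottom; in degree 0 it descends to \<open>Y\<close> and is extended over
  \<open>X\<close>, in higher degrees it bounds because \<open>Y\<close> is
  semi-Gorenstein-projective. As for torsionlessness, every map from a triple to \<open>T2 A\<close>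
  sees a bottom element y only through \<phi> y, so a torsionless triple has \<phi> injective; but
  an injective \<phi> into a projective \<open>P\<close> would make \<open>Y\<close>
  torsionless.\<close>

lemma left_module_ring: "left_module R M \<Longrightarrow> ring R"
  by (simp add: left_module_def)

lemma left_module_group: "left_module R M \<Longrightarrow> abelian_group M"
  by (simp add: left_module_def)

text \<open>Additive inverses come from the scalars: once 0 x = 0 is known, (-1) x is inverse to x.
  Every concrete module below is thus verified by identities that do not mention inverses.\<close>

lemma left_moduleI:
  fixes R :: "'a ring" and M :: "('a, 'm) module"
  assumes R: "ring R"
    and add: "\<And>x y. \<lbrakk>x \<in> carrier M; y \<in> carrier M\<rbrakk> \<Longrightarrow> x \<oplus>\<^bsub>M\<^esub> y \<in> carrier M"
    and zero: "\<zero>\<^bsub>M\<^esub> \<in> carrier M"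
    and assoc: "\<And>x y z. \<lbrakk>x \<in> carrier M; y \<in> carrier M; z \<in> carrier M\<rbrakk>
      \<Longrightarrow> (x \<oplus>\<^bsub>M\<^esub> y) \<oplus>\<^bsub>M\<^esub> z = x \<oplus>\<^bsub>M\<^esub> (y \<oplus>\<^bsub>M\<^esub> z)"
    and comm: "\<And>x y. \<lbrakk>x \<in> carrier M; y \<in> carrier M\<rbrakk> \<Longrightarrow> x \<oplus>\<^bsub>M\<^esub> y = y \<oplus>\<^bsub>M\<^esub> x"
    and l_zero: "\<And>x. x \<in> carrier M \<Longrightarrow> \<zero>\<^bsub>M\<^esub> \<oplus>\<^bsub>M\<^esub> x = x"
    and closed: "\<And>a x. \<lbrakk>a \<in> carrier R; x \<in> carrier M\<rbrakk> \<Longrightarrow> a \<odot>\<^bsub>M\<^esub> x \<in> carrier M"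
    and l_distr: "\<And>a b x. \<lbrakk>a \<in> carrier R; b \<in> carrier R; x \<in> carrier M\<rbrakk>
      \<Longrightarrow> (a \<oplus>\<^bsub>R\<^esub> b) \<odot>\<^bsub>M\<^esub> x = a \<odot>\<^bsub>M\<^esub> x \<oplus>\<^bsub>M\<^esub> b \<odot>\<^bsub>M\<^esub> x"
    and r_distr: "\<And>a x y. \<lbrakk>a \<in> carrier R; x \<in> carrier M; y \<in> carrier M\<rbrakk>
      \<Longrightarrow> a \<odot>\<^bsub>M\<^esub> (x \<oplus>\<^bsub>M\<^esub> y) = a \<odot>\<^bsub>M\<^esub> x \<oplus>\<^bsub>M\<^esub> a \<odot>\<^bsub>M\<^esub> y"
    and smult_assoc: "\<And>a b x. \<lbrakk>a \<in> carrier R; b \<in> carrier R; x \<in> carrier M\<rbrakk>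
      \<Longrightarrow> (a \<otimes>\<^bsub>R\<^esub> b) \<odot>\<^bsub>M\<^esub> x = a \<odot>\<^bsub>M\<^esub> (b \<odot>\<^bsub>M\<^esub> x)"
    and one: "\<And>x. x \<in> carrier M \<Longrightarrow> \<one>\<^bsub>R\<^esub> \<odot>\<^bsub>M\<^esub> x = x"
    and zero_smult: "\<And>x. x \<in> carrier M \<Longrightarrow> \<zero>\<^bsub>R\<^esub> \<odot>\<^bsub>M\<^esub> x = \<zero>\<^bsub>M\<^esub>"
  shows "left_module R M"
proof -
  interpret R: ring R by (rule R)
  have ab: "abelian_group M"
  proof (rule abelian_groupI)
    fix x assume x: "x \<in> carrier M"
    have "(\<ominus>\<^bsub>R\<^esub> \<one>\<^bsub>R\<^esub>) \<odot>\<^bsub>M\<^esub> x \<oplus>\<^bsub>M\<^esub> x = (\<ominus>\<^bsub>R\<^esub> \<one>\<^bsub>R\<^esub> \<oplus>\<^bsub>R\<^esub> \<one>\<^bsub>R\<^esub>) \<odot>\<^bsub>M\<^esub> x"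
      using x l_distr[of "\<ominus>\<^bsub>R\<^esub> \<one>\<^bsub>R\<^esub>" "\<one>\<^bsub>R\<^esub>" x] one by simp
    also have "\<dots> = \<zero>\<^bsub>M\<^esub>" using x zero_smult by (simp add: R.l_neg)
    finally show "\<exists>y\<in>carrier M. y \<oplus>\<^bsub>M\<^esub> x = \<zero>\<^bsub>M\<^esub>" using x closed by blast
  qed (fact add zero assoc comm l_zero)+
  show ?thesis
    by (intro left_module.intro left_module_axioms.intro)
      (fact R ab closed l_distr r_distr smult_assoc one)+
qed

context left_module
begin

lemma zero_smult: "x \<in> carrier M \<Longrightarrow> \<zero>\<^bsub>R\<^esub> \<odot>\<^bsub>M\<^esub> x = \<zero>\<^bsub>M\<^esub>"
proof -
  assume x: "x \<in> carrier M"
  have "\<zero>\<^bsub>R\<^esub> \<odot>\<^bsub>M\<^esub> x \<oplus>\<^bsub>M\<^esub> \<zero>\<^bsub>R\<^esub> \<odot>\<^bsub>M\<^esub> x = \<zero>\<^bsub>R\<^esub> \<odot>\<^bsub>M\<^esub> x"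
    using smult_l_distr[of "\<zero>\<^bsub>R\<^esub>" "\<zero>\<^bsub>R\<^esub>" x] x by simp
  then show ?thesis
    using M.add.l_cancel_one x smult_closed by (metis R.zero_closed)
qed

lemma smult_zero: "a \<in> carrier R \<Longrightarrow> a \<odot>\<^bsub>M\<^esub> \<zero>\<^bsub>M\<^esub> = \<zero>\<^bsub>M\<^esub>"
proof -
  assume a: "a \<in> carrier R"
  have "a \<odot>\<^bsub>M\<^esub> \<zero>\<^bsub>M\<^esub> \<oplus>\<^bsub>M\<^esub> a \<odot>\<^bsub>M\<^esub> \<zero>\<^bsub>M\<^esub> = a \<odot>\<^bsub>M\<^esub> \<zero>\<^bsub>M\<^esub>"
    using smult_r_distr[of a "\<zero>\<^bsub>M\<^esub>" "\<zero>\<^bsub>M\<^esub>"] a by simp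
  then show ?thesis
    using M.add.l_cancel_one a smult_closed by (metis M.zero_closed)
qed

end

text \<open>The condition of \<open>lin_maps\<close> with extensionality dropped, so that
  composites, sums and projections written as lambda terms qualify as they stand;
  \<open>restrict_lin_maps\<close> leads back.\<close>

definition lin_map :: "'a ring \<Rightarrow> ('a, 'm) module \<Rightarrow> ('a, 'n) module \<Rightarrow> ('m \<Rightarrow> 'n) \<Rightarrow> bool" where
  "lin_map R M N f \<longleftrightarrow>
     (\<forall>x \<in> carrier M. f x \<in> carrier N) \<and>
     (\<forall>x \<in> carrier M. \<forall>y \<in> carrier M. f (x \<oplus>\<^bsub>M\<^esub> y) = f x \<oplus>\<^bsub>N\<^esub> f y) \<and>
     (\<forall>r \<in> carrier R. \<forall>x \<in> carrier M. f (r \<odot>\<^bsub>M\<^esub> x) = r \<odot>\<^bsub>N\<^esub> f x)"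

lemma lin_mapI:
  assumes "\<And>x. x \<in> carrier M \<Longrightarrow> f x \<in> carrier N"
    and "\<And>x y. \<lbrakk>x \<in> carrier M; y \<in> carrier M\<rbrakk> \<Longrightarrow> f (x \<oplus>\<^bsub>M\<^esub> y) = f x \<oplus>\<^bsub>N\<^esub> f y"
    and "\<And>r x. \<lbrakk>r \<in> carrier R; x \<in> carrier M\<rbrakk> \<Longrightarrow> f (r \<odot>\<^bsub>M\<^esub> x) = r \<odot>\<^bsub>N\<^esub> f x"
  shows "lin_map R M N f"
  using assms by (simp add: lin_map_def)

lemma lin_map_closed: "lin_map R M N f \<Longrightarrow> x \<in> carrier M \<Longrightarrow> f x \<in> carrier N"
  by (simp add: lin_map_def)

lemma lin_map_add:
  "lin_map R M N f \<Longrightarrow> x \<in> carrier M \<Longrightarrow> y \<in> carrier M \<Longrightarrow> f (x \<oplus>\<^bsub>M\<^esub> y) = f x \<oplus>\<^bsub>N\<^esub> f y"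
  by (simp add: lin_map_def)

lemma lin_map_smult:
  "lin_map R M N f \<Longrightarrow> r \<in> carrier R \<Longrightarrow> x \<in> carrier M \<Longrightarrow> f (r \<odot>\<^bsub>M\<^esub> x) = r \<odot>\<^bsub>N\<^esub> f x"
  by (simp add: lin_map_def)

lemma lin_maps_iff: "f \<in> lin_maps R M N \<longleftrightarrow> lin_map R M N f \<and> f \<in> extensional (carrier M)"
  by (auto simp: lin_maps_def lin_map_def PiE_def)

lemma lin_map_cong:
  assumes "left_module R M" "lin_map R M N f" "\<And>x. x \<in> carrier M \<Longrightarrow> f x = g x"
  shows "lin_map R M N g"
proof -
  interpret M: left_module R M by fact
  show ?thesis
    using assms(2) by (auto simp: lin_map_def M.smult_closed simp flip: assms(3))
qed

lemma restrict_lin_maps: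
  assumes "left_module R M" "lin_map R M N f"
  shows "restrict f (carrier M) \<in> lin_maps R M N"
  using lin_map_cong[OF assms, of "restrict f (carrier M)"] by (simp add: lin_maps_iff)

lemma lin_map_comp:
  "lin_map R L M f \<Longrightarrow> lin_map R M N g \<Longrightarrow> lin_map R L N (\<lambda>x. g (f x))"
  by (simp add: lin_map_def)

lemma lin_map_id: "lin_map R M M (\<lambda>x. x)"
  by (simp add: lin_map_def)

lemma lin_map_zero:
  assumes "left_module R M" "left_module R N" "lin_map R M N f"
  shows "f \<zero>\<^bsub>M\<^esub> = \<zero>\<^bsub>N\<^esub>"
proof -
  interpret M: left_module R M by fact
  interpret N: left_module R N by fact
  have z: "\<zero>\<^bsub>M\<^esub> \<in> carrier M" by (rule M.M.zero_closed)
  have "f (\<zero>\<^bsub>R\<^esub> \<odot>\<^bsub>M\<^esub> \<zero>\<^bsub>M\<^esub>) = \<zero>\<^bsub>R\<^esub> \<odot>\<^bsub>N\<^esub> f \<zero>\<^bsub>M\<^esub>"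
    using assms(3) z by (simp add: lin_map_def)
  then show ?thesis
    using lin_map_closed[OF assms(3) z] z by (simp add: N.zero_smult M.zero_smult)
qed

lemma lin_map_neg:
  assumes "left_module R M" "left_module R N" "lin_map R M N f" "x \<in> carrier M"
  shows "f (\<ominus>\<^bsub>M\<^esub> x) = \<ominus>\<^bsub>N\<^esub> f x"
proof -
  interpret M: abelian_group M using assms(1) by (rule left_module_group)
  interpret N: abelian_group N using assms(2) by (rule left_module_group)
  have "f (\<ominus>\<^bsub>M\<^esub> x) \<oplus>\<^bsub>N\<^esub> f x = \<zero>\<^bsub>N\<^esub>"
    using assms by (simp add: M.l_neg lin_map_zero[OF assms(1-3)] flip: lin_map_add)
  then show ?thesis
    using assms by (intro N.minus_equality[symmetric]) (auto intro: lin_map_closed)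
qed

lemma lin_map_minus:
  assumes "left_module R M" "left_module R N" "lin_map R M N f" "x \<in> carrier M" "y \<in> carrier M"
  shows "f (x \<ominus>\<^bsub>M\<^esub> y) = f x \<ominus>\<^bsub>N\<^esub> f y"
proof -
  interpret M: abelian_group M using assms(1) by (rule left_module_group)
  show ?thesis
    using assms by (simp add: a_minus_def lin_map_add[OF assms(3)] lin_map_neg)
qed

lemma smult_neg:
  assumes "left_module R M" "r \<in> carrier R" "x \<in> carrier M"
  shows "r \<odot>\<^bsub>M\<^esub> (\<ominus>\<^bsub>M\<^esub> x) = \<ominus>\<^bsub>M\<^esub> (r \<odot>\<^bsub>M\<^esub> x)"
proof -
  interpret M: left_module R M by fact
  have "r \<odot>\<^bsub>M\<^esub> (\<ominus>\<^bsub>M\<^esub> x) \<oplus>\<^bsub>M\<^esub> r \<odot>\<^bsub>M\<^esub> x = \<zero>\<^bsub>M\<^esub>"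
    using assms by (simp add: M.M.l_neg M.smult_zero flip: M.smult_r_distr)
  then show ?thesis
    using assms by (intro M.M.minus_equality[symmetric]) (auto intro: M.smult_closed)
qed

lemma lin_map_plus:
  assumes "left_module R N" "lin_map R M N f" "lin_map R M N g"
  shows "lin_map R M N (\<lambda>x. f x \<oplus>\<^bsub>N\<^esub> g x)"
proof -
  interpret N: left_module R N by fact
  show ?thesis
    by (rule lin_mapI)
      (simp_all add: lin_map_closed[OF assms(2)] lin_map_closed[OF assms(3)]
        lin_map_add[OF assms(2)] lin_map_add[OF assms(3)]
        lin_map_smult[OF assms(2)] lin_map_smult[OF assms(3)] N.smult_r_distr N.M.a_ac)
qed

lemma lin_map_uminus:
  assumes "left_module R N" "lin_map R M N f"
  shows "lin_map R M N (\<lambda>x. \<ominus>\<^bsub>N\<^esub> f x)"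
proof -
  interpret N: left_module R N by fact
  show ?thesis
    by (rule lin_mapI)
      (simp_all add: lin_map_closed[OF assms(2)] lin_map_add[OF assms(2)] N.M.minus_add
        lin_map_smult[OF assms(2)] smult_neg[OF assms(1)])
qed

lemma lin_map_diff:
  assumes "left_module R N" "lin_map R M N f" "lin_map R M N g"
  shows "lin_map R M N (\<lambda>x. f x \<ominus>\<^bsub>N\<^esub> g x)"
  unfolding a_minus_def using assms by (intro lin_map_plus lin_map_uminus)

lemma lin_map_const_zero:
  assumes "left_module R N"
  shows "lin_map R M N (\<lambda>x. \<zero>\<^bsub>N\<^esub>)"
proof -
  interpret N: left_module R N by fact
  show ?thesis by (auto simp: lin_map_def N.smult_zero)
qed

section \<open>Submodules, kernels, products, free and regular modules\<close>

definition sub_module :: "('a, 'm) module \<Rightarrow> 'm set \<Rightarrow> ('a, 'm) module" where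
  "sub_module M S = M\<lparr>carrier := S\<rparr>"

lemma sub_module_simps [simp]:
  "carrier (sub_module M S) = S" "add (sub_module M S) = add M"
  "zero (sub_module M S) = zero M" "smult (sub_module M S) = smult M"
  by (simp_all add: sub_module_def)

lemma left_module_sub_module:
  assumes "left_module R M" "S \<subseteq> carrier M" "\<zero>\<^bsub>M\<^esub> \<in> S"
    and "\<And>x y. \<lbrakk>x \<in> S; y \<in> S\<rbrakk> \<Longrightarrow> x \<oplus>\<^bsub>M\<^esub> y \<in> S"
    and "\<And>r x. \<lbrakk>r \<in> carrier R; x \<in> S\<rbrakk> \<Longrightarrow> r \<odot>\<^bsub>M\<^esub> x \<in> S"
  shows "left_module R (sub_module M S)"
proof -
  interpret M: left_module R M by fact
  have S: "x \<in> carrier M" if "x \<in> S" for x using that assms(2) by blast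
  show ?thesis
  proof (rule left_moduleI[OF left_module_ring[OF assms(1)]], goal_cases)
    case (3 x y z) then show ?case by (simp add: M.M.a_assoc S)
  next
    case (4 x y) then show ?case by (simp add: M.M.a_comm S)
  qed (simp_all add: assms(3-5) S M.smult_l_distr M.smult_r_distr M.smult_assoc
      M.smult_one M.zero_smult)
qed

definition kernel_of :: "('a, 'm) module \<Rightarrow> ('a, 'n) module \<Rightarrow> ('m \<Rightarrow> 'n) \<Rightarrow> ('a, 'm) module" where
  "kernel_of M N f = sub_module M {x \<in> carrier M. f x = \<zero>\<^bsub>N\<^esub>}"

lemma kernel_of_simps [simp]:
  "carrier (kernel_of M N f) = {x \<in> carrier M. f x = \<zero>\<^bsub>N\<^esub>}" "add (kernel_of M N f) = add M"
  "zero (kernel_of M N f) = zero M" "smult (kernel_of M N f) = smult M"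
  by (simp_all add: kernel_of_def)

lemma left_module_kernel_of:
  assumes "left_module R M" "left_module R N" "lin_map R M N f"
  shows "left_module R (kernel_of M N f)"
proof -
  interpret M: left_module R M by fact
  interpret N: left_module R N by fact
  show ?thesis
    unfolding kernel_of_def using assms(3)
    by (intro left_module_sub_module[OF assms(1)])
      (auto simp: lin_map_zero[OF assms] lin_map_add[OF assms(3)] lin_map_smult[OF assms(3)]
        M.smult_closed N.smult_zero)
qed

lemma lin_map_kernel_incl: "lin_map R (kernel_of M N f) M (\<lambda>x. x)"
  by (simp add: lin_map_def)

definition prod_module :: "('a, 'm) module \<Rightarrow> ('a, 'n) module \<Rightarrow> ('a, 'm \<times> 'n) module" where
  "prod_module M N =
     \<lparr>carrier = carrier M \<times> carrier N, mult = undefined, one = undefined,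
      zero = (\<zero>\<^bsub>M\<^esub>, \<zero>\<^bsub>N\<^esub>),
      add = (\<lambda>(x, y) (x', y'). (x \<oplus>\<^bsub>M\<^esub> x', y \<oplus>\<^bsub>N\<^esub> y')),
      smult = (\<lambda>r (x, y). (r \<odot>\<^bsub>M\<^esub> x, r \<odot>\<^bsub>N\<^esub> y))\<rparr>"

lemma prod_module_simps [simp]:
  "carrier (prod_module M N) = carrier M \<times> carrier N" "zero (prod_module M N) = (\<zero>\<^bsub>M\<^esub>, \<zero>\<^bsub>N\<^esub>)"
  "(x, y) \<oplus>\<^bsub>prod_module M N\<^esub> (x', y') = (x \<oplus>\<^bsub>M\<^esub> x', y \<oplus>\<^bsub>N\<^esub> y')"
  "r \<odot>\<^bsub>prod_module M N\<^esub> (x, y) = (r \<odot>\<^bsub>M\<^esub> x, r \<odot>\<^bsub>N\<^esub> y)"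
  by (simp_all add: prod_module_def)

lemma left_module_prod:
  assumes "left_module R M" "left_module R N"
  shows "left_module R (prod_module M N)"
proof -
  interpret M: left_module R M by fact
  interpret N: left_module R N by fact
  show ?thesis
    by (rule left_moduleI[OF left_module_ring[OF assms(1)]])
      (auto simp: M.M.a_ac M.smult_l_distr M.smult_r_distr M.smult_assoc
        M.smult_one M.zero_smult M.smult_closed N.M.a_ac N.smult_l_distr N.smult_r_distr
        N.smult_assoc N.smult_one N.zero_smult N.smult_closed)
qed

lemma free_module_simps [simp]:
  "carrier (free_module R n) = {..<n} \<rightarrow>\<^sub>E carrier R"
  "zero (free_module R n) = (\<lambda>i\<in>{..<n}. \<zero>\<^bsub>R\<^esub>)"
  "v \<oplus>\<^bsub>free_module R n\<^esub> w = (\<lambda>i\<in>{..<n}. v i \<oplus>\<^bsub>R\<^esub> w i)"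
  "r \<odot>\<^bsub>free_module R n\<^esub> v = (\<lambda>i\<in>{..<n}. r \<otimes>\<^bsub>R\<^esub> v i)"
  by (simp_all add: free_module_def)

lemma regular_module_simps [simp]:
  "carrier (regular_module R) = carrier R" "zero (regular_module R) = \<zero>\<^bsub>R\<^esub>"
  "add (regular_module R) = add R" "smult (regular_module R) = mult R"
  by (simp_all add: regular_module_def)

lemma left_module_free:
  assumes "ring R"
  shows "left_module R (free_module R n)"
proof -
  interpret R: ring R by fact
  note mem = PiE_mem[of _ "{..<n}" "\<lambda>_. carrier R"]
  show ?thesis
  proof (rule left_moduleI[OF assms], goal_cases)
    case (3 x y z)
    then show ?case
      unfolding free_module_simps
      by (intro restrict_ext) (simp add: mem R.a_assoc)
  next
    case (4 x y)
    then show ?case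
      unfolding free_module_simps
      by (intro restrict_ext) (simp add: mem R.a_comm)
  next
    case (5 x)
    then show ?case
      unfolding free_module_simps
      by (intro PiE_ext[of _ "{..<n}" "\<lambda>_. carrier R" x]) (auto simp: mem)
  next
    case (7 a b x)
    then show ?case
      unfolding free_module_simps
      by (intro restrict_ext) (simp add: mem R.l_distr)
  next
    case (8 a x y)
    then show ?case
      unfolding free_module_simps
      by (intro restrict_ext) (simp add: mem R.r_distr)
  next
    case (9 a b x)
    then show ?case
      unfolding free_module_simps
      by (intro restrict_ext) (simp add: mem R.m_assoc)
  next
    case (10 x)
    then show ?case
      unfolding free_module_simps
      by (intro PiE_ext[of _ "{..<n}" "\<lambda>_. carrier R" x]) (auto simp: mem)
  next
    case (11 x)
    then show ?case
      unfolding free_module_simps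
      by (intro restrict_ext) (simp add: mem)
  qed auto
qed

lemma left_module_regular:
  assumes "ring R"
  shows "left_module R (regular_module R)"
proof -
  interpret R: ring R by fact
  show ?thesis
    by (rule left_moduleI[OF assms]) (auto simp: R.a_ac R.m_assoc R.l_distr R.r_distr)
qed

text \<open>Indexing by the naturals below n matches the coordinates of
  \<open>free_module R n\<close>, allows repeated generators, and gives inductions on the length;
  the values of \<open>c\<close> and \<open>g\<close> from n on do not matter.\<close>

primrec lincomb :: "('a, 'm) module \<Rightarrow> (nat \<Rightarrow> 'a) \<Rightarrow> (nat \<Rightarrow> 'm) \<Rightarrow> nat \<Rightarrow> 'm" where
  "lincomb M c g 0 = \<zero>\<^bsub>M\<^esub>"
| "lincomb M c g (Suc n) = lincomb M c g n \<oplus>\<^bsub>M\<^esub> c n \<odot>\<^bsub>M\<^esub> g n"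

lemma lincomb_closed:
  assumes "left_module R M" "\<And>i. i < n \<Longrightarrow> c i \<in> carrier R" "\<And>i. i < n \<Longrightarrow> g i \<in> carrier M"
  shows "lincomb M c g n \<in> carrier M"
proof -
  interpret M: left_module R M by fact
  show ?thesis using assms(2,3) by (induction n) (auto simp: M.smult_closed)
qed

lemma lincomb_cong:
  assumes "\<And>i. i < n \<Longrightarrow> c i = c' i" "\<And>i. i < n \<Longrightarrow> g i = g' i"
  shows "lincomb M c g n = lincomb M c' g' n"
  using assms by (induction n) auto

lemma lin_map_lincomb:
  assumes "left_module R M" "left_module R N" "lin_map R M N f"
    "\<And>i. i < n \<Longrightarrow> c i \<in> carrier R" "\<And>i. i < n \<Longrightarrow> g i \<in> carrier M"
  shows "f (lincomb M c g n) = lincomb N c (\<lambda>i. f (g i)) n"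
  using assms(4,5)
proof (induction n)
  case 0
  then show ?case by (simp add: lin_map_zero[OF assms(1-3)])
next
  case (Suc n)
  interpret M: left_module R M by fact
  show ?case
    using Suc
    by (simp add: lin_map_add[OF assms(3)] lin_map_smult[OF assms(3)]
        lincomb_closed[OF assms(1)] M.smult_closed)
qed

text \<open>The existence half of the universal property of a free module;
  \<open>lin_map_free_expand\<close> is the uniqueness half.\<close>

lemma lin_map_from_free:
  assumes "left_module R M" "\<And>i. i < n \<Longrightarrow> g i \<in> carrier M"
  shows "lin_map R (free_module R n) M (\<lambda>v. lincomb M v g n)"
proof -
  interpret M: left_module R M by fact
  \<comment> \<open>The length k varies while n stays fixed: the vector operations cut off at n, so
    an induction on n itself would change the vectors.\<close>
  have add: "lincomb M (\<lambda>i\<in>{..<n}. v i \<oplus>\<^bsub>R\<^esub> w i) g k = lincomb M v g k \<oplus>\<^bsub>M\<^esub> lincomb M w g k"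
    if "v \<in> {..<n} \<rightarrow> carrier R" "w \<in> {..<n} \<rightarrow> carrier R" "k \<le> n" for v w k
    using that(3)
  proof (induction k)
    case (Suc k)
    have "lincomb M v g k \<in> carrier M" "lincomb M w g k \<in> carrier M"
      using that(1,2) Suc.prems assms(2) by (auto intro!: lincomb_closed[OF assms(1)])
    moreover have "v k \<in> carrier R" "w k \<in> carrier R" "g k \<in> carrier M"
      using that(1,2) Suc.prems assms(2) by auto
    ultimately show ?case
      using Suc by (simp add: M.smult_l_distr M.smult_closed M.M.a_ac)
  qed simp
  have smult: "lincomb M (\<lambda>i\<in>{..<n}. r \<otimes>\<^bsub>R\<^esub> v i) g k = r \<odot>\<^bsub>M\<^esub> lincomb M v g k"
    if "v \<in> {..<n} \<rightarrow> carrier R" "r \<in> carrier R" "k \<le> n" for v r k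
    using that(3)
  proof (induction k)
    case 0
    then show ?case using that by (simp add: M.smult_zero)
  next
    case (Suc k)
    have "lincomb M v g k \<in> carrier M"
      using that(1,2) Suc.prems assms(2) by (auto intro!: lincomb_closed[OF assms(1)])
    moreover have "v k \<in> carrier R" "g k \<in> carrier M"
      using that(1,2) Suc.prems assms(2) by auto
    ultimately show ?case
      using Suc that(2) by (simp add: M.smult_r_distr M.smult_closed M.smult_assoc)
  qed
  show ?thesis
  proof (rule lin_mapI)
    fix v assume "v \<in> carrier (free_module R n)"
    then show "lincomb M v g n \<in> carrier M"
      using assms(2) by (auto intro!: lincomb_closed[OF assms(1)])
  qed (auto simp: PiE_def add smult)
qed

definition unit_vector :: "'a ring \<Rightarrow> nat \<Rightarrow> nat \<Rightarrow> nat \<Rightarrow> 'a" where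
  "unit_vector R n j = (\<lambda>i\<in>{..<n}. if i = j then \<one>\<^bsub>R\<^esub> else \<zero>\<^bsub>R\<^esub>)"

lemma unit_vector_closed:
  assumes "ring R"
  shows "unit_vector R n j \<in> carrier (free_module R n)"
proof -
  interpret R: ring R by fact
  show ?thesis by (auto simp: unit_vector_def)
qed

lemma lincomb_unit_vector:
  assumes "ring R" "v \<in> carrier (free_module R n)"
  shows "lincomb (free_module R n) v (unit_vector R n) n = v"
proof -
  interpret R: ring R by fact
  \<comment> \<open>The partial sums are truncations of \<open>v\<close>, with zero, not
    \<open>undefined\<close>, at the positions i with k \<le> i < n.\<close>
  have "lincomb (free_module R n) v (unit_vector R n) k
      = (\<lambda>i\<in>{..<n}. if i < k then v i else \<zero>\<^bsub>R\<^esub>)" if "k \<le> n" for k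
    using that
  proof (induction k)
    case (Suc k)
    have "v i \<in> carrier R" if "i < n" for i using assms(2) that by auto
    with Suc show ?case
      by (auto simp: unit_vector_def fun_eq_iff less_Suc_eq)
  qed simp
  from this[of n] show ?thesis
    using assms(2) by (auto simp: fun_eq_iff PiE_iff extensional_def)
qed

lemma lin_map_free_expand:
  assumes "left_module R M" "lin_map R (free_module R n) M f" "v \<in> carrier (free_module R n)"
  shows "f v = lincomb M v (\<lambda>i. f (unit_vector R n i)) n"
proof -
  note R = left_module_ring[OF assms(1)]
  have "f (lincomb (free_module R n) v (unit_vector R n) n)
      = lincomb M v (\<lambda>i. f (unit_vector R n i)) n"
    using assms(3) unit_vector_closed[OF R, of n]
    by (intro lin_map_lincomb[OF left_module_free[OF R] assms(1,2)]) auto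
  then show ?thesis using lincomb_unit_vector[OF R assms(3)] by simp
qed

section \<open>Projective modules\<close>

lemma in_add_iff:
  "in_add R P \<longleftrightarrow> left_module R P \<and>
     (\<exists>n s r. lin_map R P (free_module R n) s \<and> lin_map R (free_module R n) P r \<and>
        (\<forall>x \<in> carrier P. r (s x) = x))" (is "_ \<longleftrightarrow> ?rhs")
proof
  assume "in_add R P"
  then show ?rhs unfolding in_add_def lin_maps_iff Bex_def by blast
next
  assume rhs: ?rhs
  then obtain n s r where P: "left_module R P" and s: "lin_map R P (free_module R n) s"
    and r: "lin_map R (free_module R n) P r" and rs: "\<forall>x \<in> carrier P. r (s x) = x" by blast
  note F = left_module_free[OF left_module_ring[OF P]]
  have "restrict s (carrier P) \<in> lin_maps R P (free_module R n)"
    by (rule restrict_lin_maps[OF P s])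
  moreover have "restrict r (carrier (free_module R n)) \<in> lin_maps R (free_module R n) P"
    by (rule restrict_lin_maps[OF F r])
  moreover have "\<forall>x \<in> carrier P. restrict r (carrier (free_module R n)) (restrict s (carrier P) x) = x"
    using rs lin_map_closed[OF s] by simp
  ultimately show "in_add R P" unfolding in_add_def using P by blast
qed

lemma in_add_left_module: "in_add R P \<Longrightarrow> left_module R P"
  by (simp add: in_add_def)

text \<open>A retract of a retract is a retract; later membership proofs use a convenient projective
  \<open>F\<close> in place of a free module.\<close>

lemma in_add_retract:
  assumes "in_add R F" "left_module R P" "lin_map R P F s" "lin_map R F P r"
    "\<And>x. x \<in> carrier P \<Longrightarrow> r (s x) = x"
  shows "in_add R P"
proof -
  obtain n s' r' where "lin_map R F (free_module R n) s'" "lin_map R (free_module R n) F r'"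
    "\<forall>x \<in> carrier F. r' (s' x) = x"
    using assms(1) unfolding in_add_iff by blast
  then show ?thesis
    unfolding in_add_iff using assms(2-5)
    by (intro conjI exI[of _ n] exI[of _ "\<lambda>x. s' (s x)"] exI[of _ "\<lambda>x. r (r' x)"])
      (auto intro: lin_map_comp simp: lin_map_closed)
qed

lemma in_add_free:
  assumes "ring R"
  shows "in_add R (free_module R n)"
  unfolding in_add_iff using left_module_free[OF assms] lin_map_id by blast

lemma in_add_prod:
  assumes "in_add R P" "in_add R Q"
  shows "in_add R (prod_module P Q)"
proof -
  note R = left_module_ring[OF in_add_left_module[OF assms(1)]]
  obtain m s r where P: "left_module R P" and s: "lin_map R P (free_module R m) s"
    and r: "lin_map R (free_module R m) P r" and rs: "\<forall>x \<in> carrier P. r (s x) = x"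
    using assms(1) unfolding in_add_iff by blast
  obtain n s' r' where Q: "left_module R Q" and s': "lin_map R Q (free_module R n) s'"
    and r': "lin_map R (free_module R n) Q r'" and rs': "\<forall>x \<in> carrier Q. r' (s' x) = x"
    using assms(2) unfolding in_add_iff by blast
  \<comment> \<open>Concatenation and splitting of coordinate vectors identify
    \<open>R^m x R^n\<close> with \<open>R^(m+n)\<close>.\<close>
  define S where "S = (\<lambda>(v, w). \<lambda>i\<in>{..<m + n}. if i < m then v i else w (i - m) :: 'a)"
  define T where "T = (\<lambda>u. (\<lambda>i\<in>{..<m}. u i, \<lambda>i\<in>{..<n}. u (i + m) :: 'a))"
  have S: "lin_map R (prod_module (free_module R m) (free_module R n)) (free_module R (m + n)) S"
    by (rule lin_mapI) (auto simp: S_def PiE_iff fun_eq_iff)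
  have T: "lin_map R (free_module R (m + n)) (prod_module (free_module R m) (free_module R n)) T"
    by (rule lin_mapI) (auto simp: T_def PiE_iff fun_eq_iff)
  have TS: "T (S x) = x" if "x \<in> carrier (prod_module (free_module R m) (free_module R n))" for x
    using that by (auto simp: S_def T_def PiE_iff fun_eq_iff extensional_def)
  have F: "in_add R (prod_module (free_module R m) (free_module R n))"
    by (rule in_add_retract[OF in_add_free[OF R] _ S T])
      (use TS in \<open>auto intro: left_module_prod left_module_free R\<close>)
  have "lin_map R (prod_module P Q) (prod_module (free_module R m) (free_module R n))
      (\<lambda>(x, y). (s x, s' y))"
    using s s' by (intro lin_mapI) (auto simp: lin_map_def simp del: free_module_simps)
  moreover have "lin_map R (prod_module (free_module R m) (free_module R n)) (prod_module P Q)
      (\<lambda>(x, y). (r x, r' y))"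
    using r r' by (intro lin_mapI) (auto simp: lin_map_def simp del: free_module_simps)
  ultimately show ?thesis
    by (rule in_add_retract[OF F left_module_prod[OF P Q]]) (use rs rs' in auto)
qed

text \<open>Preimages are chosen only for the images of the unit vectors and then spread linearly by
  the coordinates \<open>s\<close>. Asking f to land in the image of g, instead of g to be onto,
  allows lifting into the kernel of a differential, which is known to be the image of the next
  one.\<close>

lemma in_add_lift:
  assumes P: "in_add R P" and M: "left_module R M" and N: "left_module R N"
    and f: "lin_map R P N f" and g: "lin_map R M N g"
    and sub: "\<And>x. x \<in> carrier P \<Longrightarrow> f x \<in> g ` carrier M"
  obtains h where "lin_map R P M h" "\<And>x. x \<in> carrier P \<Longrightarrow> g (h x) = f x"
proof -
  note R = left_module_ring[OF M]
  obtain n s r where s: "lin_map R P (free_module R n) s"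
    and r: "lin_map R (free_module R n) P r" and rs: "\<forall>x \<in> carrier P. r (s x) = x"
    using P unfolding in_add_iff by blast
  have "\<forall>j. \<exists>m \<in> carrier M. g m = f (r (unit_vector R n j))"
    using sub[OF lin_map_closed[OF r unit_vector_closed[OF R]]] by (metis imageE)
  then obtain m where m: "\<And>j. m j \<in> carrier M" "\<And>j. g (m j) = f (r (unit_vector R n j))"
    by metis
  show ?thesis
  proof (rule that[of "\<lambda>x. lincomb M (s x) m n"])
    show "lin_map R P M (\<lambda>x. lincomb M (s x) m n)"
      using m(1) by (intro lin_map_comp[OF s] lin_map_from_free[OF M])
    fix x assume x: "x \<in> carrier P"
    have sx: "s x \<in> carrier (free_module R n)" by (rule lin_map_closed[OF s x])
    have "g (lincomb M (s x) m n) = lincomb N (s x) (\<lambda>i. g (m i)) n"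
      using sx m(1) by (intro lin_map_lincomb[OF M N g]) auto
    also have "\<dots> = f (r (s x))"
      using lin_map_free_expand[OF N lin_map_comp[OF r f] sx] m(2) by simp
    finally show "g (lincomb M (s x) m n) = f x" using rs x by simp
  qed
qed

text \<open>The copy is the image of the splitting \<open>s\<close> inside a free module, on which
  \<open>r\<close> inverts \<open>s\<close>. It moves a projective module to the element type at
  which resolutions are tested.\<close>

lemma in_add_copy:
  fixes P :: "('a, 'p) module"
  assumes "in_add R P"
  obtains P' :: "('a, nat \<Rightarrow> 'a) module" and h k where "in_add R P'" "lin_map R P P' h"
    "lin_map R P' P k" "\<forall>x \<in> carrier P. k (h x) = x" "\<forall>x \<in> carrier P'. h (k x) = x"
proof -
  obtain n s r where P: "left_module R P" and s: "lin_map R P (free_module R n) s"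
    and r: "lin_map R (free_module R n) P r" and rs: "\<forall>x \<in> carrier P. r (s x) = x"
    using assms unfolding in_add_iff by blast
  note F = left_module_free[OF left_module_ring[OF P], of n]
  interpret P: left_module R P by (rule P)
  define P' where "P' = sub_module (free_module R n) (s ` carrier P)"
  have P': "left_module R P'"
    unfolding P'_def
  proof (rule left_module_sub_module[OF F])
    show "s ` carrier P \<subseteq> carrier (free_module R n)" using lin_map_closed[OF s] by blast
    show "\<zero>\<^bsub>free_module R n\<^esub> \<in> s ` carrier P"
      using lin_map_zero[OF P F s] P.M.zero_closed by (metis imageI)
    show "x \<oplus>\<^bsub>free_module R n\<^esub> y \<in> s ` carrier P" if "x \<in> s ` carrier P" "y \<in> s ` carrier P" for x y
      using that by (auto simp: lin_map_add[OF s, symmetric] simp del: free_module_simps)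
    show "c \<odot>\<^bsub>free_module R n\<^esub> x \<in> s ` carrier P" if "c \<in> carrier R" "x \<in> s ` carrier P" for c x
      using that
      by (auto simp: lin_map_smult[OF s, symmetric] P.smult_closed simp del: free_module_simps)
  qed
  have s': "lin_map R P P' s"
    using s by (simp add: lin_map_def P'_def)
  have "\<And>x. x \<in> s ` carrier P \<Longrightarrow> x \<in> carrier (free_module R n)"
    using lin_map_closed[OF s] by blast
  then have r': "lin_map R P' P r" using r by (simp add: lin_map_def P'_def del: free_module_simps)
  show ?thesis
  proof (rule that[OF _ s' r'])
    show "in_add R P'" by (rule in_add_retract[OF assms P' r' s']) (use rs in \<open>auto simp: P'_def\<close>)
  qed (use rs in \<open>auto simp: P'_def\<close>)
qed

section \<open>Projective resolutions\<close>

text \<open>\<open>projective_resolution\<close> with \<open>lin_map\<close> in place of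
  \<open>lin_maps\<close>: differentials need not be extensional, so they can be spliced and
  conjugated freely.\<close>

definition resolves ::
    "'a ring \<Rightarrow> ('a, 'n) module \<Rightarrow> (nat \<Rightarrow> ('a, 'p) module) \<Rightarrow> (nat \<Rightarrow> 'p \<Rightarrow> 'p) \<Rightarrow> ('p \<Rightarrow> 'n) \<Rightarrow> bool" where
  "resolves R N P d \<epsilon> \<longleftrightarrow>
     (\<forall>i. in_add R (P i)) \<and>
     (\<forall>i. lin_map R (P (Suc i)) (P i) (d i)) \<and>
     lin_map R (P 0) N \<epsilon> \<and>
     \<epsilon> ` carrier (P 0) = carrier N \<and>
     d 0 ` carrier (P 1) = {x \<in> carrier (P 0). \<epsilon> x = \<zero>\<^bsub>N\<^esub>} \<and>
     (\<forall>i. d (Suc i) ` carrier (P (Suc (Suc i))) = {x \<in> carrier (P (Suc i)). d i x = \<zero>\<^bsub>P i\<^esub>})"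

lemma resolvesD:
  assumes "resolves R N P d \<epsilon>"
  shows "in_add R (P i)" "left_module R (P i)" "lin_map R (P (Suc i)) (P i) (d i)"
    "lin_map R (P 0) N \<epsilon>" "\<epsilon> ` carrier (P 0) = carrier N"
    "d 0 ` carrier (P (Suc 0)) = {x \<in> carrier (P 0). \<epsilon> x = \<zero>\<^bsub>N\<^esub>}"
    "d (Suc i) ` carrier (P (Suc (Suc i))) = {x \<in> carrier (P (Suc i)). d i x = \<zero>\<^bsub>P i\<^esub>}"
  using assms by (simp_all add: resolves_def in_add_left_module)

lemma resolves_exact:
  assumes "resolves R N P d \<epsilon>"
  shows "x \<in> carrier (P (Suc 0)) \<Longrightarrow> \<epsilon> (d 0 x) = \<zero>\<^bsub>N\<^esub>"
    "y \<in> carrier (P (Suc (Suc i))) \<Longrightarrow> d i (d (Suc i) y) = \<zero>\<^bsub>P i\<^esub>"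
  using resolvesD(6,7)[OF assms] by blast+

lemma projective_resolution_iff:
  "projective_resolution R N P d \<epsilon> \<longleftrightarrow>
     resolves R N P d \<epsilon> \<and> (\<forall>i. d i \<in> extensional (carrier (P (Suc i)))) \<and> \<epsilon> \<in> extensional (carrier (P 0))"
  by (simp only: projective_resolution_def resolves_def lin_maps_iff all_conj_distrib conj_ac)

lemma resolves_restrict:
  assumes "resolves R N P d \<epsilon>"
  shows "projective_resolution R N P (\<lambda>i. restrict (d i) (carrier (P (Suc i)))) (restrict \<epsilon> (carrier (P 0)))"
proof -
  have "lin_map R (P (Suc i)) (P i) (restrict (d i) (carrier (P (Suc i))))" for i
    using restrict_lin_maps[OF resolvesD(2,3)[OF assms]] by (simp add: lin_maps_iff)
  moreover have "lin_map R (P 0) N (restrict \<epsilon> (carrier (P 0)))"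
    using restrict_lin_maps[OF resolvesD(2,4)[OF assms]] by (simp add: lin_maps_iff)
  moreover have "{x \<in> carrier (P (Suc i)). restrict (d i) (carrier (P (Suc i))) x = \<zero>\<^bsub>P i\<^esub>}
      = {x \<in> carrier (P (Suc i)). d i x = \<zero>\<^bsub>P i\<^esub>}" for i
    by auto
  moreover have "{x \<in> carrier (P 0). restrict \<epsilon> (carrier (P 0)) x = \<zero>\<^bsub>N\<^esub>}
      = {x \<in> carrier (P 0). \<epsilon> x = \<zero>\<^bsub>N\<^esub>}"
    by auto
  ultimately show ?thesis
    using assms unfolding projective_resolution_iff resolves_def by simp
qed

text \<open>Vanishing of the cohomology of \<^term>\<open>Hom_group R (P i) M\<close> in degree \<^term>\<open>Suc j\<close>.\<close>

definition coacyclic ::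
    "'a ring \<Rightarrow> (nat \<Rightarrow> ('a, 'p) module) \<Rightarrow> (nat \<Rightarrow> 'p \<Rightarrow> 'p) \<Rightarrow> ('a, 'm) module \<Rightarrow> nat \<Rightarrow> bool" where
  "coacyclic R P d M j \<longleftrightarrow>
     (\<forall>f. lin_map R (P (Suc j)) M f \<and> (\<forall>x \<in> carrier (P (Suc (Suc j))). f (d (Suc j) x) = \<zero>\<^bsub>M\<^esub>) \<longrightarrow>
        (\<exists>g. lin_map R (P j) M g \<and> (\<forall>x \<in> carrier (P (Suc j)). f x = g (d j x))))"

lemma coacyclicE:
  assumes "coacyclic R P d M j" "lin_map R (P (Suc j)) M f"
    "\<And>x. x \<in> carrier (P (Suc (Suc j))) \<Longrightarrow> f (d (Suc j) x) = \<zero>\<^bsub>M\<^esub>"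
  obtains g where "lin_map R (P j) M g" "\<And>x. x \<in> carrier (P (Suc j)) \<Longrightarrow> f x = g (d j x)"
  using assms unfolding coacyclic_def by blast

section \<open>Ext groups as cocycles modulo coboundaries\<close>

lemma group_Hom_group:
  assumes "left_module R L" "left_module R M"
  shows "group (Hom_group R L M)"
proof -
  interpret L: left_module R L by fact
  interpret M: left_module R M by fact
  have closed: "(\<lambda>x\<in>carrier L. f x \<oplus>\<^bsub>M\<^esub> g x) \<in> lin_maps R L M"
    if "f \<in> lin_maps R L M" "g \<in> lin_maps R L M" for f g
    using that by (intro restrict_lin_maps[OF assms(1)] lin_map_plus[OF assms(2)])
      (simp_all add: lin_maps_iff)
  have mem: "f x \<in> carrier M" if "f \<in> lin_maps R L M" "x \<in> carrier L" for f x
    using that by (auto simp: lin_maps_iff intro: lin_map_closed)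
  show ?thesis
    unfolding Hom_group_def
  proof (rule groupI, goal_cases)
    case (1 f g)
    then show ?case using closed by simp
  next
    case 2
    show ?case
      using restrict_lin_maps[OF assms(1) lin_map_const_zero[OF assms(2)]] by simp
  next
    case (3 f g h)
    then show ?case by (auto intro!: restrict_ext simp: mem M.M.a_assoc)
  next
    case (4 f)
    then have "restrict f (carrier L) = f"
      by (simp add: lin_maps_iff extensional_restrict)
    then show ?case using 4 by (auto simp: mem cong: restrict_cong)
  next
    case (5 f)
    then have "restrict (\<lambda>x. \<ominus>\<^bsub>M\<^esub> f x) (carrier L) \<in> lin_maps R L M"
      by (intro restrict_lin_maps[OF assms(1)] lin_map_uminus[OF assms(2)]) (simp add: lin_maps_iff)
    then show ?case
      using 5 by (intro bexI[of _ "restrict (\<lambda>x. \<ominus>\<^bsub>M\<^esub> f x) (carrier L)"])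
        (auto intro!: restrict_ext simp: mem M.M.l_neg)
  qed
qed

text \<open>The quotient of the cocycles C by the coboundaries B is trivial exactly when C is
  contained in B. The index \<open>Suc j\<close> keeps to positive degrees, where B is the image of
  a coboundary map.\<close>

lemma trivial_Ext_iff:
  assumes res: "resolves R N P d \<epsilon>" and M: "left_module R M"
  shows "trivial_group (Ext_group R P d M (Suc j)) \<longleftrightarrow> coacyclic R P d M j"
proof -
  interpret M: left_module R M by fact
  let ?H = "\<lambda>i. Hom_group R (P i) M"
  note P = resolvesD(2)[OF res]
  note d = resolvesD(3)[OF res]
  have Hs: "carrier (?H i) = lin_maps R (P i) M"
    "\<one>\<^bsub>?H i\<^esub> = (\<lambda>x\<in>carrier (P i). \<zero>\<^bsub>M\<^esub>)"
    "f \<otimes>\<^bsub>?H i\<^esub> g = (\<lambda>x\<in>carrier (P i). f x \<oplus>\<^bsub>M\<^esub> g x)" for i f g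
    by (simp_all add: Hom_group_def)
  have H: "group (?H i)" for i by (rule group_Hom_group[OF P M])
  have cob: "coboundary P d i f \<in> lin_maps R (P (Suc i)) M" if "f \<in> lin_maps R (P i) M" for i f
    unfolding coboundary_def compose_def using that
    by (intro restrict_lin_maps[OF P] lin_map_comp[OF d]) (simp add: lin_maps_iff)
  define C where "C = kernel (?H (Suc j)) (?H (Suc (Suc j))) (coboundary P d (Suc j))"
  define B where "B = coboundary P d j ` lin_maps R (P j) M"
  define G where "G = ?H (Suc j)\<lparr>carrier := C\<rparr>"
  have "coboundary P d (Suc j) \<in> hom (?H (Suc j)) (?H (Suc (Suc j)))"
    using lin_map_closed[OF d] cob
    by (auto simp: hom_def Hs coboundary_def compose_def intro!: restrict_ext)
  then have "group_hom (?H (Suc j)) (?H (Suc (Suc j))) (coboundary P d (Suc j))"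
    by (intro group_hom.intro group_hom_axioms.intro H)
  then have "subgroup C (?H (Suc j))"
    unfolding C_def by (rule group_hom.subgroup_kernel)
  then have G: "group G"
    unfolding G_def using H by (rule subgroup.subgroup_is_group)
  have C_iff: "f \<in> C \<longleftrightarrow> f \<in> lin_maps R (P (Suc j)) M
      \<and> (\<forall>x \<in> carrier (P (Suc (Suc j))). f (d (Suc j) x) = \<zero>\<^bsub>M\<^esub>)" for f
    by (auto simp: C_def kernel_def Hs coboundary_def compose_def fun_eq_iff)
  have BC: "B \<subseteq> C"
  proof
    fix f assume "f \<in> B"
    then obtain g where g: "g \<in> lin_maps R (P j) M" and f: "f = coboundary P d j g"
      by (auto simp: B_def)
    have "g \<zero>\<^bsub>P j\<^esub> = \<zero>\<^bsub>M\<^esub>" using lin_map_zero[OF P M] g by (simp add: lin_maps_iff)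
    then show "f \<in> C"
      using cob[OF g] lin_map_closed[OF d] resolves_exact(2)[OF res]
      by (auto simp: C_iff f coboundary_def compose_def)
  qed
  have Ext: "Ext_group R P d M (Suc j) = G Mod B"
    by (simp add: Ext_group_def G_def C_def B_def)
  have CB: "C \<subseteq> B \<longleftrightarrow> coacyclic R P d M j"
  proof
    assume CB: "C \<subseteq> B"
    show "coacyclic R P d M j"
      unfolding coacyclic_def
    proof (intro allI impI, elim conjE)
      fix f assume f: "lin_map R (P (Suc j)) M f"
        and fd: "\<forall>x \<in> carrier (P (Suc (Suc j))). f (d (Suc j) x) = \<zero>\<^bsub>M\<^esub>"
      have "restrict f (carrier (P (Suc j))) \<in> C"
        using restrict_lin_maps[OF P f] fd lin_map_closed[OF d] by (simp add: C_iff)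
      then obtain g where g: "g \<in> lin_maps R (P j) M"
        and eq: "restrict f (carrier (P (Suc j))) = coboundary P d j g"
        using CB unfolding B_def by blast
      have "f x = g (d j x)" if "x \<in> carrier (P (Suc j))" for x
        using fun_cong[OF eq, of x] that by (simp add: coboundary_def compose_def)
      then show "\<exists>g. lin_map R (P j) M g \<and> (\<forall>x \<in> carrier (P (Suc j)). f x = g (d j x))"
        using g by (auto simp: lin_maps_iff)
    qed
  next
    assume ac: "coacyclic R P d M j"
    show "C \<subseteq> B"
    proof
      fix f assume "f \<in> C"
      then have f: "lin_map R (P (Suc j)) M f" "f \<in> extensional (carrier (P (Suc j)))"
        "\<And>x. x \<in> carrier (P (Suc (Suc j))) \<Longrightarrow> f (d (Suc j) x) = \<zero>\<^bsub>M\<^esub>"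
        by (auto simp: C_iff lin_maps_iff)
      obtain g where g: "lin_map R (P j) M g" "\<And>x. x \<in> carrier (P (Suc j)) \<Longrightarrow> f x = g (d j x)"
        using coacyclicE[OF ac f(1,3)] by blast
      have "f = coboundary P d j (restrict g (carrier (P j)))"
        using f(2) g(2) lin_map_closed[OF d]
        by (auto simp: coboundary_def compose_def extensional_def fun_eq_iff)
      then show "f \<in> B"
        unfolding B_def using restrict_lin_maps[OF P g(1)] by blast
    qed
  qed
  show ?thesis
    unfolding Ext
  proof
    assume "trivial_group (G Mod B)"
    then have triv: "B #>\<^bsub>G\<^esub> f = B" if "f \<in> C" for f
      using that by (auto simp: trivial_group_def carrier_FactGroup G_def)
    \<comment> \<open>Triviality only says that the coset of f equals B; f lies in that coset
      because the zero cocycle is a coboundary.\<close>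
    have "f \<in> B" if "f \<in> C" for f
    proof -
      have "coboundary P d j (\<lambda>x\<in>carrier (P j). \<zero>\<^bsub>M\<^esub>) \<in> B"
        unfolding B_def
        using restrict_lin_maps[OF P lin_map_const_zero[OF M]] by blast
      moreover have "coboundary P d j (\<lambda>x\<in>carrier (P j). \<zero>\<^bsub>M\<^esub>) = \<one>\<^bsub>G\<^esub>"
        using lin_map_closed[OF d] by (auto simp: coboundary_def compose_def G_def Hs intro!: restrict_ext)
      moreover have "\<one>\<^bsub>G\<^esub> \<otimes>\<^bsub>G\<^esub> f = f"
        using that G by (intro monoid.l_one) (auto simp: G_def intro: group.is_monoid)
      ultimately have "f \<in> B #>\<^bsub>G\<^esub> f"
        unfolding r_coset_def by (intro UN_I[of "\<one>\<^bsub>G\<^esub>"]) auto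
      then show "f \<in> B" using triv[OF that] by simp
    qed
    then show "coacyclic R P d M j" using CB by blast
  next
    assume "coacyclic R P d M j"
    then have B: "B = carrier G" using CB BC by (auto simp: G_def)
    interpret G: group G by (rule G)
    have "subgroup (carrier G) G" by (rule G.subgroup_self)
    then have norm: "carrier G \<lhd> G" by (auto simp: G.normal_inv_iff)
    show "trivial_group (G Mod B)"
      unfolding trivial_group_def B using normal.factorgroup_is_group[OF norm]
        G.coset_join2[OF _ G.subgroup_self]
      by (auto simp: carrier_FactGroup)
  qed
qed

text \<open>The existence half of \<open>Ext_vanishes\<close>, separated because it has to be
  established by construction for every new module.\<close>

definition resolvable :: "'a ring \<Rightarrow> ('a, 'n) module \<Rightarrow> bool" where
  "resolvable R N \<longleftrightarrow> (\<exists>(P :: nat \<Rightarrow> ('a, nat \<Rightarrow> 'a) module) d \<epsilon>. resolves R N P d \<epsilon>)"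

text \<open>Bridges two notions of combination: \<open>fg_module\<close> sums over a set of
  generators, whereas an indexed family may repeat elements, so the coefficients of equal generators
  are collected.\<close>

lemma lincomb_in_span:
  assumes N: "left_module R N" and "finite S" "S \<subseteq> carrier N"
    "\<And>i. i < n \<Longrightarrow> v i \<in> carrier R" "\<And>i. i < n \<Longrightarrow> g i \<in> S"
  shows "\<exists>c \<in> S \<rightarrow> carrier R. lincomb N v g n = (\<Oplus>\<^bsub>N\<^esub>s\<in>S. c s \<odot>\<^bsub>N\<^esub> s)"
  using assms(4,5)
proof (induction n)
  interpret N: left_module R N by fact
  case 0
  have "(\<Oplus>\<^bsub>N\<^esub>s\<in>S. \<zero>\<^bsub>R\<^esub> \<odot>\<^bsub>N\<^esub> s) = (\<Oplus>\<^bsub>N\<^esub>s\<in>S. \<zero>\<^bsub>N\<^esub>)"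
    using assms(3) by (intro N.M.finsum_cong') (auto simp: N.zero_smult)
  then show ?case by (intro bexI[of _ "\<lambda>_. \<zero>\<^bsub>R\<^esub>"]) auto
next
  interpret N: left_module R N by fact
  case (Suc n)
  then obtain c where c: "c \<in> S \<rightarrow> carrier R" "lincomb N v g n = (\<Oplus>\<^bsub>N\<^esub>s\<in>S. c s \<odot>\<^bsub>N\<^esub> s)"
    by force
  \<comment> \<open>The new term is absorbed into the coefficient of the generator
    \<open>g n\<close>; all other coefficients gain zero.\<close>
  let ?c = "\<lambda>s. c s \<oplus>\<^bsub>R\<^esub> (if g n = s then v n else \<zero>\<^bsub>R\<^esub>)"
  have v: "v n \<in> carrier R" and g: "g n \<in> S" using Suc.prems by auto
  have S: "s \<in> carrier N" "c s \<in> carrier R" if "s \<in> S" for s using that c(1) assms(3) by auto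
  have "(\<Oplus>\<^bsub>N\<^esub>s\<in>S. ?c s \<odot>\<^bsub>N\<^esub> s)
      = (\<Oplus>\<^bsub>N\<^esub>s\<in>S. c s \<odot>\<^bsub>N\<^esub> s \<oplus>\<^bsub>N\<^esub> (if g n = s then v n \<odot>\<^bsub>N\<^esub> s else \<zero>\<^bsub>N\<^esub>))"
    using v S
    by (intro N.M.finsum_cong') (auto simp: N.smult_l_distr N.smult_closed N.zero_smult)
  also have "\<dots> = (\<Oplus>\<^bsub>N\<^esub>s\<in>S. c s \<odot>\<^bsub>N\<^esub> s) \<oplus>\<^bsub>N\<^esub> (\<Oplus>\<^bsub>N\<^esub>s\<in>S. if g n = s then v n \<odot>\<^bsub>N\<^esub> s else \<zero>\<^bsub>N\<^esub>)"
    using v S by (intro N.M.finsum_addf) (auto simp: N.smult_closed)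
  also have "(\<Oplus>\<^bsub>N\<^esub>s\<in>S. if g n = s then v n \<odot>\<^bsub>N\<^esub> s else \<zero>\<^bsub>N\<^esub>) = v n \<odot>\<^bsub>N\<^esub> g n"
    using v S g assms(2) by (intro N.M.add.finprod_singleton) (auto simp: N.smult_closed)
  finally have "lincomb N v g (Suc n) = (\<Oplus>\<^bsub>N\<^esub>s\<in>S. ?c s \<odot>\<^bsub>N\<^esub> s)" using c(2) by simp
  moreover have "?c \<in> S \<rightarrow> carrier R" using v S by auto
  ultimately show ?case by (intro bexI[of _ ?c])
qed

lemma fg_module_if_surjection:
  assumes N: "left_module R N" and Q: "in_add R Q" and e: "lin_map R Q N e"
    and surj: "e ` carrier Q = carrier N"
  shows "fg_module R N"
proof -
  note R = left_module_ring[OF N]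
  obtain n s r where s: "lin_map R Q (free_module R n) s"
    and r: "lin_map R (free_module R n) Q r" and rs: "\<forall>x \<in> carrier Q. r (s x) = x"
    using Q unfolding in_add_iff by blast
  note er = lin_map_comp[OF r e]
  define g where "g i = e (r (unit_vector R n i))" for i
  let ?S = "g ` {..<n}"
  have S: "?S \<subseteq> carrier N"
    using lin_map_closed[OF er unit_vector_closed[OF R]] by (auto simp: g_def)
  have "\<exists>c \<in> ?S \<rightarrow> carrier R. x = (\<Oplus>\<^bsub>N\<^esub>s\<in>?S. c s \<odot>\<^bsub>N\<^esub> s)" if x: "x \<in> carrier N" for x
  proof -
    obtain q where q: "q \<in> carrier Q" "x = e q" using x surj by blast
    have sq: "s q \<in> carrier (free_module R n)" using lin_map_closed[OF s q(1)] .
    have "e (r (s q)) = lincomb N (s q) g n"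
      unfolding g_def by (rule lin_map_free_expand[OF N er sq])
    then have "x = lincomb N (s q) g n" using q rs by simp
    moreover have "\<exists>c \<in> ?S \<rightarrow> carrier R. lincomb N (s q) g n = (\<Oplus>\<^bsub>N\<^esub>s\<in>?S. c s \<odot>\<^bsub>N\<^esub> s)"
      using sq by (intro lincomb_in_span[OF N _ S]) auto
    ultimately show ?thesis by simp
  qed
  then have "finite ?S \<and> (\<forall>x \<in> carrier N. \<exists>c \<in> ?S \<rightarrow> carrier R. x = (\<Oplus>\<^bsub>N\<^esub>s\<in>?S. c s \<odot>\<^bsub>N\<^esub> s))"
    by simp
  then show ?thesis unfolding fg_module_def using N S by (intro conjI exI[of _ ?S]) blast+
qed

text \<open>Finite generation is absorbed by resolvability, since the first term of a resolution
  maps onto N, and each Ext group is replaced by the solvability of a cocycle equation. This is the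
  form used from here on.\<close>

lemma semi_Gorenstein_projective_iff:
  "semi_Gorenstein_projective R N \<longleftrightarrow> left_module R N \<and> resolvable R N \<and>
     (\<forall>(P :: nat \<Rightarrow> ('a, nat \<Rightarrow> 'a) module) d \<epsilon> j. resolves R N P d \<epsilon> \<longrightarrow>
        coacyclic R P d (regular_module R) j)" (is "_ \<longleftrightarrow> ?rhs") for R :: "'a ring"
proof
  assume sGp: "semi_Gorenstein_projective R N"
  then have N: "left_module R N"
    by (simp add: semi_Gorenstein_projective_def fg_module_def)
  note A = left_module_regular[OF left_module_ring[OF N]]
  have van: "Ext_vanishes R (Suc j) N (regular_module R)" for j
    using sGp by (simp add: semi_Gorenstein_projective_def)
  have "resolvable R N"
    using van[of 0] unfolding Ext_vanishes_def resolvable_def projective_resolution_iff by blast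
  moreover have "coacyclic R P d (regular_module R) j" if "resolves R N P d \<epsilon>"
    for P :: "nat \<Rightarrow> ('a, nat \<Rightarrow> 'a) module" and d \<epsilon> j
  proof -
    let ?d = "\<lambda>i. restrict (d i) (carrier (P (Suc i)))"
    note pr = resolves_restrict[OF that]
    then have "trivial_group (Ext_group R P ?d (regular_module R) (Suc j))"
      using van[of j] unfolding Ext_vanishes_def by blast
    then have "coacyclic R P ?d (regular_module R) j"
      using pr trivial_Ext_iff[OF _ A] unfolding projective_resolution_iff by blast
    then show ?thesis unfolding coacyclic_def by simp
  qed
  ultimately show ?rhs using N by blast
next
  assume rhs: ?rhs
  then have N: "left_module R N" by blast
  note A = left_module_regular[OF left_module_ring[OF N]]
  obtain P :: "nat \<Rightarrow> ('a, nat \<Rightarrow> 'a) module" and d \<epsilon> where res: "resolves R N P d \<epsilon>"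
    using rhs unfolding resolvable_def by blast
  have "fg_module R N"
    by (rule fg_module_if_surjection[OF N resolvesD(1,4,5)[OF res]])
  moreover have "Ext_vanishes R i N (regular_module R)" if "i \<ge> 1" for i
  proof -
    obtain j where i: "i = Suc j" using \<open>i \<ge> 1\<close> by (cases i) auto
    show ?thesis
      unfolding Ext_vanishes_def i
      using rhs resolves_restrict[OF res] trivial_Ext_iff[OF _ A] projective_resolution_iff by blast
  qed
  ultimately show "semi_Gorenstein_projective R N"
    by (simp add: semi_Gorenstein_projective_def)
qed

section \<open>Resolutions with elements of another type\<close>

lemma resolves_copy:
  assumes res: "resolves R N P d \<epsilon>" and N: "left_module R N"
    and P': "\<And>i. in_add R (P' i)" and h: "\<And>i. lin_map R (P i) (P' i) (h i)"
    and k: "\<And>i. lin_map R (P' i) (P i) (k i)"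
    and kh: "\<And>i x. x \<in> carrier (P i) \<Longrightarrow> k i (h i x) = x"
    and hk: "\<And>i x. x \<in> carrier (P' i) \<Longrightarrow> h i (k i x) = x"
  shows "resolves R N P' (\<lambda>i x. h i (d i (k (Suc i) x))) (\<lambda>x. \<epsilon> (k 0 x))"
proof -
  note P = resolvesD(2)[OF res] and d = resolvesD(3)[OF res] and eps = resolvesD(4)[OF res]
  have kim: "k i ` carrier (P' i) = carrier (P i)" for i
  proof
    show "carrier (P i) \<subseteq> k i ` carrier (P' i)"
    proof
      fix x assume x: "x \<in> carrier (P i)"
      show "x \<in> k i ` carrier (P' i)"
        using kh[OF x] lin_map_closed[OF h x] by (metis image_eqI)
    qed
  qed (use lin_map_closed[OF k] in blast)
  have P'': "left_module R (P' i)" for i using P' by (rule in_add_left_module)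
  have h0: "h i \<zero>\<^bsub>P i\<^esub> = \<zero>\<^bsub>P' i\<^esub>" and k0: "k i \<zero>\<^bsub>P' i\<^esub> = \<zero>\<^bsub>P i\<^esub>" for i
    using lin_map_zero[OF P P'' h] lin_map_zero[OF P'' P k] by auto
  have h_im: "h i ` {x \<in> carrier (P i). p x} = {x \<in> carrier (P' i). p (k i x)}" for p i
  proof (intro subset_antisym subsetI)
    fix x assume "x \<in> h i ` {x \<in> carrier (P i). p x}"
    then show "x \<in> {x \<in> carrier (P' i). p (k i x)}"
      using kh lin_map_closed[OF h] by auto
  next
    fix x assume "x \<in> {x \<in> carrier (P' i). p (k i x)}"
    then have x: "x \<in> carrier (P' i)" "p (k i x)" by auto
    show "x \<in> h i ` {x \<in> carrier (P i). p x}"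
      using x(2) lin_map_closed[OF k x(1)] hk[OF x(1)] by (intro image_eqI[of _ _ "k i x"]) auto
  qed
  have im: "(\<lambda>x. h i (d i (k (Suc i) x))) ` carrier (P' (Suc i)) = h i ` (d i ` carrier (P (Suc i)))" for i
    by (simp add: image_image flip: kim)
  have h_zero: "h i x = \<zero>\<^bsub>P' i\<^esub> \<longleftrightarrow> x = \<zero>\<^bsub>P i\<^esub>" if "x \<in> carrier (P i)" for i x
    using h0 k0 kh[OF that] by metis
  show ?thesis
    unfolding resolves_def
  proof (intro conjI allI)
    show "(\<lambda>x. \<epsilon> (k 0 x)) ` carrier (P' 0) = carrier N"
      using kim[of 0] resolvesD(5)[OF res] by (metis image_image)
    show "(\<lambda>x. h 0 (d 0 (k (Suc 0) x))) ` carrier (P' 1) = {x \<in> carrier (P' 0). \<epsilon> (k 0 x) = \<zero>\<^bsub>N\<^esub>}"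
      using im[of 0] h_im[of 0] resolvesD(6)[OF res] by simp
    fix i
    have "(\<lambda>x. h (Suc i) (d (Suc i) (k (Suc (Suc i)) x))) ` carrier (P' (Suc (Suc i)))
        = {x \<in> carrier (P' (Suc i)). d i (k (Suc i) x) = \<zero>\<^bsub>P i\<^esub>}"
      using im[of "Suc i"] h_im[of "Suc i"] resolvesD(7)[OF res] by simp
    also have "\<dots> = {x \<in> carrier (P' (Suc i)). h i (d i (k (Suc i) x)) = \<zero>\<^bsub>P' i\<^esub>}"
      using h_zero[OF lin_map_closed[OF d lin_map_closed[OF k]]] by auto
    finally show "(\<lambda>x. h (Suc i) (d (Suc i) (k (Suc (Suc i)) x))) ` carrier (P' (Suc (Suc i)))
        = {x \<in> carrier (P' (Suc i)). h i (d i (k (Suc i) x)) = \<zero>\<^bsub>P' i\<^esub>}" .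
  qed (intro P' lin_map_comp[OF lin_map_comp[OF k d] h] lin_map_comp[OF k eps])+
qed

text \<open>Copies are chosen degree by degree and the differentials conjugated by the isomorphisms;
  these are returned as well, so that cocycles can be carried to the copy and back.\<close>

lemma resolves_copy_ex:
  fixes P :: "nat \<Rightarrow> ('a, 'p) module"
  assumes "resolves R N P d \<epsilon>" "left_module R N"
  obtains P' :: "nat \<Rightarrow> ('a, nat \<Rightarrow> 'a) module" and h k where
    "resolves R N P' (\<lambda>i x. h i (d i (k (Suc i) x))) (\<lambda>x. \<epsilon> (k 0 x))"
    "\<forall>i. lin_map R (P i) (P' i) (h i)" "\<forall>i. lin_map R (P' i) (P i) (k i)"
    "\<forall>i. \<forall>x \<in> carrier (P i). k i (h i x) = x" "\<forall>i. \<forall>x \<in> carrier (P' i). h i (k i x) = x"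
proof -
  let ?ok = "\<lambda>i P' h k. in_add R (P' :: ('a, nat \<Rightarrow> 'a) module) \<and> lin_map R (P i) P' h \<and>
    lin_map R P' (P i) k \<and> (\<forall>x \<in> carrier (P i). k (h x) = x) \<and> (\<forall>x \<in> carrier P'. h (k x) = x)"
  have "\<exists>T. ?ok i (fst T) (fst (snd T)) (snd (snd T))" for i
  proof -
    obtain P' :: "('a, nat \<Rightarrow> 'a) module" and h k where "in_add R P'" "lin_map R (P i) P' h"
      "lin_map R P' (P i) k" "\<forall>x \<in> carrier (P i). k (h x) = x" "\<forall>x \<in> carrier P'. h (k x) = x"
      by (rule in_add_copy[OF resolvesD(1)[OF assms(1), of i]])
    then show ?thesis by (intro exI[of _ "(P', h, k)"]) simp
  qed
  then have "\<exists>T. \<forall>i. ?ok i (fst (T i)) (fst (snd (T i))) (snd (snd (T i)))"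
    by (intro choice allI)
  then obtain T where T: "\<And>i. ?ok i (fst (T i)) (fst (snd (T i))) (snd (snd (T i)))"
    by blast
  show ?thesis
    by (rule that[OF resolves_copy[OF assms, where P' = "\<lambda>i. fst (T i)"
          and h = "\<lambda>i. fst (snd (T i))" and k = "\<lambda>i. snd (snd (T i))"]])
      (use T in auto)
qed

lemma resolvable_if_resolves:
  "resolves R N P d \<epsilon> \<Longrightarrow> left_module R N \<Longrightarrow> resolvable R N"
  unfolding resolvable_def by (erule (1) resolves_copy_ex) blast

text \<open>The definition tests only resolutions with elements in
  \<open>nat \<Rightarrow> 'a\<close>. A resolution of any type has an isomorphic copy there; a
  cocycle is moved to the copy, bounded, and moved back. This is needed for the corners of a
  resolution over \<open>T2 A\<close>, whose elements are vectors of matrices.\<close>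

lemma semi_Gorenstein_projective_coacyclic:
  fixes P :: "nat \<Rightarrow> ('a, 'p) module"
  assumes sGp: "semi_Gorenstein_projective R N" and res: "resolves R N P d \<epsilon>"
  shows "coacyclic R P d (regular_module R) j"
  unfolding coacyclic_def
proof (intro allI impI, elim conjE)
  let ?A = "regular_module R"
  have N: "left_module R N" using sGp by (simp add: semi_Gorenstein_projective_iff)
  note d = resolvesD(3)[OF res]
  obtain P' :: "nat \<Rightarrow> ('a, nat \<Rightarrow> 'a) module" and h k where
    res': "resolves R N P' (\<lambda>i x. h i (d i (k (Suc i) x))) (\<lambda>x. \<epsilon> (k 0 x))"
    and h: "\<forall>i. lin_map R (P i) (P' i) (h i)" and k: "\<forall>i. lin_map R (P' i) (P i) (k i)"
    and kh: "\<forall>i. \<forall>x \<in> carrier (P i). k i (h i x) = x"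
    and "\<forall>i. \<forall>x \<in> carrier (P' i). h i (k i x) = x"
    by (rule resolves_copy_ex[OF res N])
  note h = h[rule_format] and k = k[rule_format] and kh = kh[rule_format]
  fix f assume f: "lin_map R (P (Suc j)) ?A f"
    and fd: "\<forall>x \<in> carrier (P (Suc (Suc j))). f (d (Suc j) x) = \<zero>\<^bsub>?A\<^esub>"
  have ac: "coacyclic R P' (\<lambda>i x. h i (d i (k (Suc i) x))) ?A j"
    using sGp res' unfolding semi_Gorenstein_projective_iff by blast
  have "f (k (Suc j) (h (Suc j) (d (Suc j) (k (Suc (Suc j)) x)))) = \<zero>\<^bsub>?A\<^esub>"
    if "x \<in> carrier (P' (Suc (Suc j)))" for x
    using fd kh[OF lin_map_closed[OF d]] lin_map_closed[OF k that] by simp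
  then obtain g where g: "lin_map R (P' j) ?A g"
    "\<And>x. x \<in> carrier (P' (Suc j)) \<Longrightarrow> f (k (Suc j) x) = g (h j (d j (k (Suc j) x)))"
    using coacyclicE[OF ac lin_map_comp[OF k f]] by blast
  have "f x = g (h j (d j x))" if "x \<in> carrier (P (Suc j))" for x
    using g(2)[OF lin_map_closed[OF h that]] kh[OF that] by simp
  then show "\<exists>g. lin_map R (P j) ?A g \<and> (\<forall>x\<in>carrier (P (Suc j)). f x = g (d j x))"
    using lin_map_comp[OF h g(1)] by blast
qed

text \<open>Yoneda splicing of the short exact sequences 0 -> N (i+1) -> Q i -> N i -> 0: the
  differential is a projection followed by an inclusion, and exactness survives because \<delta> is
  injective.\<close>

lemma resolves_splice:
  assumes Q: "\<And>i. in_add R (Q i)" and N: "\<And>i. left_module R (N i)"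
    and e: "\<And>i. lin_map R (Q i) (N i) (e i)" and surj: "\<And>i. e i ` carrier (Q i) = carrier (N i)"
    and \<delta>: "\<And>i. lin_map R (N (Suc i)) (Q i) (\<delta> i)"
    and inj: "\<And>i x. x \<in> carrier (N (Suc i)) \<Longrightarrow> \<delta> i x = \<zero>\<^bsub>Q i\<^esub> \<Longrightarrow> x = \<zero>\<^bsub>N (Suc i)\<^esub>"
    and im: "\<And>i. \<delta> i ` carrier (N (Suc i)) = {x \<in> carrier (Q i). e i x = \<zero>\<^bsub>N i\<^esub>}"
  shows "resolves R (N 0) Q (\<lambda>i x. \<delta> i (e (Suc i) x)) (e 0)"
proof -
  have im': "(\<lambda>x. \<delta> i (e (Suc i) x)) ` carrier (Q (Suc i)) = {x \<in> carrier (Q i). e i x = \<zero>\<^bsub>N i\<^esub>}" for i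
    using im[of i] surj[of "Suc i"] by (metis image_image)
  have z: "\<delta> i (e (Suc i) x) = \<zero>\<^bsub>Q i\<^esub> \<longleftrightarrow> e (Suc i) x = \<zero>\<^bsub>N (Suc i)\<^esub>" if "x \<in> carrier (Q (Suc i))" for x i
    using inj lin_map_closed[OF e that] lin_map_zero[OF N in_add_left_module[OF Q] \<delta>] by metis
  show ?thesis
    unfolding resolves_def
  proof (intro conjI allI)
    fix i
    have "{x \<in> carrier (Q (Suc i)). e (Suc i) x = \<zero>\<^bsub>N (Suc i)\<^esub>}
        = {x \<in> carrier (Q (Suc i)). \<delta> i (e (Suc i) x) = \<zero>\<^bsub>Q i\<^esub>}"
      using z by blast
    then show "(\<lambda>x. \<delta> (Suc i) (e (Suc (Suc i)) x)) ` carrier (Q (Suc (Suc i)))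
        = {x \<in> carrier (Q (Suc i)). \<delta> i (e (Suc i) x) = \<zero>\<^bsub>Q i\<^esub>}"
      using im'[of "Suc i"] by simp
    show "lin_map R (Q (Suc i)) (Q i) (\<lambda>x. \<delta> i (e (Suc i) x))"
      by (rule lin_map_comp[OF e \<delta>])
  qed (use Q e[of 0] surj[of 0] im'[of 0] in simp_all)
qed

text \<open>A single splice at the front; \<open>case_nat\<close> shifts the given resolution up by
  one degree.\<close>

lemma resolves_extend:
  assumes res: "resolves R N' P d \<epsilon>" and Q: "in_add R Q" and N': "left_module R N'"
    and e: "lin_map R Q N e" and surj: "e ` carrier Q = carrier N"
    and \<delta>: "lin_map R N' Q \<delta>"
    and inj: "\<And>x. x \<in> carrier N' \<Longrightarrow> \<delta> x = \<zero>\<^bsub>Q\<^esub> \<Longrightarrow> x = \<zero>\<^bsub>N'\<^esub>"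
    and im: "\<delta> ` carrier N' = {x \<in> carrier Q. e x = \<zero>\<^bsub>N\<^esub>}"
  shows "resolves R N (case_nat Q P) (case_nat (\<lambda>x. \<delta> (\<epsilon> x)) d) e"
proof -
  note P = resolvesD[OF res]
  have im': "(\<lambda>x. \<delta> (\<epsilon> x)) ` carrier (P 0) = {x \<in> carrier Q. e x = \<zero>\<^bsub>N\<^esub>}"
    using im P(5) by (metis image_image)
  have z: "\<delta> (\<epsilon> x) = \<zero>\<^bsub>Q\<^esub> \<longleftrightarrow> \<epsilon> x = \<zero>\<^bsub>N'\<^esub>" if "x \<in> carrier (P 0)" for x
    using inj lin_map_closed[OF P(4) that] lin_map_zero[OF N' in_add_left_module[OF Q] \<delta>] by metis
  have "d 0 ` carrier (P (Suc 0)) = {x \<in> carrier (P 0). \<delta> (\<epsilon> x) = \<zero>\<^bsub>Q\<^esub>}"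
    using z P(6) by blast
  then show ?thesis
    unfolding resolves_def using P Q e surj im' lin_map_comp[OF P(4) \<delta>]
    by (auto split: nat.split)
qed

text \<open>Here \<open>Q\<close> may have any element type; a copy in
  \<open>nat \<Rightarrow> 'a\<close> takes its place, so that all terms of the resolution share one
  type.\<close>

lemma resolvable_extend:
  fixes Q :: "('a, 'q) module"
  assumes "resolvable R N'" and Q: "in_add R Q" and N: "left_module R N" and N': "left_module R N'"
    and e: "lin_map R Q N e" and surj: "e ` carrier Q = carrier N"
    and \<delta>: "lin_map R N' Q \<delta>"
    and inj: "\<And>x. x \<in> carrier N' \<Longrightarrow> \<delta> x = \<zero>\<^bsub>Q\<^esub> \<Longrightarrow> x = \<zero>\<^bsub>N'\<^esub>"
    and im: "\<delta> ` carrier N' = {x \<in> carrier Q. e x = \<zero>\<^bsub>N\<^esub>}"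
  shows "resolvable R N"
proof -
  obtain P :: "nat \<Rightarrow> ('a, nat \<Rightarrow> 'a) module" and d \<epsilon> where res: "resolves R N' P d \<epsilon>"
    using assms(1) unfolding resolvable_def by blast
  obtain Q' :: "('a, nat \<Rightarrow> 'a) module" and h k where Q': "in_add R Q'" and h: "lin_map R Q Q' h"
    and k: "lin_map R Q' Q k" and kh: "\<forall>x \<in> carrier Q. k (h x) = x"
    and hk: "\<forall>x \<in> carrier Q'. h (k x) = x"
    by (rule in_add_copy[OF Q])
  note kh = kh[rule_format] and hk = hk[rule_format]
  have kim: "k ` carrier Q' = carrier Q"
  proof (intro subset_antisym subsetI)
    fix x assume x: "x \<in> carrier Q"
    show "x \<in> k ` carrier Q'"
      using lin_map_closed[OF h x] kh[OF x] by (intro image_eqI[of _ _ "h x"]) simp_all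
  qed (use lin_map_closed[OF k] in auto)
  have k0: "k \<zero>\<^bsub>Q'\<^esub> = \<zero>\<^bsub>Q\<^esub>"
    by (rule lin_map_zero[OF in_add_left_module[OF Q'] in_add_left_module[OF Q] k])
  have "resolves R N (case_nat Q' P) (case_nat (\<lambda>x. h (\<delta> (\<epsilon> x))) d) (\<lambda>x. e (k x))"
  proof (rule resolves_extend[OF res Q' N' lin_map_comp[OF k e]  _ lin_map_comp[OF \<delta> h]])
    show "(\<lambda>x. e (k x)) ` carrier Q' = carrier N"
      using kim surj by (metis image_image)
    show "x = \<zero>\<^bsub>N'\<^esub>" if "x \<in> carrier N'" "h (\<delta> x) = \<zero>\<^bsub>Q'\<^esub>" for x
      using inj[OF that(1)] kh[OF lin_map_closed[OF \<delta> that(1)]] that(2) k0 by simp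
    show "(\<lambda>x. h (\<delta> x)) ` carrier N' = {x \<in> carrier Q'. e (k x) = \<zero>\<^bsub>N\<^esub>}"
    proof (intro subset_antisym subsetI)
      fix y assume "y \<in> (\<lambda>x. h (\<delta> x)) ` carrier N'"
      then obtain x where x: "x \<in> carrier N'" "y = h (\<delta> x)" by blast
      then show "y \<in> {x \<in> carrier Q'. e (k x) = \<zero>\<^bsub>N\<^esub>}"
        using im lin_map_closed[OF \<delta> x(1)] lin_map_closed[OF h] kh by auto
    next
      fix y assume "y \<in> {x \<in> carrier Q'. e (k x) = \<zero>\<^bsub>N\<^esub>}"
      then have y: "y \<in> carrier Q'" "e (k y) = \<zero>\<^bsub>N\<^esub>" by auto
      then obtain x where "x \<in> carrier N'" "k y = \<delta> x"
        using im lin_map_closed[OF k] by blast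
      then show "y \<in> (\<lambda>x. h (\<delta> x)) ` carrier N'"
        using hk[OF y(1)] by (metis image_eqI)
    qed
  qed
  then show ?thesis unfolding resolvable_def by blast
qed

lemma resolves_kernel:
  assumes res: "resolves R N P d \<epsilon>"
  shows "resolves R (kernel_of (P 0) N \<epsilon>) (\<lambda>i. P (Suc i)) (\<lambda>i. d (Suc i)) (d 0)"
proof -
  have "lin_map R (P (Suc 0)) (kernel_of (P 0) N \<epsilon>) (d 0)"
    using resolvesD(3)[OF res, of 0] resolves_exact(1)[OF res] by (simp add: lin_map_def)
  then show ?thesis
    unfolding resolves_def using resolvesD(1,3,6,7)[OF res] by simp
qed

lemma resolvable_kernelE:
  fixes N :: "('a, 'n) module"
  assumes "resolvable R N" "left_module R N"
  obtains P :: "('a, nat \<Rightarrow> 'a) module" and \<epsilon> where "in_add R P" "lin_map R P N \<epsilon>"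
    "\<epsilon> ` carrier P = carrier N" "resolvable R (kernel_of P N \<epsilon>)" "left_module R (kernel_of P N \<epsilon>)"
proof -
  obtain P :: "nat \<Rightarrow> ('a, nat \<Rightarrow> 'a) module" and d \<epsilon> where res: "resolves R N P d \<epsilon>"
    using assms(1) unfolding resolvable_def by blast
  have "left_module R (kernel_of (P 0) N \<epsilon>)"
    by (rule left_module_kernel_of[OF resolvesD(2)[OF res] assms(2) resolvesD(4)[OF res]])
  then show ?thesis
    using that[OF resolvesD(1,4,5)[OF res]] resolvable_if_resolves[OF resolves_kernel[OF res]] by blast
qed

section \<open>Kernels of maps from projective modules\<close>

lemma (in abelian_group) minus_plus_cancel:
  "\<lbrakk>x \<in> carrier G; y \<in> carrier G\<rbrakk> \<Longrightarrow> (x \<ominus> y) \<oplus> y = x"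
  by (simp add: a_minus_def a_assoc l_neg)

lemma (in abelian_group) plus_minus_cancel:
  "\<lbrakk>x \<in> carrier G; y \<in> carrier G\<rbrakk> \<Longrightarrow> (x \<oplus> y) \<ominus> y = x"
  by (simp add: a_minus_def a_assoc r_neg)

lemma (in abelian_group) diff_zero: "x \<in> carrier G \<Longrightarrow> x \<ominus> \<zero> = x"
  by (simp add: a_minus_def)

lemma (in abelian_group) minus_eq_zero_iff [simp]:
  assumes "x \<in> carrier G" "y \<in> carrier G"
  shows "x \<ominus> y = \<zero> \<longleftrightarrow> x = y"
  using assms minus_plus_cancel[OF assms] by (auto simp: a_minus_def r_neg)

lemma lin_map_fst: "lin_map R (prod_module M N) M fst"
  by (rule lin_mapI) auto

lemma lin_map_snd: "lin_map R (prod_module M N) N snd"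
  by (rule lin_mapI) auto

lemma lin_map_pair:
  assumes "lin_map R L M f" "lin_map R L N g"
  shows "lin_map R L (prod_module M N) (\<lambda>x. (f x, g x))"
  using assms by (intro lin_mapI) (simp_all add: lin_map_def)

lemma lin_map_into_kernel:
  assumes "lin_map R L M f" "\<And>x. x \<in> carrier L \<Longrightarrow> g (f x) = \<zero>\<^bsub>N\<^esub>"
  shows "lin_map R L (kernel_of M N g) f"
  using assms by (simp add: lin_map_def)

text \<open>A projective summand is added to the first term of a resolution; the syzygy stays the
  same up to a zero coordinate.\<close>

lemma resolvable_prod:
  fixes R :: "'a ring"
  assumes "resolvable R N" and N: "left_module R N" and Q: "in_add R Q"
  shows "resolvable R (prod_module N Q)"
proof -
  obtain P :: "('a, nat \<Rightarrow> 'a) module" and \<epsilon> where P: "in_add R P" and eps: "lin_map R P N \<epsilon>"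
    and surj: "\<epsilon> ` carrier P = carrier N" and res: "resolvable R (kernel_of P N \<epsilon>)"
    and K: "left_module R (kernel_of P N \<epsilon>)"
    by (rule resolvable_kernelE[OF assms(1) N])
  note Q' = in_add_left_module[OF Q]
  interpret Q: left_module R Q by (rule Q')
  show ?thesis
  proof (rule resolvable_extend[OF res in_add_prod[OF P Q] left_module_prod[OF N Q'] K])
    show "lin_map R (prod_module P Q) (prod_module N Q) (\<lambda>z. (\<epsilon> (fst z), snd z))"
      by (intro lin_map_pair lin_map_comp[OF lin_map_fst eps] lin_map_snd)
    show "lin_map R (kernel_of P N \<epsilon>) (prod_module P Q) (\<lambda>x. (x, \<zero>\<^bsub>Q\<^esub>))"
      by (intro lin_map_pair lin_map_kernel_incl lin_map_const_zero Q')
    have "(\<lambda>z. (\<epsilon> (fst z), snd z)) ` (carrier P \<times> carrier Q) = \<epsilon> ` carrier P \<times> carrier Q"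
      by force
    then show "(\<lambda>z. (\<epsilon> (fst z), snd z)) ` carrier (prod_module P Q) = carrier (prod_module N Q)"
      by (simp add: surj)
  qed auto
qed

text \<open>A resolution of a projective module splits: there are maps t with d t d = d. Then x - t
  (d x) is a cycle, hence a boundary, so a cocycle f cannot distinguish x from t (d x), and f t is
  the bounding map.\<close>

lemma projective_coacyclic:
  assumes res: "resolves R N P d \<epsilon>" and N: "in_add R N" and M: "left_module R M"
  shows "coacyclic R P d M j"
proof -
  note P = resolvesD(2)[OF res] and d = resolvesD(3)[OF res] and eps = resolvesD(4)[OF res]
  note N' = in_add_left_module[OF N]
  have ag: "abelian_group (P i)" for i by (rule left_module_group[OF P])
  txt \<open>A partial contracting homotopy.\<close>
  have htpy: "\<exists>t. lin_map R (P i) (P (Suc i)) t \<and> (\<forall>x \<in> carrier (P (Suc i)). d i (t (d i x)) = d i x)" for i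
  proof (induction i)
    case 0
    interpret P0: abelian_group "P 0" by (rule ag)
    obtain s where s: "lin_map R N (P 0) s" "\<And>x. x \<in> carrier N \<Longrightarrow> \<epsilon> (s x) = x"
      using in_add_lift[OF N P N' lin_map_id eps] resolvesD(5)[OF res] by blast
    \<comment> \<open>\<open>s\<close> splits the augmentation, so the remainder x - s (\<epsilon>
      x) lies in its kernel and can be lifted along \<open>d 0\<close>.\<close>
    have sub: "x \<ominus>\<^bsub>P 0\<^esub> s (\<epsilon> x) \<in> d 0 ` carrier (P (Suc 0))" if "x \<in> carrier (P 0)" for x
    proof -
      interpret N: abelian_group N by (rule left_module_group[OF N'])
      note e = lin_map_closed[OF eps that]
      show ?thesis
        unfolding resolvesD(6)[OF res]
        using that lin_map_closed[OF s(1) e] e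
        by (simp add: lin_map_minus[OF P N' eps] s(2))
    qed
    have "lin_map R (P 0) (P 0) (\<lambda>x. x \<ominus>\<^bsub>P 0\<^esub> s (\<epsilon> x))"
      by (intro lin_map_diff P lin_map_id lin_map_comp[OF eps s(1)])
    from in_add_lift[OF resolvesD(1)[OF res] P P this d sub]
    obtain t where t: "lin_map R (P 0) (P (Suc 0)) t"
      "\<And>x. x \<in> carrier (P 0) \<Longrightarrow> d 0 (t x) = x \<ominus>\<^bsub>P 0\<^esub> s (\<epsilon> x)"
      by blast
    have "d 0 (t (d 0 x)) = d 0 x" if "x \<in> carrier (P (Suc 0))" for x
      using lin_map_closed[OF d that]
      by (simp add: t(2) resolves_exact(1)[OF res that] lin_map_zero[OF N' P s(1)] P0.diff_zero)
    then show ?case using t(1) by blast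
  next
    case (Suc i)
    interpret P0: abelian_group "P i" by (rule ag)
    interpret P1: abelian_group "P (Suc i)" by (rule ag)
    obtain t where t: "lin_map R (P i) (P (Suc i)) t"
      "\<And>x. x \<in> carrier (P (Suc i)) \<Longrightarrow> d i (t (d i x)) = d i x"
      using Suc by blast
    \<comment> \<open>The identity d t d = d puts x - t (d x) into the kernel of \<open>d i\<close>,
      that is, into the image of the next differential; lifting it gives the next map t'.\<close>
    have sub: "x \<ominus>\<^bsub>P (Suc i)\<^esub> t (d i x) \<in> d (Suc i) ` carrier (P (Suc (Suc i)))"
      if "x \<in> carrier (P (Suc i))" for x
      unfolding resolvesD(7)[OF res]
      using that lin_map_closed[OF d that] lin_map_closed[OF t(1)]
      by (simp add: lin_map_minus[OF P P d] t(2))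
    have "lin_map R (P (Suc i)) (P (Suc i)) (\<lambda>x. x \<ominus>\<^bsub>P (Suc i)\<^esub> t (d i x))"
      by (intro lin_map_diff P lin_map_id lin_map_comp[OF d t(1)])
    from in_add_lift[OF resolvesD(1)[OF res] P P this d sub]
    obtain t' where t': "lin_map R (P (Suc i)) (P (Suc (Suc i))) t'"
      "\<And>x. x \<in> carrier (P (Suc i)) \<Longrightarrow> d (Suc i) (t' x) = x \<ominus>\<^bsub>P (Suc i)\<^esub> t (d i x)"
      by blast
    have "d (Suc i) (t' (d (Suc i) x)) = d (Suc i) x" if "x \<in> carrier (P (Suc (Suc i)))" for x
      using lin_map_closed[OF d that]
      by (simp add: t'(2) resolves_exact(2)[OF res that] lin_map_zero[OF P P t(1)] P1.diff_zero)
    then show ?case using t'(1) by blast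
  qed
  show ?thesis
    unfolding coacyclic_def
  proof (intro allI impI, elim conjE)
    fix f assume f: "lin_map R (P (Suc j)) M f"
      and fd: "\<forall>x \<in> carrier (P (Suc (Suc j))). f (d (Suc j) x) = \<zero>\<^bsub>M\<^esub>"
    interpret M: abelian_group M by (rule left_module_group[OF M])
    interpret P0: abelian_group "P j" by (rule ag)
    interpret P1: abelian_group "P (Suc j)" by (rule ag)
    obtain t where t: "lin_map R (P j) (P (Suc j)) t"
      "\<And>x. x \<in> carrier (P (Suc j)) \<Longrightarrow> d j (t (d j x)) = d j x"
      using htpy by blast
    have "f x = f (t (d j x))" if x: "x \<in> carrier (P (Suc j))" for x
    proof -
      note tx = lin_map_closed[OF t(1) lin_map_closed[OF d x]]
      have "x \<ominus>\<^bsub>P (Suc j)\<^esub> t (d j x) \<in> d (Suc j) ` carrier (P (Suc (Suc j)))"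
        unfolding resolvesD(7)[OF res]
        using x lin_map_closed[OF d x] tx by (simp add: lin_map_minus[OF P P d] t(2))
      then have "f (x \<ominus>\<^bsub>P (Suc j)\<^esub> t (d j x)) = \<zero>\<^bsub>M\<^esub>" using fd by auto
      then show ?thesis
        using lin_map_closed[OF f] x tx by (simp add: lin_map_minus[OF P M f])
    qed
    then show "\<exists>g. lin_map R (P j) M g \<and> (\<forall>x\<in>carrier (P (Suc j)). f x = g (d j x))"
      using lin_map_comp[OF t(1) f] by blast
  qed
qed

text \<open>
  A form of Schanuel's lemma: if \<open>Q0\<close> maps onto \<open>N\<close> with kernel \<open>K0\<close>, and \<open>Q1\<close> onto \<open>K0\<close> with
  kernel \<open>K1\<close>, then \<open>Q1 \<oplus> X\<close> maps onto the kernel of \<open>X \<rightarrow> N\<close> with kernel \<open>K1 \<oplus> Q0\<close>.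
\<close>

lemma resolvable_kernel:
  fixes R :: "'a ring"
  assumes resN: "resolvable R N" and N: "left_module R N" and X: "in_add R X"
    and \<pi>: "lin_map R X N \<pi>" and surj: "\<pi> ` carrier X = carrier N"
  shows "resolvable R (kernel_of X N \<pi>)"
proof -
  note X' = in_add_left_module[OF X]
  obtain Q0 :: "('a, nat \<Rightarrow> 'a) module" and \<epsilon> where Q0: "in_add R Q0" and eps: "lin_map R Q0 N \<epsilon>"
    and eps_surj: "\<epsilon> ` carrier Q0 = carrier N" and res0: "resolvable R (kernel_of Q0 N \<epsilon>)"
    and K0: "left_module R (kernel_of Q0 N \<epsilon>)"
    by (rule resolvable_kernelE[OF resN N])
  let ?K0 = "kernel_of Q0 N \<epsilon>"
  obtain Q1 :: "('a, nat \<Rightarrow> 'a) module" and e1 where Q1: "in_add R Q1" and e1: "lin_map R Q1 ?K0 e1"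
    and e1_surj: "e1 ` carrier Q1 = carrier ?K0" and res1: "resolvable R (kernel_of Q1 ?K0 e1)"
    and K1: "left_module R (kernel_of Q1 ?K0 e1)"
    by (rule resolvable_kernelE[OF res0 K0])
  let ?K1 = "kernel_of Q1 ?K0 e1"
  note Q0' = in_add_left_module[OF Q0] and Q1' = in_add_left_module[OF Q1]
  have e1': "lin_map R Q1 Q0 e1" using lin_map_comp[OF e1 lin_map_kernel_incl] .
  interpret N: abelian_group N by (rule left_module_group[OF N])
  interpret X: abelian_group X by (rule left_module_group[OF X'])
  interpret Q0: abelian_group Q0 by (rule left_module_group[OF Q0'])
  interpret Q1: abelian_group Q1 by (rule left_module_group[OF Q1'])
  \<comment> \<open>By projectivity, \<open>u\<close> and \<open>v\<close> compare the two covers of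
    \<open>N\<close> over the identity, in both directions.\<close>
  obtain u where u: "lin_map R X Q0 u" "\<And>x. x \<in> carrier X \<Longrightarrow> \<epsilon> (u x) = \<pi> x"
    using in_add_lift[OF X Q0' N \<pi> eps] lin_map_closed[OF \<pi>] eps_surj by blast
  obtain v where v: "lin_map R Q0 X v" "\<And>q. q \<in> carrier Q0 \<Longrightarrow> \<pi> (v q) = \<epsilon> q"
    using in_add_lift[OF Q0 X' N eps \<pi>] lin_map_closed[OF eps] surj by blast
  have uv: "lin_map R Q0 Q0 (\<lambda>q. u (v q))" by (rule lin_map_comp[OF v(1) u(1)])
  \<comment> \<open>Going to \<open>X\<close> and back changes q by an element of the kernel of
    \<epsilon>, which \<open>w\<close> lifts through the cover \<open>e1\<close> of that
    kernel.\<close>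
  have "lin_map R Q0 ?K0 (\<lambda>q. q \<ominus>\<^bsub>Q0\<^esub> u (v q))"
    using lin_map_closed[OF v(1)] lin_map_closed[OF u(1)] lin_map_closed[OF eps]
    by (intro lin_map_into_kernel lin_map_diff Q0' lin_map_id uv)
      (simp add: lin_map_minus[OF Q0' N eps] u(2) v(2))
  from in_add_lift[OF Q0 Q1' K0 this e1] lin_map_closed[OF this]
  obtain w where w: "lin_map R Q0 Q1 w" "\<And>q. q \<in> carrier Q0 \<Longrightarrow> e1 (w q) = q \<ominus>\<^bsub>Q0\<^esub> u (v q)"
    using e1_surj by blast
  note closed = lin_map_closed[OF u(1)] lin_map_closed[OF v(1)] lin_map_closed[OF w(1)]
    lin_map_closed[OF e1'] lin_map_closed[OF \<pi>] lin_map_closed[OF eps]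
  have eps_e1: "\<epsilon> (e1 x) = \<zero>\<^bsub>N\<^esub>" if "x \<in> carrier Q1" for x
    using lin_map_closed[OF e1 that] by simp
  \<comment> \<open>A pair (x, p) yields q = e1 x + u p in \<open>Q0\<close> with \<epsilon> q =
    \<pi> p, so p - v q lies in the kernel of \<pi>. It vanishes iff p = v q, and then x differs
    from w q by an element of \<open>?K1\<close>; this dictates \<delta>.\<close>
  define e where "e = (\<lambda>z. snd z \<ominus>\<^bsub>X\<^esub> v (e1 (fst z) \<oplus>\<^bsub>Q0\<^esub> u (snd z)))"
  define \<delta> where "\<delta> = (\<lambda>z. (fst z \<oplus>\<^bsub>Q1\<^esub> w (snd z), v (snd z)))"
  have e: "lin_map R (prod_module Q1 X) (kernel_of X N \<pi>) e"
    unfolding e_def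
    by (intro lin_map_into_kernel lin_map_diff X' lin_map_snd lin_map_comp[OF _ v(1)]
        lin_map_plus Q0' lin_map_comp[OF lin_map_fst e1'] lin_map_comp[OF lin_map_snd u(1)])
      (auto simp: closed lin_map_minus[OF X' N \<pi>] v(2) lin_map_add[OF eps] eps_e1 u(2))
  have \<delta>: "lin_map R (prod_module ?K1 Q0) (prod_module Q1 X) \<delta>"
    unfolding \<delta>_def
    by (intro lin_map_pair lin_map_plus Q1' lin_map_comp[OF lin_map_snd v(1)]
        lin_map_comp[OF lin_map_snd w(1)] lin_map_comp[OF lin_map_fst lin_map_kernel_incl])
  show ?thesis
  proof (rule resolvable_extend[OF resolvable_prod[OF res1 K1 Q0] in_add_prod[OF Q1 X] _ _ e _ \<delta>])
    show "left_module R (kernel_of X N \<pi>)" by (rule left_module_kernel_of[OF X' N \<pi>])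
    show "left_module R (prod_module ?K1 Q0)" by (rule left_module_prod[OF K1 Q0'])
    show "e ` carrier (prod_module Q1 X) = carrier (kernel_of X N \<pi>)"
    proof (intro subset_antisym subsetI)
      fix x assume "x \<in> carrier (kernel_of X N \<pi>)"
      then have x: "x \<in> carrier X" "\<pi> x = \<zero>\<^bsub>N\<^esub>" by auto
      \<comment> \<open>For x in the kernel of \<pi>, -u x lies in the kernel of \<epsilon>; with a
        preimage q of it under \<open>e1\<close>, the correction term of e vanishes at (q,
        x).\<close>
      then have "\<ominus>\<^bsub>Q0\<^esub> u x \<in> e1 ` carrier Q1"
        unfolding e1_surj by (simp add: closed lin_map_neg[OF Q0' N eps] u(2))
      then obtain q where q: "q \<in> carrier Q1" "e1 q = \<ominus>\<^bsub>Q0\<^esub> u x" by auto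
      have "e (q, x) = x"
        using x q by (simp add: e_def closed Q0.l_neg lin_map_zero[OF Q0' X' v(1)] X.diff_zero)
      then show "x \<in> e ` carrier (prod_module Q1 X)"
        using x(1) q(1) by (intro image_eqI[of _ _ "(q, x)"]) simp_all
    qed (use lin_map_closed[OF e] in blast)
    have e\<delta>: "e1 (fst (\<delta> z)) = snd z \<ominus>\<^bsub>Q0\<^esub> u (v (snd z))"
      if "z \<in> carrier (prod_module ?K1 Q0)" for z
      using that by (auto simp: \<delta>_def lin_map_add[OF e1'] closed w(2))
    show "z = \<zero>\<^bsub>prod_module ?K1 Q0\<^esub>"
      if z: "z \<in> carrier (prod_module ?K1 Q0)" and 0: "\<delta> z = \<zero>\<^bsub>prod_module Q1 X\<^esub>" for z
    proof -
      obtain x q where z_eq: "z = (x, q)" by (cases z)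
      have xq: "x \<in> carrier Q1" "q \<in> carrier Q0" using z z_eq by auto
      have vq: "v q = \<zero>\<^bsub>X\<^esub>" and xw: "x \<oplus>\<^bsub>Q1\<^esub> w q = \<zero>\<^bsub>Q1\<^esub>" using 0 by (auto simp: z_eq \<delta>_def)
      have "e1 \<zero>\<^bsub>Q1\<^esub> = q \<ominus>\<^bsub>Q0\<^esub> u \<zero>\<^bsub>X\<^esub>" using e\<delta>[OF z] xw vq by (simp add: z_eq \<delta>_def)
      then have "q = \<zero>\<^bsub>Q0\<^esub>"
        using xq by (simp add: lin_map_zero[OF Q1' Q0' e1'] lin_map_zero[OF X' Q0' u(1)] Q0.diff_zero)
      then show ?thesis
        using xw xq by (simp add: z_eq lin_map_zero[OF Q0' Q1' w(1)])
    qed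
    show "\<delta> ` carrier (prod_module ?K1 Q0)
        = {z \<in> carrier (prod_module Q1 X). e z = \<zero>\<^bsub>kernel_of X N \<pi>\<^esub>}"
    proof (intro subset_antisym subsetI)
      fix y assume "y \<in> \<delta> ` carrier (prod_module ?K1 Q0)"
      then obtain z where z: "z \<in> carrier (prod_module ?K1 Q0)" "y = \<delta> z" by blast
      have "e (\<delta> z) = v (snd z) \<ominus>\<^bsub>X\<^esub> v (e1 (fst (\<delta> z)) \<oplus>\<^bsub>Q0\<^esub> u (v (snd z)))"
        by (simp add: e_def \<delta>_def)
      also have "\<dots> = \<zero>\<^bsub>X\<^esub>"
        using z(1) by (auto simp: e\<delta>[OF z(1)] closed Q0.minus_plus_cancel)
      finally show "y \<in> {z \<in> carrier (prod_module Q1 X). e z = \<zero>\<^bsub>kernel_of X N \<pi>\<^esub>}"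
        using lin_map_closed[OF \<delta> z(1)] z(2) by simp
    next
      fix y assume "y \<in> {z \<in> carrier (prod_module Q1 X). e z = \<zero>\<^bsub>kernel_of X N \<pi>\<^esub>}"
      then obtain x p where y: "y = (x, p)" "x \<in> carrier Q1" "p \<in> carrier X" "e (x, p) = \<zero>\<^bsub>X\<^esub>"
        by (cases y) auto
      define q where "q = e1 x \<oplus>\<^bsub>Q0\<^esub> u p"
      have q: "q \<in> carrier Q0" using y by (simp add: q_def closed)
      have p: "p = v q"
        using y(4) q y(3) by (simp add: e_def closed flip: q_def)
      have "q \<ominus>\<^bsub>Q0\<^esub> u (v q) = e1 x"
        unfolding p[symmetric] unfolding q_def using y(2,3)
        by (simp add: closed Q0.plus_minus_cancel)
      then have "e1 (x \<ominus>\<^bsub>Q1\<^esub> w q) = \<zero>\<^bsub>Q0\<^esub>"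
        using y(2) q by (simp add: lin_map_minus[OF Q1' Q0' e1'] closed w(2))
      moreover have "x \<ominus>\<^bsub>Q1\<^esub> w q \<oplus>\<^bsub>Q1\<^esub> w q = x"
        using y(2) q by (simp add: Q1.minus_plus_cancel closed)
      ultimately show "y \<in> \<delta> ` carrier (prod_module ?K1 Q0)"
        using y(2) q p by (intro image_eqI[of _ _ "(x \<ominus>\<^bsub>Q1\<^esub> w q, q)"])
          (simp_all add: y(1) \<delta>_def closed)
    qed
  qed
qed

text \<open>\<open>X'\<close>, \<open>h\<close> and \<open>\<pi>'\<close> are fixed before the
  resolution of the kernel is given, so one copy of \<open>X\<close> serves all resolutions.\<close>

lemma resolves_kernel_extend:
  fixes X :: "('a, 'x) module"
  assumes N: "left_module R N" and X: "in_add R X"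
    and \<pi>: "lin_map R X N \<pi>" and surj: "\<pi> ` carrier X = carrier N"
  obtains X' :: "('a, nat \<Rightarrow> 'a) module" and h \<pi>' where "lin_map R X X' h"
    "\<forall>(P :: nat \<Rightarrow> ('a, nat \<Rightarrow> 'a) module) d \<epsilon>. resolves R (kernel_of X N \<pi>) P d \<epsilon> \<longrightarrow>
       resolves R N (case_nat X' P) (case_nat (\<lambda>x. h (\<epsilon> x)) d) \<pi>'"
proof -
  note X' = in_add_left_module[OF X]
  obtain X2 :: "('a, nat \<Rightarrow> 'a) module" and h k where X2: "in_add R X2" and h: "lin_map R X X2 h"
    and k: "lin_map R X2 X k" and kh: "\<forall>x \<in> carrier X. k (h x) = x"
    and hk: "\<forall>x \<in> carrier X2. h (k x) = x"
    by (rule in_add_copy[OF X])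
  have k0: "k \<zero>\<^bsub>X2\<^esub> = \<zero>\<^bsub>X\<^esub>" by (rule lin_map_zero[OF in_add_left_module[OF X2] X' k])
  have kim: "k ` carrier X2 = carrier X"
  proof (intro subset_antisym subsetI)
    fix x assume x: "x \<in> carrier X"
    show "x \<in> k ` carrier X2"
      using lin_map_closed[OF h x] kh x by (intro image_eqI[of _ _ "h x"]) simp_all
  qed (use lin_map_closed[OF k] in auto)
  have "resolves R N (case_nat X2 P) (case_nat (\<lambda>x. h (\<epsilon> x)) d) (\<lambda>x. \<pi> (k x))"
    if res: "resolves R (kernel_of X N \<pi>) P d \<epsilon>" for P :: "nat \<Rightarrow> ('a, nat \<Rightarrow> 'a) module" and d \<epsilon>
  proof (rule resolves_extend[OF res X2 left_module_kernel_of[OF X' N \<pi>] lin_map_comp[OF k \<pi>]])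
    show "(\<lambda>x. \<pi> (k x)) ` carrier X2 = carrier N"
      using kim surj by (metis image_image)
    show "lin_map R (kernel_of X N \<pi>) X2 h"
      using h by (simp add: lin_map_def)
    show "x = \<zero>\<^bsub>kernel_of X N \<pi>\<^esub>" if "x \<in> carrier (kernel_of X N \<pi>)" "h x = \<zero>\<^bsub>X2\<^esub>" for x
      using kh that k0 by fastforce
    show "h ` carrier (kernel_of X N \<pi>) = {x \<in> carrier X2. \<pi> (k x) = \<zero>\<^bsub>N\<^esub>}"
    proof (intro subset_antisym subsetI)
      fix y assume y: "y \<in> {x \<in> carrier X2. \<pi> (k x) = \<zero>\<^bsub>N\<^esub>}"
      then show "y \<in> h ` carrier (kernel_of X N \<pi>)"
        using hk lin_map_closed[OF k] by (intro image_eqI[of _ _ "k y"]) auto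
    qed (use kh lin_map_closed[OF h] in auto)
  qed
  then show ?thesis using that[OF h] by blast
qed

text \<open>Dimension shifting without a long exact sequence: put \<open>X\<close> in front of a
  resolution of the kernel to get one of \<open>N\<close>. Its higher cocycle equations are those of
  the kernel shifted by one degree, and the lowest, Ext^1(N, A) = 0, extends maps from the kernel to
  \<open>X\<close>.\<close>

lemma semi_Gorenstein_projective_kernel:
  fixes R :: "'a ring"
  assumes sGp: "semi_Gorenstein_projective R N" and X: "in_add R X"
    and \<pi>: "lin_map R X N \<pi>" and surj: "\<pi> ` carrier X = carrier N"
  shows "semi_Gorenstein_projective R (kernel_of X N \<pi>)"
    and "lin_map R (kernel_of X N \<pi>) (regular_module R) l \<Longrightarrow>
      \<exists>g. lin_map R X (regular_module R) g \<and> (\<forall>x \<in> carrier (kernel_of X N \<pi>). l x = g x)"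
proof -
  let ?A = "regular_module R"
  have N: "left_module R N" and resN: "resolvable R N"
    using sGp by (simp_all add: semi_Gorenstein_projective_iff)
  note K = left_module_kernel_of[OF in_add_left_module[OF X] N \<pi>]
  note resK = resolvable_kernel[OF resN N X \<pi> surj]
  obtain X' :: "('a, nat \<Rightarrow> 'a) module" and h \<pi>' where h: "lin_map R X X' h"
    and ext: "\<forall>(P :: nat \<Rightarrow> ('a, nat \<Rightarrow> 'a) module) d \<epsilon>. resolves R (kernel_of X N \<pi>) P d \<epsilon> \<longrightarrow>
       resolves R N (case_nat X' P) (case_nat (\<lambda>x. h (\<epsilon> x)) d) \<pi>'"
    by (rule resolves_kernel_extend[OF N X \<pi> surj])
  have ac: "coacyclic R (case_nat X' P) (case_nat (\<lambda>x. h (\<epsilon> x)) d) ?A j"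
    if "resolves R (kernel_of X N \<pi>) P d \<epsilon>" for P :: "nat \<Rightarrow> ('a, nat \<Rightarrow> 'a) module" and d \<epsilon> j
    using semi_Gorenstein_projective_coacyclic[OF sGp] ext that by blast
  have "coacyclic R P d ?A j"
    if "resolves R (kernel_of X N \<pi>) P d \<epsilon>" for P :: "nat \<Rightarrow> ('a, nat \<Rightarrow> 'a) module" and d \<epsilon> j
    using ac[OF that, of "Suc j"] by (simp add: coacyclic_def)
  then show "semi_Gorenstein_projective R (kernel_of X N \<pi>)"
    unfolding semi_Gorenstein_projective_iff using K resK by blast
  assume l: "lin_map R (kernel_of X N \<pi>) ?A l"
  obtain P :: "nat \<Rightarrow> ('a, nat \<Rightarrow> 'a) module" and d \<epsilon> where
    res: "resolves R (kernel_of X N \<pi>) P d \<epsilon>" using resK unfolding resolvable_def by blast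
  \<comment> \<open>Composed with the augmentation, l becomes a cocycle in degree 1 of the extended
    complex, whose degree 0 is the copy of \<open>X\<close>.\<close>
  have z: "l (\<epsilon> (d 0 x)) = \<zero>\<^bsub>?A\<^esub>" if "x \<in> carrier (P (Suc 0))" for x
    using resolves_exact(1)[OF res that]
      lin_map_zero[OF K left_module_regular[OF left_module_ring[OF N]] l] by simp
  obtain g where g: "lin_map R X' ?A g" "\<forall>x \<in> carrier (P 0). l (\<epsilon> x) = g (h (\<epsilon> x))"
    using ac[OF res, of 0] lin_map_comp[OF resolvesD(4)[OF res] l] z
    unfolding coacyclic_def by auto
  have "l x = g (h x)" if "x \<in> carrier (kernel_of X N \<pi>)" for x
  proof -
    have "x \<in> \<epsilon> ` carrier (P 0)" using that resolvesD(5)[OF res] by simp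
    then show ?thesis using g(2) by blast
  qed
  then show "\<exists>g. lin_map R X ?A g \<and> (\<forall>x \<in> carrier (kernel_of X N \<pi>). l x = g x)"
    using lin_map_comp[OF h g(1)] by blast
qed

section \<open>Modules over upper triangular matrices\<close>

lemma T2_simps [simp]:
  "carrier (T2 A) = carrier A \<times> carrier A \<times> carrier A"
  "\<zero>\<^bsub>T2 A\<^esub> = (\<zero>\<^bsub>A\<^esub>, \<zero>\<^bsub>A\<^esub>, \<zero>\<^bsub>A\<^esub>)"
  "\<one>\<^bsub>T2 A\<^esub> = (\<one>\<^bsub>A\<^esub>, \<zero>\<^bsub>A\<^esub>, \<one>\<^bsub>A\<^esub>)"
  "(a1, a2, a3) \<oplus>\<^bsub>T2 A\<^esub> (b1, b2, b3) = (a1 \<oplus>\<^bsub>A\<^esub> b1, a2 \<oplus>\<^bsub>A\<^esub> b2, a3 \<oplus>\<^bsub>A\<^esub> b3)"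
  "(a1, a2, a3) \<otimes>\<^bsub>T2 A\<^esub> (b1, b2, b3)
     = (a1 \<otimes>\<^bsub>A\<^esub> b1, a1 \<otimes>\<^bsub>A\<^esub> b2 \<oplus>\<^bsub>A\<^esub> a2 \<otimes>\<^bsub>A\<^esub> b3, a3 \<otimes>\<^bsub>A\<^esub> b3)"
  by (simp_all add: T2_def)

lemma T2_add:
  "a \<oplus>\<^bsub>T2 A\<^esub> b = (fst a \<oplus>\<^bsub>A\<^esub> fst b, fst (snd a) \<oplus>\<^bsub>A\<^esub> fst (snd b), snd (snd a) \<oplus>\<^bsub>A\<^esub> snd (snd b))"
  by (cases a; cases b) simp

lemma T2_mult:
  "a \<otimes>\<^bsub>T2 A\<^esub> b = (fst a \<otimes>\<^bsub>A\<^esub> fst b,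
     fst a \<otimes>\<^bsub>A\<^esub> fst (snd b) \<oplus>\<^bsub>A\<^esub> fst (snd a) \<otimes>\<^bsub>A\<^esub> snd (snd b), snd (snd a) \<otimes>\<^bsub>A\<^esub> snd (snd b))"
  by (cases a; cases b) simp

lemma ring_T2:
  assumes "ring A"
  shows "ring (T2 A)"
proof -
  interpret A: ring A by fact
  have "abelian_group (T2 A)"
  proof (rule abelian_groupI)
    fix x assume "x \<in> carrier (T2 A)"
    then show "\<exists>y\<in>carrier (T2 A). y \<oplus>\<^bsub>T2 A\<^esub> x = \<zero>\<^bsub>T2 A\<^esub>"
      by (cases x) (auto simp: A.l_neg intro!: bexI[of _ "\<ominus>\<^bsub>A\<^esub> _"])
  qed (auto simp: A.a_ac)
  moreover have "monoid (T2 A)"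
    by (rule monoidI) (auto simp: A.m_assoc A.l_distr A.r_distr A.a_ac)
  ultimately show ?thesis
    by (rule ringI) (auto simp: A.l_distr A.r_distr A.a_ac)
qed

lemma T2_module_simps [simp]:
  "carrier (T2_module X Y \<phi>) = carrier X \<times> carrier Y"
  "\<zero>\<^bsub>T2_module X Y \<phi>\<^esub> = (\<zero>\<^bsub>X\<^esub>, \<zero>\<^bsub>Y\<^esub>)"
  "(x, y) \<oplus>\<^bsub>T2_module X Y \<phi>\<^esub> (x', y') = (x \<oplus>\<^bsub>X\<^esub> x', y \<oplus>\<^bsub>Y\<^esub> y')"
  "(a1, a2, a3) \<odot>\<^bsub>T2_module X Y \<phi>\<^esub> (x, y) = (a1 \<odot>\<^bsub>X\<^esub> x \<oplus>\<^bsub>X\<^esub> a2 \<odot>\<^bsub>X\<^esub> \<phi> y, a3 \<odot>\<^bsub>Y\<^esub> y)"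
  by (simp_all add: T2_module_def)

lemma left_module_T2_module:
  assumes "left_module A X" "left_module A Y" "lin_map A Y X \<phi>"
  shows "left_module (T2 A) (T2_module X Y \<phi>)"
proof -
  interpret X: left_module A X by fact
  interpret Y: left_module A Y by fact
  note \<phi> = lin_map_closed[OF assms(3)] lin_map_add[OF assms(3)] lin_map_smult[OF assms(3)]
  show ?thesis
    by (rule left_moduleI[OF ring_T2[OF left_module_ring[OF assms(1)]]])
      (auto simp: \<phi> X.M.a_ac X.smult_l_distr X.smult_r_distr X.smult_assoc
        X.smult_one X.zero_smult X.smult_closed Y.M.a_ac Y.smult_l_distr Y.smult_r_distr
        Y.smult_assoc Y.smult_one Y.zero_smult Y.smult_closed)
qed

lemma lin_map_T2_module:
  assumes "lin_map A X X' f" "lin_map A Y Y' g" "left_module A X" "left_module A X'"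
    and "lin_map A Y X \<phi>" "\<And>y. y \<in> carrier Y \<Longrightarrow> \<phi>' (g y) = f (\<phi> y)"
  shows "lin_map (T2 A) (T2_module X Y \<phi>) (T2_module X' Y' \<phi>') (\<lambda>(x, y). (f x, g y))"
proof -
  interpret X: left_module A X by fact
  note f = lin_map_closed[OF assms(1)] lin_map_add[OF assms(1)] lin_map_smult[OF assms(1)]
  note g = lin_map_closed[OF assms(2)] lin_map_add[OF assms(2)] lin_map_smult[OF assms(2)]
  show ?thesis
    by (rule lin_mapI) (auto simp: f g assms(6) X.smult_closed lin_map_closed[OF assms(5)])
qed

text \<open>The triple is the sum of (Q, Q), with the identity, and (X, 0); these are retracts of
  sums of the second column (A, A) and of the first column (A, 0) of \<open>T2 A\<close>.\<close>

lemma in_add_T2_module: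
  fixes A :: "'a ring"
  assumes Q: "in_add A Q" and X: "in_add A X"
  shows "in_add (T2 A) (T2_module (prod_module Q X) Q (\<lambda>q. (q, \<zero>\<^bsub>X\<^esub>)))" (is "in_add _ ?C")
proof -
  note Q' = in_add_left_module[OF Q] and X' = in_add_left_module[OF X]
  note A = left_module_ring[OF Q']
  interpret A: ring A by (rule A)
  interpret Q: left_module A Q by (rule Q')
  interpret X: left_module A X by (rule X')
  obtain n s r where s: "lin_map A Q (free_module A n) s"
    and r: "lin_map A (free_module A n) Q r" and rs: "\<forall>x \<in> carrier Q. r (s x) = x"
    using Q unfolding in_add_iff by blast
  obtain m s' r' where s': "lin_map A X (free_module A m) s'"
    and r': "lin_map A (free_module A m) X r'" and rs': "\<forall>x \<in> carrier X. r' (s' x) = x"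
    using X unfolding in_add_iff by blast
  let ?F = "free_module (T2 A)"
  have in_add_F: "in_add (T2 A) (prod_module (?F n) (?F m))"
    using ring_T2[OF A] by (intro in_add_prod in_add_free)
  have inl: "lin_map A Q (prod_module Q X) (\<lambda>q. (q, \<zero>\<^bsub>X\<^esub>))"
    by (intro lin_map_pair lin_map_id lin_map_const_zero X')
  note C = left_module_T2_module[OF left_module_prod[OF Q' X'] Q' inl]
  have s_mem: "s x i \<in> carrier A" if "x \<in> carrier Q" "i < n" for x i
    using lin_map_closed[OF s that(1)] that(2) by auto
  have s'_mem: "s' x i \<in> carrier A" if "x \<in> carrier X" "i < m" for x i
    using lin_map_closed[OF s' that(1)] that(2) by auto
  note s_simps = lin_map_add[OF s] lin_map_smult[OF s] lin_map_add[OF s'] lin_map_smult[OF s']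
  \<comment> \<open>\<open>Q\<close> goes to the second column, its top copy to the upper row and
    its bottom copy to the lower; \<open>X\<close> goes to the first column. \<open>T\<close> below
    reads the same entries back.\<close>
  define S where "S = (\<lambda>((q, x), y). (\<lambda>i\<in>{..<n}. (\<zero>\<^bsub>A\<^esub>, s q i, s y i), \<lambda>i\<in>{..<m}. (s' x i, \<zero>\<^bsub>A\<^esub>, \<zero>\<^bsub>A\<^esub>)))"
  have S: "lin_map (T2 A) ?C (prod_module (?F n) (?F m)) S"
  proof (rule lin_mapI)
    fix z assume "z \<in> carrier ?C"
    then show "S z \<in> carrier (prod_module (?F n) (?F m))"
      by (auto simp: S_def s_mem s'_mem split: if_splits)
  next
    fix z z' assume "z \<in> carrier ?C" "z' \<in> carrier ?C"
    then show "S (z \<oplus>\<^bsub>?C\<^esub> z') = S z \<oplus>\<^bsub>prod_module (?F n) (?F m)\<^esub> S z'"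
      by (auto simp: S_def s_simps intro!: restrict_ext)
  next
    fix a z assume "a \<in> carrier (T2 A)" "z \<in> carrier ?C"
    then show "S (a \<odot>\<^bsub>?C\<^esub> z) = a \<odot>\<^bsub>prod_module (?F n) (?F m)\<^esub> S z"
      by (auto simp: S_def s_simps s_mem s'_mem Q.smult_closed X.smult_closed X.smult_zero
          intro!: restrict_ext)
  qed
  define T where "T = (\<lambda>(v :: nat \<Rightarrow> 'a \<times> 'a \<times> 'a, w :: nat \<Rightarrow> 'a \<times> 'a \<times> 'a). ((r (\<lambda>i\<in>{..<n}. fst (snd (v i))), r' (\<lambda>i\<in>{..<m}. fst (w i))),
    r (\<lambda>i\<in>{..<n}. snd (snd (v i)))))"
  have F_mem: "fst (v i) \<in> carrier A" "fst (snd (v i)) \<in> carrier A" "snd (snd (v i)) \<in> carrier A"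
    if "v \<in> carrier (?F k)" "i < k" for v i k
    using PiE_mem[of v "{..<k}" "\<lambda>_. carrier (T2 A)" i] that by (auto simp: mem_Times_iff)
  have F_vec: "(\<lambda>i\<in>{..<k}. fst (v i)) \<in> carrier (free_module A k)"
    "(\<lambda>i\<in>{..<k}. fst (snd (v i))) \<in> carrier (free_module A k)"
    "(\<lambda>i\<in>{..<k}. snd (snd (v i))) \<in> carrier (free_module A k)"
    if "v \<in> carrier (?F k)" for v k
    using F_mem[OF that] by auto
  have T: "lin_map (T2 A) (prod_module (?F n) (?F m)) ?C T"
  proof (rule lin_mapI)
    fix z assume "z \<in> carrier (prod_module (?F n) (?F m))"
    then show "T z \<in> carrier ?C"
      using F_vec lin_map_closed[OF r] lin_map_closed[OF r']
      by (auto simp: T_def simp del: free_module_simps)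
  next
    fix z z' assume z: "z \<in> carrier (prod_module (?F n) (?F m))" "z' \<in> carrier (prod_module (?F n) (?F m))"
    obtain v w v' w' where zz: "z = (v, w)" "z' = (v', w')" by (cases z; cases z')
    have mem: "v \<in> carrier (?F n)" "v' \<in> carrier (?F n)" "w \<in> carrier (?F m)" "w' \<in> carrier (?F m)"
      using z zz by auto
    have "(\<lambda>i\<in>{..<n}. fst (snd ((v \<oplus>\<^bsub>?F n\<^esub> v') i)))
        = (\<lambda>i\<in>{..<n}. fst (snd (v i))) \<oplus>\<^bsub>free_module A n\<^esub> (\<lambda>i\<in>{..<n}. fst (snd (v' i)))"
      "(\<lambda>i\<in>{..<n}. snd (snd ((v \<oplus>\<^bsub>?F n\<^esub> v') i)))
        = (\<lambda>i\<in>{..<n}. snd (snd (v i))) \<oplus>\<^bsub>free_module A n\<^esub> (\<lambda>i\<in>{..<n}. snd (snd (v' i)))"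
      "(\<lambda>i\<in>{..<m}. fst ((w \<oplus>\<^bsub>?F m\<^esub> w') i))
        = (\<lambda>i\<in>{..<m}. fst (w i)) \<oplus>\<^bsub>free_module A m\<^esub> (\<lambda>i\<in>{..<m}. fst (w' i))"
      by (auto simp: T2_add intro!: restrict_ext)
    then show "T (z \<oplus>\<^bsub>prod_module (?F n) (?F m)\<^esub> z') = T z \<oplus>\<^bsub>?C\<^esub> T z'"
      using F_vec mem
      by (simp add: zz T_def lin_map_add[OF r] lin_map_add[OF r'] del: free_module_simps)
  next
    fix a z assume a: "a \<in> carrier (T2 A)" and z: "z \<in> carrier (prod_module (?F n) (?F m))"
    obtain v w where zz: "z = (v, w)" by (cases z)
    obtain a1 a2 a3 where aa: "a = (a1, a2, a3)" by (cases a)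
    have mem: "v \<in> carrier (?F n)" "w \<in> carrier (?F m)" using z zz by auto
    have a': "a1 \<in> carrier A" "a2 \<in> carrier A" "a3 \<in> carrier A" using a aa by auto
    have "(\<lambda>i\<in>{..<n}. fst (snd ((a \<odot>\<^bsub>?F n\<^esub> v) i)))
        = a1 \<odot>\<^bsub>free_module A n\<^esub> (\<lambda>i\<in>{..<n}. fst (snd (v i)))
            \<oplus>\<^bsub>free_module A n\<^esub> a2 \<odot>\<^bsub>free_module A n\<^esub> (\<lambda>i\<in>{..<n}. snd (snd (v i)))"
      "(\<lambda>i\<in>{..<n}. snd (snd ((a \<odot>\<^bsub>?F n\<^esub> v) i)))
        = a3 \<odot>\<^bsub>free_module A n\<^esub> (\<lambda>i\<in>{..<n}. snd (snd (v i)))"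
      "(\<lambda>i\<in>{..<m}. fst ((a \<odot>\<^bsub>?F m\<^esub> w) i)) = a1 \<odot>\<^bsub>free_module A m\<^esub> (\<lambda>i\<in>{..<m}. fst (w i))"
      by (auto simp: T2_mult aa intro!: restrict_ext)
    moreover have "a \<odot>\<^bsub>free_module A n\<^esub> v \<in> carrier (free_module A n)"
      if "a \<in> carrier A" "v \<in> carrier (free_module A n)" for a v
      using left_module.smult_closed[OF left_module_free[OF A] that] .
    ultimately show "T (a \<odot>\<^bsub>prod_module (?F n) (?F m)\<^esub> z) = a \<odot>\<^bsub>?C\<^esub> T z"
      using F_vec mem a' lin_map_closed[OF r] lin_map_closed[OF r']
      by (simp add: zz T_def lin_map_add[OF r] lin_map_smult[OF r] lin_map_smult[OF r']
          del: free_module_simps)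
        (simp add: aa X.smult_zero X.smult_closed)
  qed
  have "T (S z) = z" if "z \<in> carrier ?C" for z
  proof -
    obtain q x y where z: "z = ((q, x), y)" by (metis prod.collapse)
    have mem: "q \<in> carrier Q" "x \<in> carrier X" "y \<in> carrier Q" using that z by auto
    have "restrict (s q) {..<n} = s q" "restrict (s y) {..<n} = s y" "restrict (s' x) {..<m} = s' x"
      using lin_map_closed[OF s] lin_map_closed[OF s'] mem by (auto intro!: extensional_restrict simp: PiE_iff)
    then show ?thesis
      using rs rs' mem by (simp add: z S_def T_def cong: restrict_cong)
  qed
  from in_add_retract[OF in_add_F C S T this] show ?thesis .
qed

text \<open>A bottom element is lifted through \<epsilon>, and its lift has the right image on the
  top by \<phi>; the summand (X, 0) covers the rest of the top. In the kernel the X-coordinate is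
  forced to be -\<phi> (\<epsilon> q), so the top of the kernel is a copy of \<open>Q\<close> and
  its bottom is the kernel of \<epsilon>.\<close>

lemma T2_module_cover:
  assumes Q: "in_add A Q" and X: "in_add A X" and Y: "left_module A Y" and \<phi>: "lin_map A Y X \<phi>"
    and \<epsilon>: "lin_map A Q Y \<epsilon>" and surj: "\<epsilon> ` carrier Q = carrier Y"
  defines "C \<equiv> T2_module (prod_module Q X) Q (\<lambda>q. (q, \<zero>\<^bsub>X\<^esub>))"
    and "e \<equiv> (\<lambda>(p, y). (\<phi> (\<epsilon> (fst p)) \<oplus>\<^bsub>X\<^esub> snd p, \<epsilon> y))"
    and "K \<equiv> T2_module Q (kernel_of Q Y \<epsilon>) (\<lambda>x. x)"
    and "\<delta> \<equiv> (\<lambda>(q, k). ((q, \<ominus>\<^bsub>X\<^esub> \<phi> (\<epsilon> q)), k))"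
  shows "lin_map (T2 A) C (T2_module X Y \<phi>) e"
    and "e ` carrier C = carrier (T2_module X Y \<phi>)"
    and "left_module (T2 A) K"
    and "lin_map (T2 A) K C \<delta>"
    and "\<And>z. z \<in> carrier K \<Longrightarrow> \<delta> z = \<zero>\<^bsub>C\<^esub> \<Longrightarrow> z = \<zero>\<^bsub>K\<^esub>"
    and "\<delta> ` carrier K = {z \<in> carrier C. e z = \<zero>\<^bsub>T2_module X Y \<phi>\<^esub>}"
proof -
  note Q' = in_add_left_module[OF Q] and X' = in_add_left_module[OF X]
  interpret X: left_module A X by (rule X')
  interpret Q: left_module A Q by (rule Q')
  interpret Y: left_module A Y by (rule Y)
  have \<phi>\<epsilon>: "lin_map A Q X (\<lambda>q. \<phi> (\<epsilon> q))" by (rule lin_map_comp[OF \<epsilon> \<phi>])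
  have inl: "lin_map A Q (prod_module Q X) (\<lambda>q. (q, \<zero>\<^bsub>X\<^esub>))"
    by (intro lin_map_pair lin_map_id lin_map_const_zero X')
  note closed = lin_map_closed[OF \<phi>] lin_map_closed[OF \<epsilon>]
  note K' = left_module_kernel_of[OF Q' Y \<epsilon>]
  show "lin_map (T2 A) C (T2_module X Y \<phi>) e"
    unfolding C_def e_def
    by (intro lin_map_T2_module lin_map_plus X' lin_map_comp[OF lin_map_fst \<phi>\<epsilon>] lin_map_snd \<epsilon>
        left_module_prod Q' inl) (simp add: closed)
  show "e ` carrier C = carrier (T2_module X Y \<phi>)"
  proof (intro subset_antisym subsetI)
    fix z assume "z \<in> carrier (T2_module X Y \<phi>)"
    then obtain x y where z: "z = (x, y)" "x \<in> carrier X" "y \<in> carrier Y" by auto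
    obtain q where q: "q \<in> carrier Q" "y = \<epsilon> q" using z(3) surj by blast
    show "z \<in> e ` carrier C"
      using z q closed lin_map_zero[OF Q' X' \<phi>\<epsilon>]
      by (intro image_eqI[of _ _ "((\<zero>\<^bsub>Q\<^esub>, x), q)"]) (auto simp: C_def e_def)
  qed (auto simp: C_def e_def closed)
  show K: "left_module (T2 A) K"
    unfolding K_def by (rule left_module_T2_module[OF Q' K' lin_map_kernel_incl])
  show "lin_map (T2 A) K C \<delta>"
    unfolding K_def C_def \<delta>_def
    by (intro lin_map_T2_module lin_map_pair lin_map_id lin_map_uminus \<phi>\<epsilon> X' Q' left_module_prod
        lin_map_kernel_incl) (auto simp: lin_map_zero[OF Y X' \<phi>] X.M.minus_equality[of "\<zero>\<^bsub>X\<^esub>" "\<zero>\<^bsub>X\<^esub>"])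
  show "z = \<zero>\<^bsub>K\<^esub>" if "z \<in> carrier K" "\<delta> z = \<zero>\<^bsub>C\<^esub>" for z
    using that by (auto simp: K_def C_def \<delta>_def)
  show "\<delta> ` carrier K = {z \<in> carrier C. e z = \<zero>\<^bsub>T2_module X Y \<phi>\<^esub>}"
  proof (intro subset_antisym subsetI)
    fix z assume "z \<in> {z \<in> carrier C. e z = \<zero>\<^bsub>T2_module X Y \<phi>\<^esub>}"
    then obtain q x k where z: "z = ((q, x), k)" "q \<in> carrier Q" "x \<in> carrier X" "k \<in> carrier Q"
      "\<phi> (\<epsilon> q) \<oplus>\<^bsub>X\<^esub> x = \<zero>\<^bsub>X\<^esub>" "\<epsilon> k = \<zero>\<^bsub>Y\<^esub>"
      by (auto simp: C_def e_def)
    have "x \<oplus>\<^bsub>X\<^esub> \<phi> (\<epsilon> q) = \<zero>\<^bsub>X\<^esub>" using z by (simp add: X.M.a_comm closed)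
    then have "\<ominus>\<^bsub>X\<^esub> \<phi> (\<epsilon> q) = x"
      using z by (intro X.M.minus_equality) (auto simp: closed)
    then show "z \<in> \<delta> ` carrier K"
      using z by (intro image_eqI[of _ _ "(q, k)"]) (auto simp: K_def \<delta>_def)
  qed (auto simp: K_def C_def e_def \<delta>_def closed X.M.r_neg)
qed

text \<open>
  The kernel of the cover above is again a module of the same kind (with \<open>X\<close> replaced by \<open>Q\<close> and \<open>Y\<close>
  by the kernel of \<open>\<epsilon>\<close>), so the covers can be spliced along a resolution of \<open>Y\<close>.
\<close>

lemma resolvable_T2_module:
  fixes A :: "'a ring"
  assumes X: "in_add A X" and Y: "left_module A Y" and resY: "resolvable A Y" and \<phi>: "lin_map A Y X \<phi>"
  shows "resolvable (T2 A) (T2_module X Y \<phi>)"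
proof -
  obtain P :: "nat \<Rightarrow> ('a, nat \<Rightarrow> 'a) module" and d \<epsilon> where res: "resolves A Y P d \<epsilon>"
    using resY unfolding resolvable_def by blast
  note P = resolvesD(1)[OF res]
  \<comment> \<open>The first cover is kept apart: it involves the element type of \<open>X\<close>,
    while the later covers involve only terms of the resolution of \<open>Y\<close>.\<close>
  note cover0 = T2_module_cover[OF P X Y \<phi> resolvesD(4,5)[OF res]]
  define K where "K = case_nat (kernel_of (P 0) Y \<epsilon>) (\<lambda>i. kernel_of (P (Suc i)) (P i) (d i))"
  have K: "left_module A (K i)" and d: "lin_map A (P (Suc i)) (K i) (d i)"
    and surj: "d i ` carrier (P (Suc i)) = carrier (K i)"
    and incl: "lin_map A (K i) (P i) (\<lambda>x. x)"
    and K_Suc: "kernel_of (P (Suc i)) (K i) (d i) = K (Suc i)" for i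
  proof -
    show "left_module A (K i)"
      using left_module_kernel_of[OF resolvesD(2)[OF res] Y resolvesD(4)[OF res]]
        left_module_kernel_of[OF resolvesD(2,2,3)[OF res]]
      by (simp add: K_def split: nat.split)
    show surj: "d i ` carrier (P (Suc i)) = carrier (K i)"
      using resolvesD(6,7)[OF res] by (simp add: K_def split: nat.split)
    have "x \<in> carrier (P (Suc i)) \<Longrightarrow> d i x \<in> carrier (K i)" for x
      using surj by blast
    then show "lin_map A (P (Suc i)) (K i) (d i)"
      using resolvesD(3)[OF res, of i] by (simp add: lin_map_def K_def split: nat.split)
    show "lin_map A (K i) (P i) (\<lambda>x. x)"
      by (simp add: K_def lin_map_kernel_incl split: nat.split)
    show "kernel_of (P (Suc i)) (K i) (d i) = K (Suc i)"
      by (simp add: K_def kernel_of_def split: nat.split)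
  qed
  \<comment> \<open>From the first kernel on, the structure map is the inclusion of the syzygy
    \<open>K i\<close> into \<open>P i\<close>, and \<open>d i\<close> covers the bottom.\<close>
  note cover = T2_module_cover[OF P P K incl d surj, unfolded K_Suc]
  have N: "left_module (T2 A) (T2_module (P i) (K i) (\<lambda>x. x))" for i
    by (intro left_module_T2_module resolvesD(2)[OF res] K incl)
  have resK: "resolvable (T2 A) (T2_module (P 0) (K 0) (\<lambda>x. x))"
    by (rule resolvable_if_resolves[OF resolves_splice[where N = "\<lambda>i. T2_module (P i) (K i) (\<lambda>x. x)",
            OF in_add_T2_module[OF P P] N cover(1,2,4,5,6)] N])
  have K0: "K 0 = kernel_of (P 0) Y \<epsilon>" by (simp add: K_def)
  show ?thesis
    by (rule resolvable_extend[OF resK[unfolded K0] in_add_T2_module[OF P X]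
          left_module_T2_module[OF in_add_left_module[OF X] Y \<phi>] cover0(3,1,2,4,5,6)])
qed

section \<open>Factoring maps through surjections and transporting resolutions\<close>

lemma lin_map_factor:
  assumes P: "left_module R P" and N: "left_module R N" and M: "left_module R M"
    and e: "lin_map R P N e" and surj: "e ` carrier P = carrier N" and f: "lin_map R P M f"
    and ker: "\<And>x. x \<in> carrier P \<Longrightarrow> e x = \<zero>\<^bsub>N\<^esub> \<Longrightarrow> f x = \<zero>\<^bsub>M\<^esub>"
  obtains l where "lin_map R N M l" "\<forall>x \<in> carrier P. l (e x) = f x"
proof -
  interpret P: left_module R P by fact
  interpret N: left_module R N by fact
  interpret M: left_module R M by fact
  \<comment> \<open>Makes the choice of a preimage in \<open>l\<close> immaterial.\<close>
  have eq: "f x = f y" if xy: "x \<in> carrier P" "y \<in> carrier P" "e x = e y" for x y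
  proof -
    have "f (x \<ominus>\<^bsub>P\<^esub> y) = \<zero>\<^bsub>M\<^esub>"
      using xy lin_map_closed[OF e] by (intro ker) (simp_all add: lin_map_minus[OF P N e])
    then show ?thesis
      using xy lin_map_closed[OF f] by (simp add: lin_map_minus[OF P M f])
  qed
  define l where "l y = f (SOME x. x \<in> carrier P \<and> e x = y)" for y
  have l: "l (e x) = f x" if x: "x \<in> carrier P" for x
  proof -
    have "(SOME z. z \<in> carrier P \<and> e z = e x) \<in> carrier P \<and> e (SOME z. z \<in> carrier P \<and> e z = e x) = e x"
      by (rule someI[of _ x]) (simp add: x)
    then show ?thesis unfolding l_def using x by (intro eq) auto
  qed
  have "lin_map R N M l"
  proof (rule lin_mapI)
    fix y assume "y \<in> carrier N"
    then obtain x where x: "x \<in> carrier P" "y = e x" using surj by blast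
    then show "l y \<in> carrier M" using l lin_map_closed[OF f] by simp
  next
    fix y y' assume "y \<in> carrier N" "y' \<in> carrier N"
    then obtain x x' where x: "x \<in> carrier P" "y = e x" "x' \<in> carrier P" "y' = e x'"
      using surj by blast
    then have "l (e (x \<oplus>\<^bsub>P\<^esub> x')) = l (e x) \<oplus>\<^bsub>M\<^esub> l (e x')"
      by (simp add: l lin_map_add[OF f])
    then show "l (y \<oplus>\<^bsub>N\<^esub> y') = l y \<oplus>\<^bsub>M\<^esub> l y'"
      using x by (simp add: lin_map_add[OF e])
  next
    fix r y assume "r \<in> carrier R" "y \<in> carrier N"
    then obtain x where x: "r \<in> carrier R" "x \<in> carrier P" "y = e x" using surj by blast
    then have "l (e (r \<odot>\<^bsub>P\<^esub> x)) = r \<odot>\<^bsub>M\<^esub> l (e x)"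
      by (simp add: l lin_map_smult[OF f] P.smult_closed)
    then show "l (r \<odot>\<^bsub>N\<^esub> y) = r \<odot>\<^bsub>M\<^esub> l y"
      using x by (simp add: lin_map_smult[OF e])
  qed
  then show ?thesis using that l by blast
qed

lemma resolves_iso:
  assumes res: "resolves R N P d \<epsilon>" and N: "left_module R N" and N': "left_module R N'"
    and h: "lin_map R N N' h" and surj: "h ` carrier N = carrier N'"
    and inj: "\<And>x. x \<in> carrier N \<Longrightarrow> h x = \<zero>\<^bsub>N'\<^esub> \<Longrightarrow> x = \<zero>\<^bsub>N\<^esub>"
  shows "resolves R N' P d (\<lambda>x. h (\<epsilon> x))"
proof -
  note eps = resolvesD(4)[OF res]
  have "h (\<epsilon> x) = \<zero>\<^bsub>N'\<^esub> \<longleftrightarrow> \<epsilon> x = \<zero>\<^bsub>N\<^esub>" if "x \<in> carrier (P 0)" for x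
    using inj[OF lin_map_closed[OF eps that]] lin_map_zero[OF N N' h] by auto
  then have "{x \<in> carrier (P 0). h (\<epsilon> x) = \<zero>\<^bsub>N'\<^esub>} = d 0 ` carrier (P (Suc 0))"
    unfolding resolvesD(6)[OF res] by blast
  moreover have "(\<lambda>x. h (\<epsilon> x)) ` carrier (P 0) = carrier N'"
    using resolvesD(5)[OF res] surj by (metis image_image)
  ultimately show ?thesis
    unfolding resolves_def using resolvesD(1,3,7)[OF res] lin_map_comp[OF eps h] by simp
qed

text \<open>
  A corner of \<open>B\<close> is a copy of \<open>A\<close> embedded by the (not necessarily unital) ring homomorphism \<open>\<iota>\<close>;
  \<open>corner_module\<close> is the functor sending \<open>M\<close> to its summand \<open>\<iota>(1) M\<close>.
\<close>

locale corner = A?: ring A + B?: ring B for A :: "'a ring" and B :: "'b ring" +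
  fixes \<iota> :: "'a \<Rightarrow> 'b"
  assumes \<iota>_closed: "a \<in> carrier A \<Longrightarrow> \<iota> a \<in> carrier B"
    and \<iota>_zero: "\<iota> \<zero>\<^bsub>A\<^esub> = \<zero>\<^bsub>B\<^esub>"
    and \<iota>_add: "\<lbrakk>a \<in> carrier A; b \<in> carrier A\<rbrakk> \<Longrightarrow> \<iota> (a \<oplus>\<^bsub>A\<^esub> b) = \<iota> a \<oplus>\<^bsub>B\<^esub> \<iota> b"
    and \<iota>_mult: "\<lbrakk>a \<in> carrier A; b \<in> carrier A\<rbrakk> \<Longrightarrow> \<iota> (a \<otimes>\<^bsub>A\<^esub> b) = \<iota> a \<otimes>\<^bsub>B\<^esub> \<iota> b"

definition corner_module :: "'a ring \<Rightarrow> ('a \<Rightarrow> 'b) \<Rightarrow> ('b, 'm) module \<Rightarrow> ('a, 'm) module" where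
  "corner_module A \<iota> M =
     \<lparr>carrier = {x \<in> carrier M. \<iota> \<one>\<^bsub>A\<^esub> \<odot>\<^bsub>M\<^esub> x = x}, mult = undefined, one = undefined,
      zero = \<zero>\<^bsub>M\<^esub>, add = add M, smult = (\<lambda>a x. \<iota> a \<odot>\<^bsub>M\<^esub> x)\<rparr>"

lemma corner_module_simps [simp]:
  "carrier (corner_module A \<iota> M) = {x \<in> carrier M. \<iota> \<one>\<^bsub>A\<^esub> \<odot>\<^bsub>M\<^esub> x = x}"
  "zero (corner_module A \<iota> M) = \<zero>\<^bsub>M\<^esub>" "add (corner_module A \<iota> M) = add M"
  "a \<odot>\<^bsub>corner_module A \<iota> M\<^esub> x = \<iota> a \<odot>\<^bsub>M\<^esub> x"
  by (simp_all add: corner_module_def)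

context corner
begin

abbreviation part :: "('b, 'm) module \<Rightarrow> ('a, 'm) module" where
  "part \<equiv> corner_module A \<iota>"

lemma smult_in_part:
  assumes "left_module B M" "a \<in> carrier A" "x \<in> carrier M"
  shows "\<iota> a \<odot>\<^bsub>M\<^esub> x \<in> carrier (part M)"
proof -
  interpret M: left_module B M by fact
  show ?thesis
    using assms(2,3) by (simp add: M.smult_closed \<iota>_closed flip: M.smult_assoc \<iota>_mult)
qed

lemma left_module_part:
  assumes "left_module B M"
  shows "left_module A (part M)"
proof -
  interpret M: left_module B M by fact
  have closed: "\<iota> a \<odot>\<^bsub>M\<^esub> x \<in> carrier (part M)" if "a \<in> carrier A" "x \<in> carrier (part M)" for a x
    using smult_in_part[OF assms that(1)] that(2) by simp
  show ?thesis
    by (rule left_moduleI[OF A.ring_axioms])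
      (use closed in \<open>auto simp: M.M.a_ac M.smult_r_distr \<iota>_closed \<iota>_add \<iota>_mult \<iota>_zero M.zero_smult
        M.smult_l_distr M.smult_assoc M.smult_zero\<close>)
qed

lemma lin_map_part:
  assumes "lin_map B M N f"
  shows "lin_map A (part M) (part N) f"
  using assms \<iota>_closed[OF A.one_closed]
  by (intro lin_mapI) (auto simp: lin_map_def \<iota>_closed simp flip: lin_map_smult[OF assms])

text \<open>Multiplication by the idempotent \<iota> 1 is natural and retracts a module onto its
  part, so exactness passes to the parts. Projectivity of the parts is assumed, since it can fail
  for a general corner.\<close>

lemma resolves_part:
  assumes res: "resolves B N P d \<epsilon>" and N: "left_module B N" and P: "\<And>i. in_add A (part (P i))"
  shows "resolves A (part N) (\<lambda>i. part (P i)) d \<epsilon>"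
proof -
  note d = resolvesD(3)[OF res] and eps = resolvesD(4)[OF res]
  let ?e = "\<iota> \<one>\<^bsub>A\<^esub>"
  have e: "?e \<in> carrier B" by (rule \<iota>_closed[OF A.one_closed])
  \<comment> \<open>A preimage of an element of the part becomes one inside the part after
    multiplication by the idempotent.\<close>
  have im: "f ` carrier (part M) = {x \<in> carrier (part L). x \<in> f ` carrier M}"
    if M: "left_module B M" and f: "lin_map B M L f" for f and M :: "('b, 'm) module" and L :: "('b, 'l) module"
  proof (intro subset_antisym subsetI)
    fix y assume "y \<in> {x \<in> carrier (part L). x \<in> f ` carrier M}"
    then obtain x where x: "x \<in> carrier M" "y = f x" "?e \<odot>\<^bsub>L\<^esub> y = y" by auto
    have "f (?e \<odot>\<^bsub>M\<^esub> x) = y" using x e lin_map_smult[OF f] by simp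
    then show "y \<in> f ` carrier (part M)"
      using smult_in_part[OF M A.one_closed x(1)] by blast
  qed (use lin_map_closed[OF lin_map_part[OF f]] in auto)
  have "\<epsilon> ` carrier (part (P 0)) = carrier (part N)"
    unfolding im[OF resolvesD(2)[OF res] eps] using resolvesD(5)[OF res] by auto
  moreover have "d 0 ` carrier (part (P (Suc 0))) = {x \<in> carrier (part (P 0)). \<epsilon> x = \<zero>\<^bsub>N\<^esub>}"
    unfolding im[OF resolvesD(2)[OF res] d] resolvesD(6)[OF res] by auto
  moreover have "d (Suc i) ` carrier (part (P (Suc (Suc i))))
      = {x \<in> carrier (part (P (Suc i))). d i x = \<zero>\<^bsub>P i\<^esub>}" for i
    unfolding im[OF resolvesD(2)[OF res] d] resolvesD(7)[OF res] by auto
  ultimately show ?thesis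
    unfolding resolves_def using P lin_map_part[OF d] lin_map_part[OF eps] by simp
qed

end

section \<open>Top and bottom of a module over triangular matrices\<close>

definition upper_corner :: "'a ring \<Rightarrow> 'a \<Rightarrow> 'a \<times> 'a \<times> 'a" where
  "upper_corner A a = (a, \<zero>\<^bsub>A\<^esub>, \<zero>\<^bsub>A\<^esub>)"

definition lower_corner :: "'a ring \<Rightarrow> 'a \<Rightarrow> 'a \<times> 'a \<times> 'a" where
  "lower_corner A a = (\<zero>\<^bsub>A\<^esub>, \<zero>\<^bsub>A\<^esub>, a)"

abbreviation top_part :: "'a ring \<Rightarrow> ('a \<times> 'a \<times> 'a, 'm) module \<Rightarrow> ('a, 'm) module" where
  "top_part A \<equiv> corner_module A (upper_corner A)"

abbreviation bot_part :: "'a ring \<Rightarrow> ('a \<times> 'a \<times> 'a, 'm) module \<Rightarrow> ('a, 'm) module" where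
  "bot_part A \<equiv> corner_module A (lower_corner A)"

lemma upper_corner:
  assumes "ring A"
  shows "corner A (T2 A) (upper_corner A)"
proof -
  interpret A: ring A by fact
  show ?thesis
    by (intro corner.intro corner_axioms.intro assms ring_T2) (auto simp: upper_corner_def)
qed

lemma lower_corner:
  assumes "ring A"
  shows "corner A (T2 A) (lower_corner A)"
proof -
  interpret A: ring A by fact
  show ?thesis
    by (intro corner.intro corner_axioms.intro assms ring_T2) (auto simp: lower_corner_def)
qed

context
  fixes A :: "'a ring"
  assumes ring_A: "ring A"
begin

interpretation A: ring A by (rule ring_A)

interpretation top: corner A "T2 A" "upper_corner A" by (rule upper_corner[OF ring_A])

interpretation bot: corner A "T2 A" "lower_corner A" by (rule lower_corner[OF ring_A])

text \<open>The off-diagonal matrix unit. Multiplication by it plays the structure map for modules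
  over \<open>T2 A\<close> that are not given as triples.\<close>

definition e12 :: "'a \<times> 'a \<times> 'a" where
  "e12 = (\<zero>\<^bsub>A\<^esub>, \<one>\<^bsub>A\<^esub>, \<zero>\<^bsub>A\<^esub>)"

lemma e12_closed: "e12 \<in> carrier (T2 A)"
  by (simp add: e12_def)

lemma lin_map_e12:
  assumes "left_module (T2 A) M"
  shows "lin_map A (bot_part A M) (top_part A M) (\<lambda>x. e12 \<odot>\<^bsub>M\<^esub> x)"
proof -
  interpret M: left_module "T2 A" M by fact
  have comm: "upper_corner A a \<otimes>\<^bsub>T2 A\<^esub> e12 = e12 \<otimes>\<^bsub>T2 A\<^esub> lower_corner A a"
    and one: "upper_corner A \<one>\<^bsub>A\<^esub> \<otimes>\<^bsub>T2 A\<^esub> e12 = e12" if "a \<in> carrier A" for a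
    using that by (simp_all add: upper_corner_def lower_corner_def e12_def)
  show ?thesis
  proof (rule lin_mapI)
    fix x assume "x \<in> carrier (bot_part A M)"
    then show "e12 \<odot>\<^bsub>M\<^esub> x \<in> carrier (top_part A M)"
      using one[OF A.one_closed] top.\<iota>_closed[OF A.one_closed] e12_closed
      by (simp add: M.smult_closed flip: M.smult_assoc)
  next
    fix r x assume "r \<in> carrier A" "x \<in> carrier (bot_part A M)"
    then show "e12 \<odot>\<^bsub>M\<^esub> (r \<odot>\<^bsub>bot_part A M\<^esub> x) = r \<odot>\<^bsub>top_part A M\<^esub> (e12 \<odot>\<^bsub>M\<^esub> x)"
      using comm[of r] top.\<iota>_closed[of r] bot.\<iota>_closed[of r] e12_closed
      by (simp flip: M.smult_assoc)
  qed (use e12_closed in \<open>auto simp: M.smult_r_distr\<close>)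
qed

lemma e12_smult_closed:
  assumes "left_module (T2 A) M" "x \<in> carrier (bot_part A M)"
  shows "e12 \<odot>\<^bsub>M\<^esub> x \<in> carrier (top_part A M)"
  using lin_map_closed[OF lin_map_e12[OF assms(1)] assms(2)] .

text \<open>In a free module a top vector consists of matrices (a1, a2, 0) and a bottom vector of
  matrices (0, 0, a3), and \<open>e12\<close> moves a3 to the middle. So reading the middle entry
  splits \<open>e12\<close> on a free module, and this passes to summands.\<close>

lemma in_add_parts:
  assumes Q: "in_add (T2 A) Q"
  shows "in_add A (top_part A Q)" and "in_add A (bot_part A Q)"
    and "\<exists>\<rho>. lin_map A (top_part A Q) (bot_part A Q) \<rho> \<and> (\<forall>y \<in> carrier (bot_part A Q). \<rho> (e12 \<odot>\<^bsub>Q\<^esub> y) = y)"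
proof -
  note Q' = in_add_left_module[OF Q]
  interpret Q: left_module "T2 A" Q by (rule Q')
  obtain n s r where s: "lin_map (T2 A) Q (free_module (T2 A) n) s"
    and r: "lin_map (T2 A) (free_module (T2 A) n) Q r" and rs: "\<forall>x \<in> carrier Q. r (s x) = x"
    using Q unfolding in_add_iff by blast
  let ?F = "free_module (T2 A) n" and ?G = "free_module A n"
  have s_mem: "fst (s x i) \<in> carrier A" "fst (snd (s x i)) \<in> carrier A" "snd (snd (s x i)) \<in> carrier A"
    if "x \<in> carrier Q" "i < n" for x i
    using PiE_mem[of "s x" "{..<n}" "\<lambda>_. carrier (T2 A)" i] lin_map_closed[OF s that(1)] that(2)
    by (auto simp: mem_Times_iff)
  have s_ext: "(\<lambda>i\<in>{..<n}. (fst (s x i), fst (snd (s x i)), snd (snd (s x i)))) = s x"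
    if "x \<in> carrier Q" for x
    using lin_map_closed[OF s that] by (simp add: PiE_iff extensional_restrict)
  have s_top: "s x i = (fst (s x i), fst (snd (s x i)), \<zero>\<^bsub>A\<^esub>)"
    if "x \<in> carrier (top_part A Q)" "i < n" for x i
  proof -
    have "s x = upper_corner A \<one>\<^bsub>A\<^esub> \<odot>\<^bsub>?F\<^esub> s x"
      using that(1) lin_map_smult[OF s top.\<iota>_closed[OF A.one_closed], of x] by simp
    then have "s x i = upper_corner A \<one>\<^bsub>A\<^esub> \<otimes>\<^bsub>T2 A\<^esub> s x i"
      using that(2) by (metis (no_types, lifting) free_module_simps(4) lessThan_iff restrict_apply')
    then show ?thesis
      using that s_mem[of x i] by (auto simp: upper_corner_def T2_mult prod_eq_iff)
  qed
  have s_bot: "s x i = (\<zero>\<^bsub>A\<^esub>, \<zero>\<^bsub>A\<^esub>, snd (snd (s x i)))"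
    if "x \<in> carrier (bot_part A Q)" "i < n" for x i
  proof -
    have "s x = lower_corner A \<one>\<^bsub>A\<^esub> \<odot>\<^bsub>?F\<^esub> s x"
      using that(1) lin_map_smult[OF s bot.\<iota>_closed[OF A.one_closed], of x] by simp
    then have "s x i = lower_corner A \<one>\<^bsub>A\<^esub> \<otimes>\<^bsub>T2 A\<^esub> s x i"
      using that(2) by (metis (no_types, lifting) free_module_simps(4) lessThan_iff restrict_apply')
    then show ?thesis
      using that s_mem[of x i] by (auto simp: lower_corner_def T2_mult prod_eq_iff)
  qed
  \<comment> \<open>One argument for three coordinate maps: \<open>p\<close> reads one matrix entry
    and \<iota> is the corner over which this reading is linear.\<close>
  have part_map: "lin_map A (corner_module A \<iota> Q) ?G (\<lambda>x. \<lambda>i\<in>{..<n}. p (s x i))"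
    if \<iota>: "\<And>a. a \<in> carrier A \<Longrightarrow> \<iota> a \<in> carrier (T2 A)"
      and p: "\<And>z. z \<in> carrier (T2 A) \<Longrightarrow> p z \<in> carrier A"
      "\<And>z z'. z \<in> carrier (T2 A) \<Longrightarrow> z' \<in> carrier (T2 A) \<Longrightarrow> p (z \<oplus>\<^bsub>T2 A\<^esub> z') = p z \<oplus>\<^bsub>A\<^esub> p z'"
      "\<And>a z. a \<in> carrier A \<Longrightarrow> z \<in> carrier (T2 A) \<Longrightarrow> p (\<iota> a \<otimes>\<^bsub>T2 A\<^esub> z) = a \<otimes>\<^bsub>A\<^esub> p z" for \<iota> p
  proof -
    have mem: "s x i \<in> carrier (T2 A)" if "x \<in> carrier Q" "i < n" for x i
      using PiE_mem[of "s x" "{..<n}" "\<lambda>_. carrier (T2 A)" i] lin_map_closed[OF s that(1)] that(2)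
      by simp
    show ?thesis
    proof (rule lin_mapI)
      fix x assume "x \<in> carrier (corner_module A \<iota> Q)"
      then show "(\<lambda>i\<in>{..<n}. p (s x i)) \<in> carrier ?G" using mem p(1) by simp
    next
      fix x y assume "x \<in> carrier (corner_module A \<iota> Q)" "y \<in> carrier (corner_module A \<iota> Q)"
      then show "(\<lambda>i\<in>{..<n}. p (s (x \<oplus>\<^bsub>corner_module A \<iota> Q\<^esub> y) i))
          = (\<lambda>i\<in>{..<n}. p (s x i)) \<oplus>\<^bsub>?G\<^esub> (\<lambda>i\<in>{..<n}. p (s y i))"
        using mem by (auto simp: p(2) lin_map_add[OF s] simp del: T2_simps intro!: restrict_ext)
    next
      fix a x assume "a \<in> carrier A" "x \<in> carrier (corner_module A \<iota> Q)"
      then show "(\<lambda>i\<in>{..<n}. p (s (a \<odot>\<^bsub>corner_module A \<iota> Q\<^esub> x) i)) = a \<odot>\<^bsub>?G\<^esub> (\<lambda>i\<in>{..<n}. p (s x i))"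
        using mem by (auto simp: p(3) \<iota> lin_map_smult[OF s] simp del: T2_simps intro!: restrict_ext)
    qed
  qed
  have p_top1: "lin_map A (top_part A Q) ?G (\<lambda>x. \<lambda>i\<in>{..<n}. fst (s x i))"
    by (rule part_map) (auto simp: upper_corner_def T2_mult T2_add)
  have p_top2: "lin_map A (top_part A Q) ?G (\<lambda>x. \<lambda>i\<in>{..<n}. fst (snd (s x i)))"
    by (rule part_map) (auto simp: upper_corner_def T2_mult T2_add)
  have p_bot: "lin_map A (bot_part A Q) ?G (\<lambda>x. \<lambda>i\<in>{..<n}. snd (snd (s x i)))"
    by (rule part_map) (auto simp: lower_corner_def T2_mult T2_add)
  \<comment> \<open>\<open>J1\<close> and \<open>J2\<close> rebuild a top or bottom element from its
    entries: matrices with zero lower entry, respectively with only the lower entry, followed by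
    \<open>r\<close>.\<close>
  let ?v = "\<lambda>z. \<lambda>i\<in>{..<n}. (fst z i, snd z i, \<zero>\<^bsub>A\<^esub>)" and ?w = "\<lambda>z. \<lambda>i\<in>{..<n}. (\<zero>\<^bsub>A\<^esub>, \<zero>\<^bsub>A\<^esub>, z i)"
  define J1 where "J1 = (\<lambda>z. r (?v z))"
  define J2 where "J2 = (\<lambda>z. r (?w z))"
  have mem1: "?v z \<in> carrier ?F"
    and mem1': "\<And>i. i < n \<Longrightarrow> fst z i \<in> carrier A" "\<And>i. i < n \<Longrightarrow> snd z i \<in> carrier A"
    if "z \<in> carrier (prod_module ?G ?G)" for z
    using that by (simp_all add: mem_Times_iff PiE_iff)
  have mem2: "?w v \<in> carrier ?F"
    and mem2': "\<And>i. i < n \<Longrightarrow> v i \<in> carrier A"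
    if "v \<in> carrier ?G" for v
    using that by (simp_all add: mem_Times_iff PiE_iff)
  have J1: "lin_map A (prod_module ?G ?G) (top_part A Q) J1"
  proof (rule lin_mapI)
    fix z assume z: "z \<in> carrier (prod_module ?G ?G)"
    note v = mem1[OF z]
    have "upper_corner A \<one>\<^bsub>A\<^esub> \<odot>\<^bsub>?F\<^esub> ?v z
        = ?v z"
      by (auto simp: upper_corner_def T2_mult mem1'[OF z] intro!: restrict_ext)
    then have "upper_corner A \<one>\<^bsub>A\<^esub> \<odot>\<^bsub>Q\<^esub> J1 z = J1 z"
      using lin_map_smult[OF r top.\<iota>_closed[OF A.one_closed] v] by (simp add: J1_def)
    then show "J1 z \<in> carrier (top_part A Q)"
      using lin_map_closed[OF r v] by (simp add: J1_def)
  next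
    fix z z' assume z: "z \<in> carrier (prod_module ?G ?G)" "z' \<in> carrier (prod_module ?G ?G)"
    note v = mem1[OF z(1)] mem1[OF z(2)]
    have "(\<lambda>i\<in>{..<n}. (fst (z \<oplus>\<^bsub>prod_module ?G ?G\<^esub> z') i, snd (z \<oplus>\<^bsub>prod_module ?G ?G\<^esub> z') i, \<zero>\<^bsub>A\<^esub>))
      = ?v z \<oplus>\<^bsub>?F\<^esub> ?v z'"
      by (cases z; cases z') (simp add: T2_add restrict_def fun_eq_iff)
    then show "J1 (z \<oplus>\<^bsub>prod_module ?G ?G\<^esub> z') = J1 z \<oplus>\<^bsub>top_part A Q\<^esub> J1 z'"
      using lin_map_add[OF r v] by (simp add: J1_def)
  next
    fix a z assume a: "a \<in> carrier A" and z: "z \<in> carrier (prod_module ?G ?G)"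
    note v = mem1[OF z]
    have "(\<lambda>i\<in>{..<n}. (fst (a \<odot>\<^bsub>prod_module ?G ?G\<^esub> z) i, snd (a \<odot>\<^bsub>prod_module ?G ?G\<^esub> z) i, \<zero>\<^bsub>A\<^esub>))
      = upper_corner A a \<odot>\<^bsub>?F\<^esub> ?v z"
      using a mem1'[OF z] by (cases z) (simp add: T2_mult upper_corner_def restrict_def fun_eq_iff)
    then show "J1 (a \<odot>\<^bsub>prod_module ?G ?G\<^esub> z) = a \<odot>\<^bsub>top_part A Q\<^esub> J1 z"
      using lin_map_smult[OF r top.\<iota>_closed[OF a] v] by (simp add: J1_def)
  qed
  have J2: "lin_map A ?G (bot_part A Q) J2"
  proof (rule lin_mapI)
    fix z assume z: "z \<in> carrier ?G"
    note v = mem2[OF z]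
    have "lower_corner A \<one>\<^bsub>A\<^esub> \<odot>\<^bsub>?F\<^esub> ?w z = ?w z"
      by (auto simp: lower_corner_def T2_mult mem2'[OF z] intro!: restrict_ext)
    then have "lower_corner A \<one>\<^bsub>A\<^esub> \<odot>\<^bsub>Q\<^esub> J2 z = J2 z"
      using lin_map_smult[OF r bot.\<iota>_closed[OF A.one_closed] v] by (simp add: J2_def)
    then show "J2 z \<in> carrier (bot_part A Q)"
      using lin_map_closed[OF r v] by (simp add: J2_def)
  next
    fix z z' assume z: "z \<in> carrier ?G" "z' \<in> carrier ?G"
    note v = mem2[OF z(1)] mem2[OF z(2)]
    have "(\<lambda>i\<in>{..<n}. (\<zero>\<^bsub>A\<^esub>, \<zero>\<^bsub>A\<^esub>, (z \<oplus>\<^bsub>?G\<^esub> z') i))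
      = ?w z \<oplus>\<^bsub>?F\<^esub> ?w z'"
      by (simp add: T2_add restrict_def fun_eq_iff)
    then show "J2 (z \<oplus>\<^bsub>?G\<^esub> z') = J2 z \<oplus>\<^bsub>bot_part A Q\<^esub> J2 z'"
      using lin_map_add[OF r v] by (simp add: J2_def del: free_module_simps)
  next
    fix a z assume a: "a \<in> carrier A" and z: "z \<in> carrier ?G"
    note v = mem2[OF z]
    have "(\<lambda>i\<in>{..<n}. (\<zero>\<^bsub>A\<^esub>, \<zero>\<^bsub>A\<^esub>, (a \<odot>\<^bsub>?G\<^esub> z) i))
      = lower_corner A a \<odot>\<^bsub>?F\<^esub> ?w z"
      using a mem2'[OF z] by (simp add: T2_mult lower_corner_def restrict_def fun_eq_iff)
    then show "J2 (a \<odot>\<^bsub>?G\<^esub> z) = a \<odot>\<^bsub>bot_part A Q\<^esub> J2 z"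
      using lin_map_smult[OF r bot.\<iota>_closed[OF a] v] by (simp add: J2_def del: free_module_simps)
  qed
  have J1_s: "J1 (\<lambda>i\<in>{..<n}. fst (s x i), \<lambda>i\<in>{..<n}. fst (snd (s x i))) = x"
    if xt: "x \<in> carrier (top_part A Q)" for x
  proof -
    have x: "x \<in> carrier Q" using xt by simp
    have "snd (snd (s x i)) = \<zero>\<^bsub>A\<^esub>" if "i < n" for i
      using arg_cong[OF s_top[OF xt that], of "\<lambda>z. snd (snd z)"] by simp
    then have "(\<lambda>i\<in>{..<n}. (fst (s x i), fst (snd (s x i)), \<zero>\<^bsub>A\<^esub>)) = s x"
      using s_ext[OF x] by (simp cong: restrict_cong)
    then show ?thesis using rs x by (simp add: J1_def cong: restrict_cong)
  qed
  have J2_s: "J2 (\<lambda>i\<in>{..<n}. snd (snd (s x i))) = x" if xb: "x \<in> carrier (bot_part A Q)" for x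
  proof -
    have x: "x \<in> carrier Q" using xb by simp
    have "fst (s x i) = \<zero>\<^bsub>A\<^esub>" "fst (snd (s x i)) = \<zero>\<^bsub>A\<^esub>" if "i < n" for i
      using arg_cong[OF s_bot[OF xb that], of fst]
        arg_cong[OF s_bot[OF xb that], of "\<lambda>z. fst (snd z)"] by simp_all
    then have "(\<lambda>i\<in>{..<n}. (\<zero>\<^bsub>A\<^esub>, \<zero>\<^bsub>A\<^esub>, snd (snd (s x i)))) = s x"
      using s_ext[OF x] by (simp cong: restrict_cong)
    then show ?thesis using rs x by (simp add: J2_def cong: restrict_cong)
  qed
  show "in_add A (top_part A Q)"
    by (rule in_add_retract[OF in_add_prod[OF in_add_free[OF ring_A] in_add_free[OF ring_A]]
          top.left_module_part[OF Q'] lin_map_pair[OF p_top1 p_top2] J1]) (rule J1_s)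
  show "in_add A (bot_part A Q)"
    by (rule in_add_retract[OF in_add_free[OF ring_A] bot.left_module_part[OF Q'] p_bot J2]) (rule J2_s)
  \<comment> \<open>The retraction of \<open>e12\<close> is the middle entry followed by
    \<open>J2\<close>.\<close>
  have "J2 (\<lambda>i\<in>{..<n}. fst (snd (s (e12 \<odot>\<^bsub>Q\<^esub> y) i))) = y" if "y \<in> carrier (bot_part A Q)" for y
  proof -
    have y: "y \<in> carrier Q" using that by simp
    have "(\<lambda>i\<in>{..<n}. fst (snd (s (e12 \<odot>\<^bsub>Q\<^esub> y) i))) = (\<lambda>i\<in>{..<n}. snd (snd (s y i)))"
      unfolding lin_map_smult[OF s e12_closed y] using s_mem[OF y]
      by (auto simp: e12_def T2_mult intro!: restrict_ext)
    then show ?thesis using J2_s[OF that] by simp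
  qed
  then show "\<exists>\<rho>. lin_map A (top_part A Q) (bot_part A Q) \<rho>
      \<and> (\<forall>y \<in> carrier (bot_part A Q). \<rho> (e12 \<odot>\<^bsub>Q\<^esub> y) = y)"
    using lin_map_comp[OF p_top2 J2] by blast
qed

end

text \<open>The two parts of a triple are \<open>X\<close> and \<open>Y\<close> up to a zero
  coordinate, and parts of projectives are projective, so a resolution passes to both
  corners.\<close>

lemma resolves_T2_parts:
  assumes X: "left_module A X" and Y: "left_module A Y" and \<phi>: "lin_map A Y X \<phi>"
    and res: "resolves (T2 A) (T2_module X Y \<phi>) Q d \<epsilon>"
  shows "resolves A X (\<lambda>i. top_part A (Q i)) d (\<lambda>z. fst (\<epsilon> z))"
    and "resolves A Y (\<lambda>i. bot_part A (Q i)) d (\<lambda>z. snd (\<epsilon> z))"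
proof -
  note A = left_module_ring[OF X]
  interpret A: ring A by (rule A)
  interpret X: left_module A X by (rule X)
  interpret Y: left_module A Y by (rule Y)
  interpret top: corner A "T2 A" "upper_corner A" by (rule upper_corner[OF A])
  interpret bot: corner A "T2 A" "lower_corner A" by (rule lower_corner[OF A])
  let ?M = "T2_module X Y \<phi>"
  note M = left_module_T2_module[OF X Y \<phi>]
  note \<phi>' = lin_map_closed[OF \<phi>]
  have top: "carrier (top_part A ?M) = carrier X \<times> {\<zero>\<^bsub>Y\<^esub>}"
    by (auto simp: upper_corner_def X.zero_smult Y.zero_smult X.smult_one \<phi>')
  have bot: "carrier (bot_part A ?M) = {\<zero>\<^bsub>X\<^esub>} \<times> carrier Y"
    by (auto simp: lower_corner_def X.zero_smult Y.smult_one \<phi>')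
  have fst: "lin_map A (top_part A ?M) X fst"
    by (rule lin_mapI)
      (auto simp: upper_corner_def X.zero_smult \<phi>' X.smult_closed)
  have snd: "lin_map A (bot_part A ?M) Y snd"
    by (rule lin_mapI) (auto simp: lower_corner_def)
  show "resolves A X (\<lambda>i. top_part A (Q i)) d (\<lambda>z. fst (\<epsilon> z))"
  proof (rule resolves_iso[OF top.resolves_part[OF res M in_add_parts(1)[OF A resolvesD(1)[OF res]]]
          top.left_module_part[OF M] X fst])
    show "fst ` carrier (top_part A ?M) = carrier X" unfolding top by force
    show "z = \<zero>\<^bsub>top_part A ?M\<^esub>" if "z \<in> carrier (top_part A ?M)" "fst z = \<zero>\<^bsub>X\<^esub>" for z
      using that unfolding top by auto
  qed
  show "resolves A Y (\<lambda>i. bot_part A (Q i)) d (\<lambda>z. snd (\<epsilon> z))"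
  proof (rule resolves_iso[OF bot.resolves_part[OF res M in_add_parts(2)[OF A resolvesD(1)[OF res]]]
          bot.left_module_part[OF M] Y snd])
    show "snd ` carrier (bot_part A ?M) = carrier Y" unfolding bot by force
    show "z = \<zero>\<^bsub>bot_part A ?M\<^esub>" if "z \<in> carrier (bot_part A ?M)" "snd z = \<zero>\<^bsub>Y\<^esub>" for z
      using that unfolding bot by auto
  qed
qed

text \<open>
  Maps from a triple to the column \<open>(A, 0)\<close> are maps from the top that vanish on the image of the
  bottom.  A cocycle of this kind bounds a map \<open>h\<close> on the top of the resolution; the obstruction is
  the restriction of \<open>h\<close> to the bottom, which is itself a cocycle, hence can be removed.
\<close>

lemma first_column_coboundary:
  fixes A :: "'a ring"
  assumes sGp: "semi_Gorenstein_projective A Y" and X: "in_add A X" and \<phi>: "lin_map A Y X \<phi>"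
    and ext: "\<And>l. lin_map A Y (regular_module A) l \<Longrightarrow>
      \<exists>l'. lin_map A X (regular_module A) l' \<and> (\<forall>y \<in> carrier Y. l y = l' (\<phi> y))"
    and res: "resolves (T2 A) (T2_module X Y \<phi>) Q d \<epsilon>"
    and f: "lin_map A (top_part A (Q (Suc i))) (regular_module A) f"
    and fd: "\<And>x. x \<in> carrier (top_part A (Q (Suc (Suc i)))) \<Longrightarrow> f (d (Suc i) x) = \<zero>\<^bsub>A\<^esub>"
    and fe: "\<And>y. y \<in> carrier (bot_part A (Q (Suc i))) \<Longrightarrow> f (e12 A \<odot>\<^bsub>Q (Suc i)\<^esub> y) = \<zero>\<^bsub>A\<^esub>"
  shows "\<exists>g. lin_map A (top_part A (Q i)) (regular_module A) g \<and>
    (\<forall>x \<in> carrier (top_part A (Q (Suc i))). f x = g (d i x)) \<and>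
    (\<forall>y \<in> carrier (bot_part A (Q i)). g (e12 A \<odot>\<^bsub>Q i\<^esub> y) = \<zero>\<^bsub>A\<^esub>)"
proof -
  let ?A = "regular_module A"
  let ?E = "\<lambda>i y. e12 A \<odot>\<^bsub>Q i\<^esub> y"
  note X' = in_add_left_module[OF X]
  note A = left_module_ring[OF X']
  have Y: "left_module A Y" using sGp by (simp add: semi_Gorenstein_projective_iff)
  interpret A: ring A by (rule A)
  interpret X: left_module A X by (rule X')
  interpret Y: left_module A Y by (rule Y)
  note A' = left_module_regular[OF A]
  note d = resolvesD(3)[OF res] and eps = resolvesD(4)[OF res]
  note resX = resolves_T2_parts(1)[OF X' Y \<phi> res] and resY = resolves_T2_parts(2)[OF X' Y \<phi> res]
  note top = resolvesD(2)[OF resX] and bot = resolvesD(2)[OF resY]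
  note dX = resolvesD(3)[OF resX] and dY = resolvesD(3)[OF resY]
  have E: "lin_map A (bot_part A (Q i)) (top_part A (Q i)) (?E i)" for i
    by (rule lin_map_e12[OF A resolvesD(2)[OF res]])
  have dE: "d i (?E (Suc i) y) = ?E i (d i y)" if "y \<in> carrier (bot_part A (Q (Suc i)))" for y i
    using that by (intro lin_map_smult[OF d e12_closed[OF A]]) simp
  \<comment> \<open>\<open>h\<close> bounds f on the top because \<open>X\<close> is projective, but
    it need not vanish on the image of the bottom, as the required g must.\<close>
  obtain h where h: "lin_map A (top_part A (Q i)) ?A h"
    "\<And>x. x \<in> carrier (top_part A (Q (Suc i))) \<Longrightarrow> f x = h (d i x)"
    using coacyclicE[OF projective_coacyclic[OF resX X A', of i] f] fd by auto
  note hE = lin_map_comp[OF E h(1)]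
  \<comment> \<open>The defect h e12 is a cocycle on the bottom: exchanging d and e12 turns h e12 d
    into f e12, which is zero by \<open>fe\<close>.\<close>
  have hEd: "h (?E i (d i y)) = \<zero>\<^bsub>A\<^esub>" if y: "y \<in> carrier (bot_part A (Q (Suc i)))" for y
    using fe[OF y] h(2)[OF lin_map_closed[OF E y]] dE[OF y] by simp
  \<comment> \<open>The correction m agrees with h on the image of the bottom and kills boundaries,
    so h - m kills that image and still bounds f.\<close>
  have "\<exists>m. lin_map A (top_part A (Q i)) ?A m \<and> (\<forall>y \<in> carrier (bot_part A (Q i)). m (?E i y) = h (?E i y))
    \<and> (\<forall>x \<in> carrier (top_part A (Q (Suc i))). m (d i x) = \<zero>\<^bsub>A\<^esub>)"
  proof (cases i)
    case 0
    have ker: "h (?E i y) = \<zero>\<^bsub>?A\<^esub>" if y: "y \<in> carrier (bot_part A (Q i))" "snd (\<epsilon> y) = \<zero>\<^bsub>Y\<^esub>" for y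
    proof -
      have "y \<in> d 0 ` carrier (bot_part A (Q (Suc 0)))"
        unfolding resolvesD(6)[OF resY] using y 0 by simp
      then show ?thesis using hEd 0 by auto
    qed
    \<comment> \<open>In degree 0 the defect kills the kernel of the augmentation, hence comes from
      a map on \<open>Y\<close>; \<open>ext\<close> carries it over to \<open>X\<close>, and the
      augmentation pulls it back to the top of the resolution.\<close>
    obtain l where l: "lin_map A Y ?A l" "\<forall>y \<in> carrier (bot_part A (Q i)). l (snd (\<epsilon> y)) = h (?E i y)"
    proof (rule lin_map_factor[OF bot Y A' _ _ hE ker])
      show "lin_map A (bot_part A (Q i)) Y (\<lambda>z. snd (\<epsilon> z))"
        "(\<lambda>z. snd (\<epsilon> z)) ` carrier (bot_part A (Q i)) = carrier Y"
        using resolvesD(4,5)[OF resY] 0 by simp_all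
    qed
    obtain l' where l': "lin_map A X ?A l'" "\<forall>y \<in> carrier Y. l y = l' (\<phi> y)"
      using ext[OF l(1)] by blast
    have "l' (fst (\<epsilon> (?E i y))) = h (?E i y)" if y: "y \<in> carrier (bot_part A (Q i))" for y
    proof -
      have y': "y \<in> carrier (Q 0)" using y 0 by simp
      have ey: "\<epsilon> y \<in> carrier (T2_module X Y \<phi>)" by (rule lin_map_closed[OF eps y'])
      have "\<epsilon> (?E i y) = e12 A \<odot>\<^bsub>T2_module X Y \<phi>\<^esub> \<epsilon> y"
        using lin_map_smult[OF eps e12_closed[OF A] y'] 0 by simp
      then have "fst (\<epsilon> (?E i y)) = \<phi> (snd (\<epsilon> y))"
        using ey lin_map_closed[OF \<phi>]
        by (cases "\<epsilon> y") (simp add: e12_def[OF A] X.zero_smult X.smult_one)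
      then show ?thesis using l(2) l'(2) y ey by (cases "\<epsilon> y") force
    qed
    moreover have "l' (fst (\<epsilon> (d i x))) = \<zero>\<^bsub>A\<^esub>" if "x \<in> carrier (top_part A (Q (Suc i)))" for x
      using that resolves_exact(1)[OF resX, of x] lin_map_zero[OF X' A' l'(1)] 0 by simp
    moreover have "lin_map A (top_part A (Q i)) ?A (\<lambda>x. l' (fst (\<epsilon> x)))"
      using lin_map_comp[OF resolvesD(4)[OF resX] l'(1)] 0 by simp
    ultimately show ?thesis by (intro exI[of _ "\<lambda>x. l' (fst (\<epsilon> x))"]) blast
  next
    case (Suc j)
    have "h (?E (Suc j) (d (Suc j) y)) = \<zero>\<^bsub>?A\<^esub>" if "y \<in> carrier (bot_part A (Q (Suc (Suc j))))" for y
      using hEd that Suc by simp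
    then obtain l where l: "lin_map A (bot_part A (Q j)) ?A l"
      "\<And>y. y \<in> carrier (bot_part A (Q (Suc j))) \<Longrightarrow> h (?E (Suc j) y) = l (d j y)"
      using coacyclicE[OF semi_Gorenstein_projective_coacyclic[OF sGp resY, of j], of "\<lambda>y. h (?E (Suc j) y)"]
        hE Suc by blast
    \<comment> \<open>Above degree 0 the defect is l d with l on the bottom one degree lower; \<rho>
      prolongs l to the top there, and composing with d makes the result kill boundaries.\<close>
    obtain \<rho> where \<rho>: "lin_map A (top_part A (Q j)) (bot_part A (Q j)) \<rho>"
      "\<forall>y \<in> carrier (bot_part A (Q j)). \<rho> (?E j y) = y"
      using in_add_parts(3)[OF A resolvesD(1)[OF res]] by blast
    have "l (\<rho> (d j (?E i y))) = h (?E i y)" if y: "y \<in> carrier (bot_part A (Q i))" for y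
    proof -
      have y': "y \<in> carrier (bot_part A (Q (Suc j)))" using y Suc by simp
      have "\<rho> (d j (?E (Suc j) y)) = d j y"
        unfolding dE[OF y'] using \<rho>(2) lin_map_closed[OF dY y'] by blast
      then show ?thesis using l(2)[OF y'] Suc by simp
    qed
    moreover have "l (\<rho> (d j (d i x))) = \<zero>\<^bsub>A\<^esub>" if "x \<in> carrier (top_part A (Q (Suc i)))" for x
      using that resolves_exact(2)[OF resX, of x j] lin_map_zero[OF top bot \<rho>(1)]
        lin_map_zero[OF bot A' l(1)] Suc by simp
    moreover have "lin_map A (top_part A (Q i)) ?A (\<lambda>x. l (\<rho> (d j x)))"
      using lin_map_comp[OF dX lin_map_comp[OF \<rho>(1) l(1)]] Suc by simp
    ultimately show ?thesis by (intro exI[of _ "\<lambda>x. l (\<rho> (d j x))"]) blast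
  qed
  then obtain m where m: "lin_map A (top_part A (Q i)) ?A m"
    "\<And>y. y \<in> carrier (bot_part A (Q i)) \<Longrightarrow> m (?E i y) = h (?E i y)"
    "\<And>x. x \<in> carrier (top_part A (Q (Suc i))) \<Longrightarrow> m (d i x) = \<zero>\<^bsub>A\<^esub>"
    by blast
  have cl: "h x \<in> carrier A" if "x \<in> carrier (top_part A (Q i))" for x
    using lin_map_closed[OF h(1) that] by simp
  show ?thesis
  proof (intro exI conjI)
    show "lin_map A (top_part A (Q i)) ?A (\<lambda>x. h x \<ominus>\<^bsub>?A\<^esub> m x)"
      by (rule lin_map_diff[OF A' h(1) m(1)])
    have minus: "a \<ominus>\<^bsub>?A\<^esub> b = a \<ominus>\<^bsub>A\<^esub> b" for a b
      by (simp add: a_minus_def a_inv_def m_inv_def regular_module_def)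
    show "\<forall>x \<in> carrier (top_part A (Q (Suc i))). f x = h (d i x) \<ominus>\<^bsub>?A\<^esub> m (d i x)"
      using h(2) m(3) cl[OF lin_map_closed[OF dX]] by (simp add: minus A.diff_zero del: corner_module_simps)
    show "\<forall>y \<in> carrier (bot_part A (Q i)). h (?E i y) \<ominus>\<^bsub>?A\<^esub> m (?E i y) = \<zero>\<^bsub>A\<^esub>"
      using m(2) cl[OF lin_map_closed[OF E]] by (simp add: minus del: corner_module_simps)
  qed
qed

text \<open>A map F to \<open>T2 A\<close> amounts to its upper row on the top part, two maps to
  \<open>A\<close>, because the lower entry of F x is the middle entry of F (e12 x). The
  second-column map is bounded by projectivity of \<open>X\<close>, the first-column map by
  \<open>first_column_coboundary\<close>.\<close>

lemma semi_Gorenstein_projective_T2_module: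
  fixes A :: "'a ring"
  assumes sGp: "semi_Gorenstein_projective A Y" and X: "in_add A X" and \<phi>: "lin_map A Y X \<phi>"
    and ext: "\<And>l. lin_map A Y (regular_module A) l \<Longrightarrow>
      \<exists>l'. lin_map A X (regular_module A) l' \<and> (\<forall>y \<in> carrier Y. l y = l' (\<phi> y))"
  shows "semi_Gorenstein_projective (T2 A) (T2_module X Y \<phi>)"
  unfolding semi_Gorenstein_projective_iff
proof (intro conjI allI impI)
  let ?A = "regular_module A" and ?B = "regular_module (T2 A)"
  note X' = in_add_left_module[OF X]
  note A = left_module_ring[OF X']
  have Y: "left_module A Y" and resY: "resolvable A Y"
    using sGp by (simp_all add: semi_Gorenstein_projective_iff)
  show "left_module (T2 A) (T2_module X Y \<phi>)" by (rule left_module_T2_module[OF X' Y \<phi>])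
  show "resolvable (T2 A) (T2_module X Y \<phi>)" by (rule resolvable_T2_module[OF X Y resY \<phi>])
  fix Q :: "nat \<Rightarrow> ('a \<times> 'a \<times> 'a, nat \<Rightarrow> 'a \<times> 'a \<times> 'a) module" and d \<epsilon> i
  assume res: "resolves (T2 A) (T2_module X Y \<phi>) Q d \<epsilon>"
  interpret A: ring A by (rule A)
  interpret top: corner A "T2 A" "upper_corner A" by (rule upper_corner[OF A])
  interpret bot: corner A "T2 A" "lower_corner A" by (rule lower_corner[OF A])
  note A' = left_module_regular[OF A]
  note d = resolvesD(3)[OF res]
  note resX = resolves_T2_parts(1)[OF X' Y \<phi> res]
  note dX = resolvesD(3)[OF resX]
  interpret Qi: left_module "T2 A" "Q i" by (rule resolvesD(2)[OF res])
  let ?E11 = "upper_corner A \<one>\<^bsub>A\<^esub>" and ?E22 = "lower_corner A \<one>\<^bsub>A\<^esub>" and ?E12 = "e12 A"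
  have E11: "?E11 \<in> carrier (T2 A)" by (rule top.\<iota>_closed[OF A.one_closed])
  have E22: "?E22 \<in> carrier (T2 A)" by (rule bot.\<iota>_closed[OF A.one_closed])
  note E12 = e12_closed[OF A]
  show "coacyclic (T2 A) Q d ?B i"
    unfolding coacyclic_def
  proof (intro allI impI, elim conjE)
    fix F assume F: "lin_map (T2 A) (Q (Suc i)) ?B F"
      and Fd: "\<forall>x \<in> carrier (Q (Suc (Suc i))). F (d (Suc i) x) = \<zero>\<^bsub>?B\<^esub>"
    have F_mem: "fst (F x) \<in> carrier A" "fst (snd (F x)) \<in> carrier A" "snd (snd (F x)) \<in> carrier A"
      if "x \<in> carrier (Q (Suc i))" for x
      using lin_map_closed[OF F that] by (auto simp: mem_Times_iff)
    have F_add: "F (x \<oplus>\<^bsub>Q (Suc i)\<^esub> y) = F x \<oplus>\<^bsub>T2 A\<^esub> F y"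
      if "x \<in> carrier (Q (Suc i))" "y \<in> carrier (Q (Suc i))" for x y
      using lin_map_add[OF F that] by simp
    have F_smult: "F (a \<odot>\<^bsub>Q (Suc i)\<^esub> x) = a \<otimes>\<^bsub>T2 A\<^esub> F x"
      if "a \<in> carrier (T2 A)" "x \<in> carrier (Q (Suc i))" for a x
      using lin_map_smult[OF F that] by simp
    have F_upper: "fst (F (upper_corner A a \<odot>\<^bsub>Q (Suc i)\<^esub> x)) = a \<otimes>\<^bsub>A\<^esub> fst (F x)"
      "fst (snd (F (upper_corner A a \<odot>\<^bsub>Q (Suc i)\<^esub> x))) = a \<otimes>\<^bsub>A\<^esub> fst (snd (F x))"
      if a: "a \<in> carrier A" and x: "x \<in> carrier (Q (Suc i))" for a x
      unfolding F_smult[OF top.\<iota>_closed[OF a] x]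
      using F_mem[OF x] a by (simp_all add: T2_mult upper_corner_def)
    have f1: "lin_map A (top_part A (Q (Suc i))) ?A (\<lambda>x. fst (F x))"
      by (rule lin_mapI)
        (auto simp: F_mem F_add T2_add F_upper simp del: T2_simps)
    have f2: "lin_map A (top_part A (Q (Suc i))) ?A (\<lambda>x. fst (snd (F x)))"
      by (rule lin_mapI)
        (auto simp: F_mem F_add T2_add F_upper simp del: T2_simps)
    \<comment> \<open>The first column of \<open>T2 A\<close> has zero bottom, so \<open>e12\<close>
      annihilates this coordinate.\<close>
    have f1e: "fst (F (?E12 \<odot>\<^bsub>Q (Suc i)\<^esub> y)) = \<zero>\<^bsub>A\<^esub>" if "y \<in> carrier (bot_part A (Q (Suc i)))" for y
    proof -
      have y: "y \<in> carrier (Q (Suc i))" using that by simp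
      show ?thesis
        unfolding F_smult[OF E12 y] using F_mem[OF y] by (simp add: T2_mult e12_def[OF A])
    qed
    have f1d: "fst (F (d (Suc i) x)) = \<zero>\<^bsub>A\<^esub>" if "x \<in> carrier (top_part A (Q (Suc (Suc i))))" for x
      using that Fd by simp
    have "\<exists>g1. lin_map A (top_part A (Q i)) ?A g1 \<and>
      (\<forall>x \<in> carrier (top_part A (Q (Suc i))). fst (F x) = g1 (d i x)) \<and>
      (\<forall>y \<in> carrier (bot_part A (Q i)). g1 (?E12 \<odot>\<^bsub>Q i\<^esub> y) = \<zero>\<^bsub>A\<^esub>)"
      by (rule first_column_coboundary[OF sGp X \<phi> _ res f1], erule ext, erule f1d, erule f1e)
    then obtain g1 where g1: "lin_map A (top_part A (Q i)) ?A g1"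
      and g1d: "\<forall>x \<in> carrier (top_part A (Q (Suc i))). fst (F x) = g1 (d i x)"
      and g1e: "\<forall>y \<in> carrier (bot_part A (Q i)). g1 (?E12 \<odot>\<^bsub>Q i\<^esub> y) = \<zero>\<^bsub>A\<^esub>"
      by blast
    have f2d: "fst (snd (F (d (Suc i) x))) = \<zero>\<^bsub>?A\<^esub>"
      if "x \<in> carrier (top_part A (Q (Suc (Suc i))))" for x
      using that Fd by simp
    obtain g2 where g2: "lin_map A (top_part A (Q i)) ?A g2"
      "\<And>x. x \<in> carrier (top_part A (Q (Suc i))) \<Longrightarrow> fst (snd (F x)) = g2 (d i x)"
      using coacyclicE[OF projective_coacyclic[OF resX X A', of i] f2] f2d by blast
    have E11_top: "?E11 \<odot>\<^bsub>M\<^esub> x \<in> carrier (top_part A M)"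
      if "left_module (T2 A) M" "x \<in> carrier M" for M :: "('a \<times> 'a \<times> 'a, nat \<Rightarrow> 'a \<times> 'a \<times> 'a) module" and x
      using top.smult_in_part[OF that(1) A.one_closed that(2)] .
    \<comment> \<open>\<open>e12\<close> factors through the projection to the bottom, so facts
      about bottom elements apply to arbitrary x.\<close>
    have E12_bot: "?E12 \<odot>\<^bsub>M\<^esub> x = ?E12 \<odot>\<^bsub>M\<^esub> (?E22 \<odot>\<^bsub>M\<^esub> x)" "?E22 \<odot>\<^bsub>M\<^esub> x \<in> carrier (bot_part A M)"
      if M: "left_module (T2 A) M" and x: "x \<in> carrier M"
      for M :: "('a \<times> 'a \<times> 'a, nat \<Rightarrow> 'a \<times> 'a \<times> 'a) module" and x
    proof -
      interpret M: left_module "T2 A" M by (rule M)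
      have "?E12 \<otimes>\<^bsub>T2 A\<^esub> ?E22 = ?E12"
        by (simp add: T2_mult e12_def[OF A] lower_corner_def)
      then show "?E12 \<odot>\<^bsub>M\<^esub> x = ?E12 \<odot>\<^bsub>M\<^esub> (?E22 \<odot>\<^bsub>M\<^esub> x)"
        using M.smult_assoc[OF E12 E22 x] by simp
      show "?E22 \<odot>\<^bsub>M\<^esub> x \<in> carrier (bot_part A M)"
        by (rule bot.smult_in_part[OF M A.one_closed x])
    qed
    have E12_top: "?E12 \<odot>\<^bsub>M\<^esub> x \<in> carrier (top_part A M)"
      if "left_module (T2 A) M" "x \<in> carrier M" for M :: "('a \<times> 'a \<times> 'a, nat \<Rightarrow> 'a \<times> 'a \<times> 'a) module" and x
      unfolding E12_bot(1)[OF that] by (rule e12_smult_closed[OF A that(1) E12_bot(2)[OF that]])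
    note Qi' = resolvesD(2)[OF res]
    \<comment> \<open>g1 and g2 give the upper row, and the lower entry is read off as the middle
      entry at e12 x. Compatibility with the off-diagonal scalar a2 needs g1 to vanish on the image
      of \<open>e12\<close>.\<close>
    define G where "G x = (g1 (?E11 \<odot>\<^bsub>Q i\<^esub> x), g2 (?E11 \<odot>\<^bsub>Q i\<^esub> x), g2 (?E12 \<odot>\<^bsub>Q i\<^esub> x))" for x
    have G: "lin_map (T2 A) (Q i) ?B G"
    proof (rule lin_mapI)
      fix x assume x: "x \<in> carrier (Q i)"
      show "G x \<in> carrier ?B"
        using lin_map_closed[OF g1 E11_top[OF Qi' x]] lin_map_closed[OF g2(1) E11_top[OF Qi' x]]
          lin_map_closed[OF g2(1) E12_top[OF Qi' x]] by (simp add: G_def)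
    next
      fix x y assume xy: "x \<in> carrier (Q i)" "y \<in> carrier (Q i)"
      show "G (x \<oplus>\<^bsub>Q i\<^esub> y) = G x \<oplus>\<^bsub>?B\<^esub> G y"
        using lin_map_add[OF g1 E11_top[OF Qi' xy(1)] E11_top[OF Qi' xy(2)]]
          lin_map_add[OF g2(1) E11_top[OF Qi' xy(1)] E11_top[OF Qi' xy(2)]]
          lin_map_add[OF g2(1) E12_top[OF Qi' xy(1)] E12_top[OF Qi' xy(2)]]
          Qi.smult_r_distr[OF E11 xy] Qi.smult_r_distr[OF E12 xy]
        by (simp add: G_def)
    next
      fix a x assume a: "a \<in> carrier (T2 A)" and x: "x \<in> carrier (Q i)"
      obtain a1 a2 a3 where aa: "a = (a1, a2, a3)" by (cases a)
      have mem: "a1 \<in> carrier A" "a2 \<in> carrier A" "a3 \<in> carrier A" using a aa by auto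
      let ?x1 = "?E11 \<odot>\<^bsub>Q i\<^esub> x" and ?x2 = "?E12 \<odot>\<^bsub>Q i\<^esub> x"
      note x1 = E11_top[OF Qi' x] and x2 = E12_top[OF Qi' x]
      note ax = top.smult_in_part[OF Qi']
      have x12: "?x1 \<in> carrier (Q i)" "?x2 \<in> carrier (Q i)" using x1 x2 by simp_all
      have "?E11 \<odot>\<^bsub>Q i\<^esub> (a \<odot>\<^bsub>Q i\<^esub> x) = (?E11 \<otimes>\<^bsub>T2 A\<^esub> a) \<odot>\<^bsub>Q i\<^esub> x"
        by (rule Qi.smult_assoc[OF E11 a x, symmetric])
      \<comment> \<open>e11 a = a1 e11 + a2 e12, and below e12 a = a3 e12: the action of a matrix
        becomes that of scalars from \<open>A\<close> on the two top elements \<open>?x1\<close> and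
        \<open>?x2\<close>.\<close>
      also have "?E11 \<otimes>\<^bsub>T2 A\<^esub> a = (upper_corner A a1 \<otimes>\<^bsub>T2 A\<^esub> ?E11) \<oplus>\<^bsub>T2 A\<^esub> (upper_corner A a2 \<otimes>\<^bsub>T2 A\<^esub> ?E12)"
        using mem by (simp add: aa T2_mult T2_add upper_corner_def e12_def[OF A])
      also have "\<dots> \<odot>\<^bsub>Q i\<^esub> x = upper_corner A a1 \<odot>\<^bsub>Q i\<^esub> ?x1 \<oplus>\<^bsub>Q i\<^esub> upper_corner A a2 \<odot>\<^bsub>Q i\<^esub> ?x2"
        using x E11 E12 top.\<iota>_closed[OF mem(1)] top.\<iota>_closed[OF mem(2)] top.m_closed
        by (simp add: Qi.smult_l_distr Qi.smult_assoc del: T2_simps)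
      finally have e1: "?E11 \<odot>\<^bsub>Q i\<^esub> (a \<odot>\<^bsub>Q i\<^esub> x)
          = upper_corner A a1 \<odot>\<^bsub>Q i\<^esub> ?x1 \<oplus>\<^bsub>Q i\<^esub> upper_corner A a2 \<odot>\<^bsub>Q i\<^esub> ?x2" .
      have "?E12 \<odot>\<^bsub>Q i\<^esub> (a \<odot>\<^bsub>Q i\<^esub> x) = (?E12 \<otimes>\<^bsub>T2 A\<^esub> a) \<odot>\<^bsub>Q i\<^esub> x"
        by (rule Qi.smult_assoc[OF E12 a x, symmetric])
      also have "?E12 \<otimes>\<^bsub>T2 A\<^esub> a = upper_corner A a3 \<otimes>\<^bsub>T2 A\<^esub> ?E12"
        using mem by (simp add: aa T2_mult upper_corner_def e12_def[OF A])
      also have "\<dots> \<odot>\<^bsub>Q i\<^esub> x = upper_corner A a3 \<odot>\<^bsub>Q i\<^esub> ?x2"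
        using Qi.smult_assoc[OF top.\<iota>_closed[OF mem(3)] E12 x] .
      finally have e2: "?E12 \<odot>\<^bsub>Q i\<^esub> (a \<odot>\<^bsub>Q i\<^esub> x) = upper_corner A a3 \<odot>\<^bsub>Q i\<^esub> ?x2" .
      have lin: "g (upper_corner A b \<odot>\<^bsub>Q i\<^esub> z) = b \<otimes>\<^bsub>A\<^esub> g z"
        if "lin_map A (top_part A (Q i)) ?A g" "b \<in> carrier A" "z \<in> carrier (top_part A (Q i))" for g b z
        using lin_map_smult[OF that] by simp
      have lin_add: "g (z \<oplus>\<^bsub>Q i\<^esub> z') = g z \<oplus>\<^bsub>A\<^esub> g z'"
        if "lin_map A (top_part A (Q i)) ?A g" "z \<in> carrier (top_part A (Q i))"
          "z' \<in> carrier (top_part A (Q i))" for g z z'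
        using lin_map_add[OF that] by simp
      have g1x2: "g1 ?x2 = \<zero>\<^bsub>A\<^esub>"
        unfolding E12_bot(1)[OF Qi' x] using g1e E12_bot(2)[OF Qi' x] by blast
      have cl: "g1 ?x1 \<in> carrier A" using lin_map_closed[OF g1 x1] by simp
      show "G (a \<odot>\<^bsub>Q i\<^esub> x) = a \<odot>\<^bsub>?B\<^esub> G x"
        unfolding G_def e1 e2
          lin_add[OF g1 ax[OF mem(1) x12(1)] ax[OF mem(2) x12(2)]]
          lin_add[OF g2(1) ax[OF mem(1) x12(1)] ax[OF mem(2) x12(2)]]
          lin[OF g1 mem(1) x1] lin[OF g1 mem(2) x2] lin[OF g2(1) mem(1) x1]
          lin[OF g2(1) mem(2) x2] lin[OF g2(1) mem(3) x2] g1x2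
        using mem cl by (simp add: aa)
    qed
    have "F x = G (d i x)" if x: "x \<in> carrier (Q (Suc i))" for x
    proof -
      note x1 = E11_top[OF Qi' x] and x2 = E12_top[OF Qi' x]
      have e: "?E11 \<odot>\<^bsub>Q i\<^esub> d i x = d i (?E11 \<odot>\<^bsub>Q (Suc i)\<^esub> x)"
        "?E12 \<odot>\<^bsub>Q i\<^esub> d i x = d i (?E12 \<odot>\<^bsub>Q (Suc i)\<^esub> x)"
        using lin_map_smult[OF d E11 x] lin_map_smult[OF d E12 x] by simp_all
      have "G (d i x) = (fst (F (?E11 \<odot>\<^bsub>Q (Suc i)\<^esub> x)), fst (snd (F (?E11 \<odot>\<^bsub>Q (Suc i)\<^esub> x))),
          fst (snd (F (?E12 \<odot>\<^bsub>Q (Suc i)\<^esub> x))))"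
        unfolding G_def e using g1d g2(2)[OF x1] g2(2)[OF x2] x1 by simp
      also have "\<dots> = F x"
        unfolding F_smult[OF E11 x] F_smult[OF E12 x]
        using F_mem[OF x] by (simp add: T2_mult upper_corner_def e12_def[OF A])
      finally show ?thesis by simp
    qed
    then show "\<exists>G. lin_map (T2 A) (Q i) ?B G \<and> (\<forall>x\<in>carrier (Q (Suc i)). F x = G (d i x))"
      using G by blast
  qed
qed

section \<open>Change of rings along isomorphisms\<close>

lemma lin_map_inverse:
  assumes h: "lin_map R M N h" and M: "left_module R M"
    and k: "\<And>y. y \<in> carrier N \<Longrightarrow> k y \<in> carrier M"
    and hk: "\<And>y. y \<in> carrier N \<Longrightarrow> h (k y) = y" and kh: "\<And>x. x \<in> carrier M \<Longrightarrow> k (h x) = x"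
  shows "lin_map R N M k"
proof -
  interpret M: left_module R M by (rule M)
  show ?thesis
  proof (rule lin_mapI)
    fix y y' assume y: "y \<in> carrier N" "y' \<in> carrier N"
    have "k (h (k y \<oplus>\<^bsub>M\<^esub> k y')) = k y \<oplus>\<^bsub>M\<^esub> k y'" using y k by (intro kh) simp
    then show "k (y \<oplus>\<^bsub>N\<^esub> y') = k y \<oplus>\<^bsub>M\<^esub> k y'" using y k hk by (simp add: lin_map_add[OF h])
  next
    fix r y assume y: "r \<in> carrier R" "y \<in> carrier N"
    have "k (h (r \<odot>\<^bsub>M\<^esub> k y)) = r \<odot>\<^bsub>M\<^esub> k y" using y k by (intro kh M.smult_closed)
    then show "k (r \<odot>\<^bsub>N\<^esub> y) = r \<odot>\<^bsub>M\<^esub> k y" using y k hk by (simp add: lin_map_smult[OF h])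
  qed (rule k)
qed

lemma resolves_lin_iso:
  assumes res: "resolves R N P d \<epsilon>" and N: "left_module R N" and N': "left_module R N'"
    and h: "lin_map R N N' h" and k: "lin_map R N' N k"
    and hk: "\<And>y. y \<in> carrier N' \<Longrightarrow> h (k y) = y" and kh: "\<And>x. x \<in> carrier N \<Longrightarrow> k (h x) = x"
  shows "resolves R N' P d (\<lambda>x. h (\<epsilon> x))"
proof (rule resolves_iso[OF res N N' h])
  show "h ` carrier N = carrier N'"
  proof (intro subset_antisym subsetI)
    fix y assume "y \<in> carrier N'"
    then show "y \<in> h ` carrier N"
      using lin_map_closed[OF k] hk by (intro image_eqI[of _ _ "k y"]) simp_all
  qed (use lin_map_closed[OF h] in auto)
  show "x = \<zero>\<^bsub>N\<^esub>" if "x \<in> carrier N" "h x = \<zero>\<^bsub>N'\<^esub>" for x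
    using kh[OF that(1)] that(2) lin_map_zero[OF N' N k] by simp
qed

lemma semi_Gorenstein_projective_lin_iso:
  assumes sGp: "semi_Gorenstein_projective R N" and N': "left_module R N'"
    and h: "lin_map R N N' h" and k: "lin_map R N' N k"
    and hk: "\<And>y. y \<in> carrier N' \<Longrightarrow> h (k y) = y" and kh: "\<And>x. x \<in> carrier N \<Longrightarrow> k (h x) = x"
  shows "semi_Gorenstein_projective R N'"
proof -
  have N: "left_module R N" using sGp by (simp add: semi_Gorenstein_projective_iff)
  note to = resolves_lin_iso[OF _ N N' h k hk kh] and fro = resolves_lin_iso[OF _ N' N k h kh hk]
  show ?thesis
    using sGp N' to fro unfolding semi_Gorenstein_projective_iff resolvable_def by blast
qed

text \<open>A ring isomorphism, written as mutually inverse corners so that everything proved for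
  corners applies in both directions. As the identities correspond, a part is the whole module with
  its scalars renamed.\<close>

locale corner_iso = fwd: corner S B \<sigma> + bwd: corner B S \<tau>
  for S :: "'s ring" and B :: "'b ring" and \<sigma> :: "'s \<Rightarrow> 'b" and \<tau> :: "'b \<Rightarrow> 's" +
  assumes \<sigma>\<tau>: "b \<in> carrier B \<Longrightarrow> \<sigma> (\<tau> b) = b" and \<tau>\<sigma>: "s \<in> carrier S \<Longrightarrow> \<tau> (\<sigma> s) = s"
    and \<sigma>_one: "\<sigma> \<one>\<^bsub>S\<^esub> = \<one>\<^bsub>B\<^esub>"

lemma corner_iso_sym:
  assumes "corner_iso S B \<sigma> \<tau>"
  shows "corner_iso B S \<tau> \<sigma>"
proof -
  interpret corner_iso S B \<sigma> \<tau> by fact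
  have "\<tau> \<one>\<^bsub>B\<^esub> = \<one>\<^bsub>S\<^esub>" using \<tau>\<sigma>[OF fwd.A.one_closed] by (simp only: \<sigma>_one)
  then show ?thesis
    by (intro corner_iso.intro corner_iso_axioms.intro fwd.corner_axioms bwd.corner_axioms \<sigma>\<tau> \<tau>\<sigma>)
qed

context corner_iso
begin

lemma carrier_part:
  assumes "left_module B M"
  shows "carrier (fwd.part M) = carrier M"
proof -
  interpret M: left_module B M by fact
  show ?thesis by (auto simp: \<sigma>_one M.smult_one)
qed

lemma lin_map_part_free:
  "lin_map S (fwd.part (free_module B n)) (free_module S n) (\<lambda>v. \<lambda>i\<in>{..<n}. \<tau> (v i))"
  "lin_map S (free_module S n) (fwd.part (free_module B n)) (\<lambda>v. \<lambda>i\<in>{..<n}. \<sigma> (v i))"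
proof -
  note F = left_module_free[OF fwd.B.ring_axioms, of n]
  have mem: "v i \<in> carrier B" if "v \<in> carrier (fwd.part (free_module B n))" "i < n" for v i
    using that unfolding carrier_part[OF F] by auto
  show 1: "lin_map S (fwd.part (free_module B n)) (free_module S n) (\<lambda>v. \<lambda>i\<in>{..<n}. \<tau> (v i))"
  proof (rule lin_mapI)
    fix v assume "v \<in> carrier (fwd.part (free_module B n))"
    then show "(\<lambda>i\<in>{..<n}. \<tau> (v i)) \<in> carrier (free_module S n)"
      using mem bwd.\<iota>_closed by simp
  next
    fix v w assume "v \<in> carrier (fwd.part (free_module B n))"
      "w \<in> carrier (fwd.part (free_module B n))"
    then show "(\<lambda>i\<in>{..<n}. \<tau> ((v \<oplus>\<^bsub>fwd.part (free_module B n)\<^esub> w) i))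
        = (\<lambda>i\<in>{..<n}. \<tau> (v i)) \<oplus>\<^bsub>free_module S n\<^esub> (\<lambda>i\<in>{..<n}. \<tau> (w i))"
      using mem[of v] mem[of w] by (simp add: bwd.\<iota>_add restrict_def fun_eq_iff)
  next
    fix s v assume "s \<in> carrier S" "v \<in> carrier (fwd.part (free_module B n))"
    then show "(\<lambda>i\<in>{..<n}. \<tau> ((s \<odot>\<^bsub>fwd.part (free_module B n)\<^esub> v) i))
        = s \<odot>\<^bsub>free_module S n\<^esub> (\<lambda>i\<in>{..<n}. \<tau> (v i))"
      using mem[of v] by (simp add: bwd.\<iota>_mult fwd.\<iota>_closed \<tau>\<sigma> restrict_def fun_eq_iff)
  qed
  show "lin_map S (free_module S n) (fwd.part (free_module B n)) (\<lambda>v. \<lambda>i\<in>{..<n}. \<sigma> (v i))"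
  proof (rule lin_map_inverse[OF 1 fwd.left_module_part[OF F]])
    show "(\<lambda>i\<in>{..<n}. \<sigma> (v i)) \<in> carrier (fwd.part (free_module B n))"
      if "v \<in> carrier (free_module S n)" for v
      using that fwd.\<iota>_closed unfolding carrier_part[OF F] by auto
    show "(\<lambda>i\<in>{..<n}. \<tau> ((\<lambda>i\<in>{..<n}. \<sigma> (v i)) i)) = v" if "v \<in> carrier (free_module S n)" for v
      using that by (intro extensionalityI[where A = "{..<n}"]) (auto simp: \<tau>\<sigma> PiE_iff)
    show "(\<lambda>i\<in>{..<n}. \<sigma> ((\<lambda>i\<in>{..<n}. \<tau> (v i)) i)) = v"
      if "v \<in> carrier (fwd.part (free_module B n))" for v
      using that unfolding carrier_part[OF F]
      by (intro extensionalityI[where A = "{..<n}"]) (auto simp: \<sigma>\<tau> PiE_iff)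
  qed
qed

text \<open>For an isomorphism the projectivity assumption of \<open>resolves_part\<close> is
  automatic, as free modules go to free modules coordinatewise.\<close>

lemma in_add_part:
  assumes P: "in_add B P"
  shows "in_add S (fwd.part P)"
proof -
  note F = left_module_free[OF fwd.B.ring_axioms]
  note P' = in_add_left_module[OF P]
  obtain n s r where s: "lin_map B P (free_module B n) s"
    and r: "lin_map B (free_module B n) P r" and rs: "\<forall>x \<in> carrier P. r (s x) = x"
    using P unfolding in_add_iff by blast
  show ?thesis
  proof (rule in_add_retract[OF in_add_free[OF fwd.A.ring_axioms] fwd.left_module_part[OF P']
        lin_map_comp[OF fwd.lin_map_part[OF s] lin_map_part_free(1)]
        lin_map_comp[OF lin_map_part_free(2) fwd.lin_map_part[OF r]]])
    fix x assume "x \<in> carrier (fwd.part P)"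
    then have x: "x \<in> carrier P" by simp
    have "(\<lambda>i\<in>{..<n}. \<sigma> ((\<lambda>i\<in>{..<n}. \<tau> (s x i)) i)) = s x"
      using lin_map_closed[OF s x]
      by (intro extensionalityI[where A = "{..<n}"]) (auto simp: \<sigma>\<tau> PiE_iff)
    then show "r (\<lambda>i\<in>{..<n}. \<sigma> ((\<lambda>i\<in>{..<n}. \<tau> (s x i)) i)) = x" using rs x by simp
  qed
qed

text \<open>Resolutions over either ring become resolutions over the other, and \<tau> and \<sigma>
  convert maps into the regular modules. The dual of a triple lives over the opposite of
  \<open>T2 A\<close>, while the criterion speaks of \<open>T2\<close> of the opposite ring.\<close>

lemma semi_Gorenstein_projective_part:
  assumes sGp: "semi_Gorenstein_projective S (fwd.part N)" and N: "left_module B N"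
  shows "semi_Gorenstein_projective B N"
  unfolding semi_Gorenstein_projective_iff
proof (intro conjI allI impI)
  show "left_module B N" by (rule N)
  interpret rev: corner_iso B S \<tau> \<sigma> by (rule corner_iso_sym) unfold_locales
  note N' = fwd.left_module_part[OF N]
  obtain P :: "nat \<Rightarrow> ('s, nat \<Rightarrow> 's) module" and d \<epsilon> where
    resP: "resolves S (fwd.part N) P d \<epsilon>"
    using sGp unfolding semi_Gorenstein_projective_iff resolvable_def by blast
  have "resolves B (bwd.part (fwd.part N)) (\<lambda>i. bwd.part (P i)) d \<epsilon>"
    by (rule bwd.resolves_part[OF resP N' rev.in_add_part[OF resolvesD(1)[OF resP]]])
  moreover have "left_module B (bwd.part (fwd.part N))"
    by (rule bwd.left_module_part[OF N'])
  moreover have carr: "carrier (bwd.part (fwd.part N)) = carrier N"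
    unfolding rev.carrier_part[OF N'] by (rule carrier_part[OF N])
  \<comment> \<open>Going there and back keeps the elements and turns a scalar b into \<sigma>
    (\<tau> b) = b; only the records differ.\<close>
  have "lin_map B (bwd.part (fwd.part N)) N (\<lambda>x. x)"
    "lin_map B N (bwd.part (fwd.part N)) (\<lambda>x. x)"
    unfolding lin_map_def carr by (simp_all add: \<sigma>\<tau>)
  ultimately have "resolves B N (\<lambda>i. bwd.part (P i)) d \<epsilon>"
    using resolves_lin_iso[where h = "\<lambda>x. x" and k = "\<lambda>x. x"] N by blast
  then show "resolvable B N" by (rule resolvable_if_resolves[OF _ N])
next
  fix P :: "nat \<Rightarrow> ('b, nat \<Rightarrow> 'b) module" and d \<epsilon> j
  assume res: "resolves B N P d \<epsilon>"
  have res': "resolves S (fwd.part N) (\<lambda>i. fwd.part (P i)) d \<epsilon>"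
    by (rule fwd.resolves_part[OF res N in_add_part[OF resolvesD(1)[OF res]]])
  note carr = carrier_part[OF resolvesD(2)[OF res]]
  show "coacyclic B P d (regular_module B) j"
    unfolding coacyclic_def
  proof (intro allI impI, elim conjE)
    fix f assume f: "lin_map B (P (Suc j)) (regular_module B) f"
      and fd: "\<forall>x\<in>carrier (P (Suc (Suc j))). f (d (Suc j) x) = \<zero>\<^bsub>regular_module B\<^esub>"
    have f_mem: "f x \<in> carrier B" if "x \<in> carrier (P (Suc j))" for x
      using lin_map_closed[OF f that] by simp
    have "lin_map S (fwd.part (P (Suc j))) (regular_module S) (\<lambda>x. \<tau> (f x))"
      using lin_map_add[OF f] lin_map_smult[OF f fwd.\<iota>_closed] f_mem
      by (intro lin_mapI) (auto simp: bwd.\<iota>_closed bwd.\<iota>_add bwd.\<iota>_mult fwd.\<iota>_closed \<tau>\<sigma>)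
    moreover have "\<tau> (f (d (Suc j) x)) = \<zero>\<^bsub>regular_module S\<^esub>"
      if "x \<in> carrier (fwd.part (P (Suc (Suc j))))" for x
      using that fd by (simp add: bwd.\<iota>_zero)
    ultimately obtain g where g: "lin_map S (fwd.part (P j)) (regular_module S) g"
      "\<And>x. x \<in> carrier (fwd.part (P (Suc j))) \<Longrightarrow> \<tau> (f x) = g (d j x)"
      using coacyclicE[OF semi_Gorenstein_projective_coacyclic[OF sGp res', of j]] by blast
    have g_mem: "g x \<in> carrier S" if "x \<in> carrier (P j)" for x
      using lin_map_closed[OF g(1), unfolded carr regular_module_simps, OF that] .
    have g_smult: "g (b \<odot>\<^bsub>P j\<^esub> x) = \<tau> b \<otimes>\<^bsub>S\<^esub> g x" if "b \<in> carrier B" "x \<in> carrier (P j)" for b x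
      using lin_map_smult[OF g(1) bwd.\<iota>_closed[OF that(1)], unfolded carr, OF that(2)] that
      by (simp add: \<sigma>\<tau>)
    have "lin_map B (P j) (regular_module B) (\<lambda>x. \<sigma> (g x))"
      using lin_map_add[OF g(1), unfolded carr corner_module_simps(3)] g_mem
      by (intro lin_mapI)
        (simp_all add: g_smult fwd.\<iota>_closed fwd.\<iota>_add fwd.\<iota>_mult bwd.\<iota>_closed \<sigma>\<tau>)
    moreover have "f x = \<sigma> (g (d j x))" if "x \<in> carrier (P (Suc j))" for x
      using \<sigma>\<tau>[OF f_mem[OF that]] unfolding g(2)[unfolded carr, OF that] by simp
    ultimately show "\<exists>g. lin_map B (P j) (regular_module B) g \<and> (\<forall>x\<in>carrier (P (Suc j)). f x = g (d j x))"
      by blast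
  qed
qed

end

section \<open>Duals\<close>

lemma opposite_ring_simps [simp]:
  "carrier (opposite_ring A) = carrier A" "zero (opposite_ring A) = \<zero>\<^bsub>A\<^esub>"
  "one (opposite_ring A) = \<one>\<^bsub>A\<^esub>" "add (opposite_ring A) = add A"
  "a \<otimes>\<^bsub>opposite_ring A\<^esub> b = b \<otimes>\<^bsub>A\<^esub> a"
  by (simp_all add: opposite_ring_def)

lemma ring_opposite:
  assumes "ring A"
  shows "ring (opposite_ring A)"
proof -
  interpret A: ring A by fact
  have "abelian_group (opposite_ring A)"
    by (rule abelian_groupI) (auto simp: A.a_ac intro: A.l_neg)
  moreover have "monoid (opposite_ring A)"
    by (rule monoidI) (auto simp: A.m_assoc)
  ultimately show ?thesis
    by (rule ringI) (auto simp: A.l_distr A.r_distr)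
qed

lemma dual_simps [simp]:
  "carrier (dual A N) = lin_maps A N (regular_module A)"
  "zero (dual A N) = (\<lambda>x\<in>carrier N. \<zero>\<^bsub>A\<^esub>)"
  "f \<oplus>\<^bsub>dual A N\<^esub> g = (\<lambda>x\<in>carrier N. f x \<oplus>\<^bsub>A\<^esub> g x)"
  "a \<odot>\<^bsub>dual A N\<^esub> f = (\<lambda>x\<in>carrier N. f x \<otimes>\<^bsub>A\<^esub> a)"
  by (simp_all add: dual_def)

lemma dual_closed: "f \<in> carrier (dual A N) \<Longrightarrow> x \<in> carrier N \<Longrightarrow> f x \<in> carrier A"
  by (auto simp: lin_maps_def)

lemma dualD:
  assumes "f \<in> carrier (dual A N)"
  shows "lin_map A N (regular_module A) f" "f \<in> extensional (carrier N)"
  using assms by (simp_all add: lin_maps_iff)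

lemma dual_eqI:
  assumes "f \<in> extensional (carrier N)" "g \<in> extensional (carrier N)"
    "\<And>x. x \<in> carrier N \<Longrightarrow> f x = g x"
  shows "f = g"
  using assms by (rule extensionalityI)

lemma lin_map_right_mult:
  assumes "ring A" "a \<in> carrier A"
  shows "lin_map A (regular_module A) (regular_module A) (\<lambda>x. x \<otimes>\<^bsub>A\<^esub> a)"
proof -
  interpret A: ring A by fact
  show ?thesis using assms(2) by (intro lin_mapI) (auto simp: A.l_distr A.m_assoc)
qed

lemma left_module_dual:
  assumes "left_module A N"
  shows "left_module (opposite_ring A) (dual A N)"
proof -
  note A = left_module_ring[OF assms]
  interpret A: ring A by (rule A)
  note A' = left_module_regular[OF A]
  note mem = dual_closed[of _ A N]
  show ?thesis
  proof (rule left_moduleI[OF ring_opposite[OF A]], goal_cases)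
    case (1 f g)
    then show ?case
      using restrict_lin_maps[OF assms lin_map_plus[OF A' dualD(1) dualD(1), of f N g]] by simp
  next
    case 2
    show ?case using restrict_lin_maps[OF assms lin_map_const_zero[OF A']] by simp
  next
    case (3 f g h)
    then show ?case using mem[of f] mem[of g] mem[of h] by (auto simp: A.a_assoc intro!: restrict_ext)
  next
    case (4 f g)
    then show ?case using mem[of f] mem[of g] by (auto simp: A.a_comm intro!: restrict_ext)
  next
    case (5 f)
    then show ?case using mem[of f] dualD(2)[of f] by (intro dual_eqI[of _ N]) auto
  next
    case (6 a f)
    then show ?case
      using restrict_lin_maps[OF assms lin_map_comp[OF dualD(1)[of f] lin_map_right_mult[OF A, of a]]]
      by simp
  next
    case (7 a b f)
    then show ?case using mem[of f] by (auto simp: A.r_distr intro!: restrict_ext)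
  next
    case (8 a f g)
    then show ?case using mem[of f] mem[of g] by (auto simp: A.l_distr intro!: restrict_ext)
  next
    case (9 a b f)
    then show ?case using mem[of f] by (auto simp: A.m_assoc intro!: restrict_ext)
  next
    case (10 f)
    then show ?case using mem[of f] dualD(2)[of f] by (intro dual_eqI[of _ N]) auto
  next
    case (11 f)
    then show ?case using mem[of f] by (auto intro!: restrict_ext)
  qed
qed

lemma lincomb_add_right:
  assumes "left_module R M" "\<And>i. i < n \<Longrightarrow> c i \<in> carrier R" "\<And>i. i < n \<Longrightarrow> g i \<in> carrier M"
    "\<And>i. i < n \<Longrightarrow> h i \<in> carrier M"
  shows "lincomb M c (\<lambda>i. g i \<oplus>\<^bsub>M\<^esub> h i) n = lincomb M c g n \<oplus>\<^bsub>M\<^esub> lincomb M c h n"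
  using assms(2-4)
proof (induction n)
  interpret M: left_module R M by fact
  case 0
  then show ?case by simp
next
  interpret M: left_module R M by fact
  case (Suc n)
  have "lincomb M c g n \<in> carrier M" "lincomb M c h n \<in> carrier M"
    using Suc.prems by (auto intro!: lincomb_closed[OF assms(1)])
  then show ?case
    using Suc by (simp add: M.smult_r_distr M.smult_closed M.M.a_ac)
qed

text \<open>Dual basis: f is recovered from its values on the generators r (e_i) as x |-> sum of
  s(x)_i f(r (e_i)), so evaluation at the generators is split by \<open>T\<close>.\<close>

lemma in_add_dual:
  fixes A :: "'a ring"
  assumes P: "in_add A P"
  shows "in_add (opposite_ring A) (dual A P)"
proof -
  note P' = in_add_left_module[OF P]
  note A = left_module_ring[OF P']
  interpret A: ring A by (rule A)
  note A' = left_module_regular[OF A] and F = left_module_free[OF A]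
  let ?F = "free_module (opposite_ring A)" and ?A = "regular_module A"
  obtain n s r where s: "lin_map A P (free_module A n) s"
    and r: "lin_map A (free_module A n) P r" and rs: "\<forall>x \<in> carrier P. r (s x) = x"
    using P unfolding in_add_iff by blast
  have re: "r (unit_vector A n i) \<in> carrier P" for i
    by (rule lin_map_closed[OF r unit_vector_closed[OF A]])
  have s_mem: "s x i \<in> carrier A" if "x \<in> carrier P" "i < n" for x i
    using lin_map_closed[OF s that(1)] that(2) by auto
  define S where "S = (\<lambda>f. \<lambda>i\<in>{..<n}. f (r (unit_vector A n i)) :: 'a)"
  define T where "T = (\<lambda>v. \<lambda>x\<in>carrier P. lincomb ?A (s x) v n)"
  have S: "lin_map (opposite_ring A) (dual A P) (?F n) S"
    using re dual_closed[of _ A P] by (intro lin_mapI) (auto simp: S_def restrict_def fun_eq_iff split: if_splits)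
  have T_closed: "lincomb ?A (s x) v n \<in> carrier A" if "x \<in> carrier P" "v \<in> carrier (?F n)" for x v
    using lincomb_closed[OF A', of n "s x" v] that s_mem by auto
  have T: "lin_map (opposite_ring A) (?F n) (dual A P) T"
  proof (rule lin_mapI)
    fix v assume "v \<in> carrier (?F n)"
    then show "T v \<in> carrier (dual A P)"
      unfolding T_def dual_simps
      by (intro restrict_lin_maps[OF P'] lin_map_comp[OF s] lin_map_from_free[OF A']) auto
  next
    fix v w assume vw: "v \<in> carrier (?F n)" "w \<in> carrier (?F n)"
    have "lincomb ?A (s x) (v \<oplus>\<^bsub>?F n\<^esub> w) n = lincomb ?A (s x) v n \<oplus>\<^bsub>A\<^esub> lincomb ?A (s x) w n"
      if x: "x \<in> carrier P" for x
    proof -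
      have "lincomb ?A (s x) (v \<oplus>\<^bsub>?F n\<^esub> w) n = lincomb ?A (s x) (\<lambda>i. v i \<oplus>\<^bsub>?A\<^esub> w i) n"
        by (rule lincomb_cong) simp_all
      also have "\<dots> = lincomb ?A (s x) v n \<oplus>\<^bsub>?A\<^esub> lincomb ?A (s x) w n"
        using vw x s_mem by (intro lincomb_add_right[OF A']) auto
      finally show ?thesis by simp
    qed
    then show "T (v \<oplus>\<^bsub>?F n\<^esub> w) = T v \<oplus>\<^bsub>dual A P\<^esub> T w"
      by (auto simp: T_def simp del: free_module_simps intro!: restrict_ext)
  next
    fix a v assume a: "a \<in> carrier (opposite_ring A)" and v: "v \<in> carrier (?F n)"
    have "lincomb ?A (s x) (a \<odot>\<^bsub>?F n\<^esub> v) n = lincomb ?A (s x) v n \<otimes>\<^bsub>A\<^esub> a"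
      if x: "x \<in> carrier P" for x
    proof -
      have "lincomb ?A (s x) (a \<odot>\<^bsub>?F n\<^esub> v) n = lincomb ?A (s x) (\<lambda>i. v i \<otimes>\<^bsub>A\<^esub> a) n"
        by (rule lincomb_cong) simp_all
      also have "\<dots> = lincomb ?A (s x) v n \<otimes>\<^bsub>A\<^esub> a"
        using a v x s_mem
        by (intro lin_map_lincomb[OF A' A' lin_map_right_mult[OF A], symmetric]) auto
      finally show ?thesis .
    qed
    then show "T (a \<odot>\<^bsub>?F n\<^esub> v) = a \<odot>\<^bsub>dual A P\<^esub> T v"
      by (auto simp: T_def simp del: free_module_simps intro!: restrict_ext)
  qed
  show ?thesis
  proof (rule in_add_retract[OF in_add_free[OF ring_opposite[OF A]] left_module_dual[OF P'] S T])
    fix f assume f: "f \<in> carrier (dual A P)"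
    note fl = dualD(1)[OF f]
    show "T (S f) = f"
    proof (rule dual_eqI[OF _ dualD(2)[OF f]])
      fix x assume x: "x \<in> carrier P"
      have "lincomb ?A (s x) (S f) n = lincomb ?A (s x) (\<lambda>i. f (r (unit_vector A n i))) n"
        by (rule lincomb_cong) (simp_all add: S_def)
      also have "\<dots> = f (r (s x))"
        by (rule lin_map_free_expand[OF A' lin_map_comp[OF r fl] lin_map_closed[OF s x], symmetric])
      finally show "T (S f) x = f x" using x rs by (simp add: T_def)
    qed (simp add: T_def)
  qed
qed

definition dual_map :: "('a, 'y) module \<Rightarrow> ('y \<Rightarrow> 'p) \<Rightarrow> ('p \<Rightarrow> 'a) \<Rightarrow> 'y \<Rightarrow> 'a" where
  "dual_map Y \<phi> f = (\<lambda>y\<in>carrier Y. f (\<phi> y))"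

lemma lin_map_dual_map:
  assumes Y: "left_module A Y" and \<phi>: "lin_map A Y P \<phi>"
  shows "lin_map (opposite_ring A) (dual A P) (dual A Y) (dual_map Y \<phi>)"
proof (rule lin_mapI)
  fix f assume "f \<in> carrier (dual A P)"
  then show "dual_map Y \<phi> f \<in> carrier (dual A Y)"
    using restrict_lin_maps[OF Y lin_map_comp[OF \<phi> dualD(1)]] by (simp add: dual_map_def)
qed (use lin_map_closed[OF \<phi>] in \<open>auto simp: dual_map_def intro!: restrict_ext\<close>)

text \<open>Approximations are tested on modules with elements in
  \<open>nat \<Rightarrow> 'a\<close>, so a map to \<open>A\<close> enters as a map to the free
  module of rank one, and its extension is read off at coordinate 0.\<close>

lemma left_add_approximation_extend:
  fixes A :: "'a ring"
  assumes appr: "left_add_approximation A Y P \<phi>" and Y: "left_module A Y"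
    and l: "lin_map A Y (regular_module A) l"
  shows "\<exists>l'. lin_map A P (regular_module A) l' \<and> (\<forall>y \<in> carrier Y. l y = l' (\<phi> y))"
proof -
  note A = left_module_ring[OF Y]
  let ?F = "free_module A 1"
  have "lin_map A Y ?F (\<lambda>y. \<lambda>i\<in>{..<1}. l y)"
    using l by (intro lin_mapI) (auto simp: lin_map_def)
  then have "restrict (\<lambda>y. \<lambda>i\<in>{..<1}. l y) (carrier Y) \<in> lin_maps A Y ?F"
    by (rule restrict_lin_maps[OF Y])
  then obtain g where g: "g \<in> lin_maps A P ?F"
    "\<forall>y \<in> carrier Y. restrict (\<lambda>y. \<lambda>i\<in>{..<1}. l y) (carrier Y) y = g (\<phi> y)"
    using appr in_add_free[OF A, of 1] unfolding left_add_approximation_def by blast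
  have "lin_map A P (regular_module A) (\<lambda>x. g x 0)"
    using g(1) by (intro lin_mapI) (auto simp: lin_maps_iff lin_map_def PiE_iff)
  moreover have "l y = g (\<phi> y) 0" if "y \<in> carrier Y" for y
    using g(2) that by (metis lessThan_iff less_one restrict_apply')
  ultimately show ?thesis by blast
qed

text \<open>
  Transposing along the antidiagonal identifies the opposite of \<open>T2 A\<close> with \<open>T2\<close> of the opposite of
  \<open>A\<close>.
\<close>

definition flip :: "'a \<times> 'a \<times> 'a \<Rightarrow> 'a \<times> 'a \<times> 'a" where
  "flip = (\<lambda>(a1, a2, a3). (a3, a2, a1))"

lemma flip_simps [simp]: "flip (a1, a2, a3) = (a3, a2, a1)"
  by (simp add: flip_def)

lemma corner_iso_flip:
  assumes "ring A"
  shows "corner_iso (T2 (opposite_ring A)) (opposite_ring (T2 A)) flip flip"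
proof -
  interpret A: ring A by fact
  note rings = ring_T2[OF ring_opposite[OF assms]] ring_opposite[OF ring_T2[OF assms]]
  show ?thesis
    by (intro corner_iso.intro corner_iso_axioms.intro corner.intro corner_axioms.intro rings)
      (auto simp: A.a_ac)
qed

text \<open>Since e12 (0, y) = (\<phi> y, 0), the value at (\<phi> y, 0) is e12 F (0, y), which has
  the lower entry of F (0, y) in the middle and zero in front. This both computes the dual and shows
  that y is seen only through \<phi> y.\<close>

lemma T2_module_map:
  assumes P: "left_module A P" and Y: "left_module A Y" and \<phi>: "lin_map A Y P \<phi>"
    and F: "lin_map (T2 A) (T2_module P Y \<phi>) (regular_module (T2 A)) F"
    and x: "x \<in> carrier P" and y: "y \<in> carrier Y"
  shows "F (x, y) = (fst (F (x, \<zero>\<^bsub>Y\<^esub>)), fst (snd (F (x, \<zero>\<^bsub>Y\<^esub>))), fst (snd (F (\<phi> y, \<zero>\<^bsub>Y\<^esub>))))"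
    and "fst (F (\<phi> y, \<zero>\<^bsub>Y\<^esub>)) = \<zero>\<^bsub>A\<^esub>"
proof -
  note A = left_module_ring[OF P]
  interpret A: ring A by (rule A)
  interpret P: left_module A P by (rule P)
  interpret Y: left_module A Y by (rule Y)
  have mem: "fst (F z) \<in> carrier A" "fst (snd (F z)) \<in> carrier A" "snd (snd (F z)) \<in> carrier A"
    if "z \<in> carrier (T2_module P Y \<phi>)" for z
    using lin_map_closed[OF F that] by (auto simp: mem_Times_iff)
  have \<phi>y: "\<phi> y \<in> carrier P" by (rule lin_map_closed[OF \<phi> y])
  have \<phi>0: "\<phi> \<zero>\<^bsub>Y\<^esub> = \<zero>\<^bsub>P\<^esub>" by (rule lin_map_zero[OF Y P \<phi>])
  have smult: "F ((a1, a2, a3) \<odot>\<^bsub>T2_module P Y \<phi>\<^esub> (p, q)) = (a1 \<otimes>\<^bsub>A\<^esub> fst (F (p, q)),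
      a1 \<otimes>\<^bsub>A\<^esub> fst (snd (F (p, q))) \<oplus>\<^bsub>A\<^esub> a2 \<otimes>\<^bsub>A\<^esub> snd (snd (F (p, q))), a3 \<otimes>\<^bsub>A\<^esub> snd (snd (F (p, q))))"
    if "a1 \<in> carrier A" "a2 \<in> carrier A" "a3 \<in> carrier A" "p \<in> carrier P" "q \<in> carrier Y" for a1 a2 a3 p q
    using that by (subst lin_map_smult[OF F]) (auto, cases "F (p, q)", simp)
  \<comment> \<open>The diagonal idempotents fix (x, 0) and (0, y), which forces the zero entries
    here and in \<open>bot\<close>.\<close>
  have top: "F (x, \<zero>\<^bsub>Y\<^esub>) = (fst (F (x, \<zero>\<^bsub>Y\<^esub>)), fst (snd (F (x, \<zero>\<^bsub>Y\<^esub>))), \<zero>\<^bsub>A\<^esub>)"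
    using smult[of "\<one>\<^bsub>A\<^esub>" "\<zero>\<^bsub>A\<^esub>" "\<zero>\<^bsub>A\<^esub>" x "\<zero>\<^bsub>Y\<^esub>"] x mem[of "(x, \<zero>\<^bsub>Y\<^esub>)"]
    by (simp add: \<phi>0 P.smult_one P.zero_smult Y.zero_smult)
  have bot: "F (\<zero>\<^bsub>P\<^esub>, y) = (\<zero>\<^bsub>A\<^esub>, \<zero>\<^bsub>A\<^esub>, snd (snd (F (\<zero>\<^bsub>P\<^esub>, y))))"
    using smult[of "\<zero>\<^bsub>A\<^esub>" "\<zero>\<^bsub>A\<^esub>" "\<one>\<^bsub>A\<^esub>" "\<zero>\<^bsub>P\<^esub>" y] y mem[of "(\<zero>\<^bsub>P\<^esub>, y)"]
    by (simp add: \<phi>y P.zero_smult Y.smult_one)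
  have off: "F (\<phi> y, \<zero>\<^bsub>Y\<^esub>) = (\<zero>\<^bsub>A\<^esub>, snd (snd (F (\<zero>\<^bsub>P\<^esub>, y))), \<zero>\<^bsub>A\<^esub>)"
    using smult[of "\<zero>\<^bsub>A\<^esub>" "\<one>\<^bsub>A\<^esub>" "\<zero>\<^bsub>A\<^esub>" "\<zero>\<^bsub>P\<^esub>" y] y mem[of "(\<zero>\<^bsub>P\<^esub>, y)"]
    by (simp add: \<phi>y P.zero_smult P.smult_one Y.zero_smult)
  then show "fst (F (\<phi> y, \<zero>\<^bsub>Y\<^esub>)) = \<zero>\<^bsub>A\<^esub>" by simp
  have "F (x, y) = F (x, \<zero>\<^bsub>Y\<^esub>) \<oplus>\<^bsub>T2 A\<^esub> F (\<zero>\<^bsub>P\<^esub>, y)"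
    using lin_map_add[OF F, of "(x, \<zero>\<^bsub>Y\<^esub>)" "(\<zero>\<^bsub>P\<^esub>, y)"] x y by simp
  also have "\<dots> = (fst (F (x, \<zero>\<^bsub>Y\<^esub>)), fst (snd (F (x, \<zero>\<^bsub>Y\<^esub>))), fst (snd (F (\<phi> y, \<zero>\<^bsub>Y\<^esub>))))"
    by (subst top, subst bot) (use off mem[of "(x, \<zero>\<^bsub>Y\<^esub>)"] mem[of "(\<zero>\<^bsub>P\<^esub>, y)"] x y in simp)
  finally show "F (x, y) = (fst (F (x, \<zero>\<^bsub>Y\<^esub>)), fst (snd (F (x, \<zero>\<^bsub>Y\<^esub>))), fst (snd (F (\<phi> y, \<zero>\<^bsub>Y\<^esub>))))" .
qed

text \<open>The dual of the triple \<open>\<phi> : Y \<rightarrow> P\<close> is the inclusion into \<open>P\<^sup>*\<close> of the kernel of \<open>\<phi>\<^sup>*\<close>.\<close>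

lemma semi_Gorenstein_projective_dual_T2_module:
  fixes A :: "'a ring"
  assumes sGp: "semi_Gorenstein_projective (opposite_ring A) (dual A Y)"
    and Y: "left_module A Y" and P: "in_add A P" and \<phi>: "lin_map A Y P \<phi>"
    and ext: "\<And>l. lin_map A Y (regular_module A) l \<Longrightarrow>
      \<exists>l'. lin_map A P (regular_module A) l' \<and> (\<forall>y \<in> carrier Y. l y = l' (\<phi> y))"
  shows "semi_Gorenstein_projective (opposite_ring (T2 A)) (dual (T2 A) (T2_module P Y \<phi>))"
proof -
  note P' = in_add_left_module[OF P]
  note A = left_module_ring[OF P']
  interpret A: ring A by (rule A)
  interpret P: left_module A P by (rule P')
  interpret Y: left_module A Y by (rule Y)
  interpret flip: corner_iso "T2 (opposite_ring A)" "opposite_ring (T2 A)" flip flip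
    by (rule corner_iso_flip[OF A])
  let ?A = "regular_module A" and ?M = "T2_module P Y \<phi>"
  let ?D = "dual (T2 A) ?M" and ?S = "T2 (opposite_ring A)"
  let ?E = "corner_module ?S flip ?D"
  let ?K = "kernel_of (dual A P) (dual A Y) (dual_map Y \<phi>)"
  let ?N = "T2_module (dual A P) ?K (\<lambda>f. f)"
  note M = left_module_T2_module[OF P' Y \<phi>]
  note \<pi> = lin_map_dual_map[OF Y \<phi>]
  note dP = left_module_dual[OF P'] and dY = left_module_dual[OF Y]
  \<comment> \<open>The extension property is surjectivity of the dual map; it exhibits the kernel
    as a syzygy of the dual of \<open>Y\<close>.\<close>
  have surj: "dual_map Y \<phi> ` carrier (dual A P) = carrier (dual A Y)"
  proof (intro subset_antisym subsetI)
    fix l assume l: "l \<in> carrier (dual A Y)"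
    obtain l' where l': "lin_map A P ?A l'" "\<forall>y \<in> carrier Y. l y = l' (\<phi> y)"
      using ext[OF dualD(1)[OF l]] by blast
    have "l = dual_map Y \<phi> (restrict l' (carrier P))"
      by (rule dual_eqI[OF dualD(2)[OF l]])
        (use l'(2) lin_map_closed[OF \<phi>] in \<open>simp_all add: dual_map_def\<close>)
    then show "l \<in> dual_map Y \<phi> ` carrier (dual A P)"
      using restrict_lin_maps[OF P' l'(1)] by simp
  qed (use lin_map_closed[OF \<pi>] in auto)
  note K = semi_Gorenstein_projective_kernel[OF sGp in_add_dual[OF P] \<pi> surj]
  \<comment> \<open>The criterion over the opposite ring, with the dual of \<open>P\<close> on top
    and the kernel at the bottom; \<open>K(2)\<close> supplies the extension of maps.\<close>
  have N: "semi_Gorenstein_projective ?S ?N"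
    by (rule semi_Gorenstein_projective_T2_module[OF K(1) in_add_dual[OF P] lin_map_kernel_incl])
      (erule K(2))
  have K_iff: "w \<in> carrier ?K \<longleftrightarrow> w \<in> carrier (dual A P) \<and> (\<forall>y \<in> carrier Y. w (\<phi> y) = \<zero>\<^bsub>A\<^esub>)" for w
    by (auto simp: dual_map_def fun_eq_iff)
  \<comment> \<open>\<open>w\<close> is the first column and so must kill the image of \<phi>;
    \<open>u\<close> is the second. Right multiplication by the off-diagonal unit moves the first
    column into the second, so after \<open>flip\<close> the pair has \<open>u\<close> on top and
    \<open>w\<close> at the bottom.\<close>
  define h where "h = (\<lambda>(u, w). \<lambda>(x, y)\<in>carrier ?M. (w x, u x, u (\<phi> y)) :: 'a \<times> 'a \<times> 'a)"
  \<comment> \<open>By \<open>T2_module_map\<close> the two upper entries on the top of the triple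
    determine F.\<close>
  define k where "k = (\<lambda>F. (\<lambda>x\<in>carrier P. fst (snd (F (x, \<zero>\<^bsub>Y\<^esub>))) :: 'a,
    \<lambda>x\<in>carrier P. fst (F (x, \<zero>\<^bsub>Y\<^esub>) :: 'a \<times> 'a \<times> 'a)))"
  have D: "carrier ?E = carrier ?D"
    by (rule flip.carrier_part[OF left_module_dual[OF M]])
  have h_closed: "h (u, w) \<in> carrier ?D" if u: "u \<in> carrier (dual A P)" and w: "w \<in> carrier ?K" for u w
  proof -
    have w': "w \<in> carrier (dual A P)" "\<And>y. y \<in> carrier Y \<Longrightarrow> w (\<phi> y) = \<zero>\<^bsub>A\<^esub>"
      using w unfolding K_iff by auto
    note ul = dualD(1)[OF u] and wl = dualD(1)[OF w'(1)]
    note u_simps = lin_map_add[OF ul] lin_map_smult[OF ul]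
      and w_simps = lin_map_add[OF wl] lin_map_smult[OF wl]
    note \<phi>_simps = lin_map_closed[OF \<phi>] lin_map_add[OF \<phi>] lin_map_smult[OF \<phi>]
    note mem = dual_closed[OF u] dual_closed[OF w'(1)]
    have "lin_map (T2 A) ?M (regular_module (T2 A)) (\<lambda>(x, y). (w x, u x, u (\<phi> y)))"
      by (rule lin_mapI) (auto simp: mem \<phi>_simps u_simps w_simps w'(2) P.smult_closed)
    from restrict_lin_maps[OF M this] show ?thesis by (simp add: h_def)
  qed
  have k_closed: "k F \<in> carrier ?N" if "F \<in> carrier ?D" for F
  proof -
    note F = dualD(1)[OF that]
    note repr = T2_module_map[OF P' Y \<phi> F]
    have mem: "fst (F z) \<in> carrier A" "fst (snd (F z)) \<in> carrier A" "snd (snd (F z)) \<in> carrier A"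
      if "z \<in> carrier ?M" for z
      using lin_map_closed[OF F that] by (auto simp: mem_Times_iff)
    have add: "F (x \<oplus>\<^bsub>P\<^esub> x', \<zero>\<^bsub>Y\<^esub>) = F (x, \<zero>\<^bsub>Y\<^esub>) \<oplus>\<^bsub>T2 A\<^esub> F (x', \<zero>\<^bsub>Y\<^esub>)"
      if "x \<in> carrier P" "x' \<in> carrier P" for x x'
      using lin_map_add[OF F, of "(x, \<zero>\<^bsub>Y\<^esub>)" "(x', \<zero>\<^bsub>Y\<^esub>)"] that by simp
    have smult: "F (a \<odot>\<^bsub>P\<^esub> x, \<zero>\<^bsub>Y\<^esub>) = (a, \<zero>\<^bsub>A\<^esub>, \<zero>\<^bsub>A\<^esub>) \<otimes>\<^bsub>T2 A\<^esub> F (x, \<zero>\<^bsub>Y\<^esub>)"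
      if "a \<in> carrier A" "x \<in> carrier P" for a x
      using lin_map_smult[OF F, of "(a, \<zero>\<^bsub>A\<^esub>, \<zero>\<^bsub>A\<^esub>)" "(x, \<zero>\<^bsub>Y\<^esub>)"] that
      by (simp add: lin_map_zero[OF Y P' \<phi>] P.zero_smult Y.zero_smult P.smult_closed)
    have "lin_map A P ?A (\<lambda>x. fst (snd (F (x, \<zero>\<^bsub>Y\<^esub>))))" "lin_map A P ?A (\<lambda>x. fst (F (x, \<zero>\<^bsub>Y\<^esub>)))"
      by (rule lin_mapI; simp add: mem add smult T2_add T2_mult)+
    then show ?thesis
      using restrict_lin_maps[OF P'] repr(2)[OF P.M.zero_closed] lin_map_closed[OF \<phi>]
      by (auto simp: k_def dual_map_def intro!: restrict_ext)
  qed
  have h: "lin_map ?S ?N ?E h"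
  proof (rule lin_mapI)
    fix z assume "z \<in> carrier ?N"
    then show "h z \<in> carrier ?E"
      unfolding D using h_closed by (cases z) simp
  next
    fix z z' assume z: "z \<in> carrier ?N" "z' \<in> carrier ?N"
    then show "h (z \<oplus>\<^bsub>?N\<^esub> z') = h z \<oplus>\<^bsub>?E\<^esub> h z'"
      using lin_map_closed[OF \<phi>] by (cases z; cases z') (auto simp: h_def restrict_def fun_eq_iff)
  next
    fix c z assume c: "c \<in> carrier ?S" and z: "z \<in> carrier ?N"
    obtain c1 c2 c3 where cc: "c = (c1, c2, c3)" by (cases c)
    obtain u w where zz: "z = (u, w)" by (cases z)
    have u: "u \<in> carrier (dual A P)" and w: "w \<in> carrier (dual A P)"
      and w\<phi>: "\<And>y. y \<in> carrier Y \<Longrightarrow> w (\<phi> y) = \<zero>\<^bsub>A\<^esub>"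
      using z K_iff[of w] by (auto simp: zz)
    show "h (c \<odot>\<^bsub>?N\<^esub> z) = c \<odot>\<^bsub>?E\<^esub> h z"
      using c lin_map_closed[OF \<phi>] dual_closed[OF u] dual_closed[OF w]
      by (auto simp: cc zz h_def restrict_def fun_eq_iff w\<phi> A.a_comm)
  qed
  have kh: "k (h z) = z" if "z \<in> carrier ?N" for z
  proof -
    obtain u w where zz: "z = (u, w)" by (cases z)
    have "u \<in> extensional (carrier P)" "w \<in> extensional (carrier P)"
      using that dualD(2)[of _ A P] by (auto simp: zz)
    then show ?thesis
      by (auto simp: zz h_def k_def restrict_def fun_eq_iff extensional_def)
  qed
  have hk: "h (k F) = F" if F: "F \<in> carrier ?D" for F
  proof (rule dual_eqI[OF _ dualD(2)[OF F]])
    fix z assume "z \<in> carrier ?M"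
    then obtain x y where z: "z = (x, y)" "x \<in> carrier P" "y \<in> carrier Y" by auto
    show "h (k F) z = F z"
      unfolding z(1) T2_module_map(1)[OF P' Y \<phi> dualD(1)[OF F] z(2,3)]
      using z(2,3) lin_map_closed[OF \<phi>] by (simp add: h_def k_def)
  qed (simp add: h_def k_def)
  have k: "lin_map ?S ?E ?N k"
    by (rule lin_map_inverse[OF h])
      (use N k_closed hk kh in \<open>simp_all only: D semi_Gorenstein_projective_iff\<close>)
  have "semi_Gorenstein_projective ?S ?E"
    by (rule semi_Gorenstein_projective_lin_iso[OF N flip.fwd.left_module_part[OF left_module_dual[OF M]] h k])
      (simp_all only: D hk kh)
  then show ?thesis
    by (rule flip.semi_Gorenstein_projective_part[OF _ left_module_dual[OF M]])
qed

text \<open>The coordinates of a projective module inside a free one, composed with \<phi>, are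
  functionals that separate the points of \<open>Y\<close>.\<close>

lemma torsionless_if_monic:
  assumes Y: "left_module A Y" and P: "in_add A P" and \<phi>: "lin_map A Y P \<phi>"
    and inj: "inj_on \<phi> (carrier Y)"
  shows "torsionless A Y"
  unfolding torsionless_def
proof (rule inj_onI)
  fix x y assume xy: "x \<in> carrier Y" "y \<in> carrier Y"
    and eq: "canonical_map A Y x = canonical_map A Y y"
  obtain n s r where s: "lin_map A P (free_module A n) s" and rs: "\<forall>x \<in> carrier P. r (s x) = x"
    using P unfolding in_add_iff by blast
  note s\<phi> = lin_map_comp[OF \<phi> s]
  have "s (\<phi> x) i = s (\<phi> y) i" if "i < n" for i
  proof -
    have "lin_map A Y (regular_module A) (\<lambda>z. s (\<phi> z) i)"
      using s\<phi> that by (intro lin_mapI) (auto simp: lin_map_def PiE_iff)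
    then have "restrict (\<lambda>z. s (\<phi> z) i) (carrier Y) \<in> carrier (dual A Y)"
      using restrict_lin_maps[OF Y] by simp
    then show ?thesis
      using fun_cong[OF eq, of "restrict (\<lambda>z. s (\<phi> z) i) (carrier Y)"] xy
      by (simp add: canonical_map_def)
  qed
  then have "s (\<phi> x) = s (\<phi> y)"
    using lin_map_closed[OF s\<phi> xy(1)] lin_map_closed[OF s\<phi> xy(2)]
    by (intro PiE_ext[of _ "{..<n}" "\<lambda>_. carrier A"]) auto
  then have "\<phi> x = \<phi> y" using rs lin_map_closed[OF \<phi>] xy by metis
  then show "x = y" using inj xy by (simp add: inj_on_eq_iff)
qed

text \<open>By \<open>T2_module_map\<close> every map to \<open>T2 A\<close> takes equal values at
  (0, x) and (0, y) when \<phi> x = \<phi> y.\<close>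

lemma monic_if_torsionless_T2_module:
  assumes P: "left_module A P" and Y: "left_module A Y" and \<phi>: "lin_map A Y P \<phi>"
    and tl: "torsionless (T2 A) (T2_module P Y \<phi>)"
  shows "inj_on \<phi> (carrier Y)"
proof (rule inj_onI)
  fix x y assume xy: "x \<in> carrier Y" "y \<in> carrier Y" and eq: "\<phi> x = \<phi> y"
  interpret P: abelian_group P by (rule left_module_group[OF P])
  have "F (\<zero>\<^bsub>P\<^esub>, x) = F (\<zero>\<^bsub>P\<^esub>, y)" if "F \<in> carrier (dual (T2 A) (T2_module P Y \<phi>))" for F
    using T2_module_map(1)[OF P Y \<phi> dualD(1)[OF that] P.zero_closed] xy eq by simp
  then have "canonical_map (T2 A) (T2_module P Y \<phi>) (\<zero>\<^bsub>P\<^esub>, x) = canonical_map (T2 A) (T2_module P Y \<phi>) (\<zero>\<^bsub>P\<^esub>, y)"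
    using xy by (auto simp: canonical_map_def simp del: dual_simps intro!: restrict_ext)
  then have "(\<zero>\<^bsub>P\<^esub>, x) = (\<zero>\<^bsub>P\<^esub>, y)"
    using tl xy unfolding torsionless_def by (elim inj_onD) simp_all
  then show "x = y" by simp
qed

theorem theorem1p7:
  fixes k :: "'k ring" and \<eta> :: "'k \<Rightarrow> 'a" and A :: "'a ring"
    and Y :: "('a, 'y) module" and P :: "('a, 'p) module" and \<phi> :: "'y \<Rightarrow> 'p"
  assumes "artin_algebra k \<eta> A"
    and "double_semi_Gorenstein_projective A Y"
    and "\<not> torsionless A Y"
    and "left_add_approximation A Y P \<phi>"
  shows "double_semi_Gorenstein_projective (T2 A) (T2_module P Y \<phi>)
    \<and> \<not> monic_triple P Y \<phi>
    \<and> \<not> torsionless (T2 A) (T2_module P Y \<phi>)"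
proof -
  have sGp: "semi_Gorenstein_projective A Y" "semi_Gorenstein_projective (opposite_ring A) (dual A Y)"
    using assms(2) by (simp_all add: double_semi_Gorenstein_projective_def)
  have Y: "left_module A Y" using sGp(1) by (simp add: semi_Gorenstein_projective_iff)
  have P: "in_add A P" and \<phi>: "lin_map A Y P \<phi>"
    using assms(4) by (simp_all add: left_add_approximation_def lin_maps_iff)
  note ext = left_add_approximation_extend[OF assms(4) Y]
  have "semi_Gorenstein_projective (T2 A) (T2_module P Y \<phi>)"
    by (rule semi_Gorenstein_projective_T2_module[OF sGp(1) P \<phi> ext])
  moreover have "semi_Gorenstein_projective (opposite_ring (T2 A)) (dual (T2 A) (T2_module P Y \<phi>))"
    by (rule semi_Gorenstein_projective_dual_T2_module[OF sGp(2) Y P \<phi> ext])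
  moreover have "\<not> inj_on \<phi> (carrier Y)"
    using torsionless_if_monic[OF Y P \<phi>] assms(3) by blast
  ultimately show ?thesis
    using monic_if_torsionless_T2_module[OF in_add_left_module[OF P] Y \<phi>]
    by (auto simp: double_semi_Gorenstein_projective_def monic_triple_def)
qed

end
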